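(* Consider a family of systems indexed by the number of qubits $n$, with states $\rho$, traceless Hermitian observables $H$, Hermitian generators $G$ (so that $\mathcal E_\phi(\cdot)=e^{i\phi G}\cdot e^{-i\phi G}$ is a unitary entangling gate), number of layers $L$, and an initialization distribution of the real parameter $\phi$ with mean $\mu$ and variance $\sigma^2$ (all may depend on $n$). Let $\mathbb V^L_{\rho,H}$ be the variance, over $\theta$ and $\phi$, of $\mathrm{Tr}[\Phi_{\theta,\phi}(\rho)H]$ for the layered circuit $\Phi_{\theta,\phi}$ of the context. If $\mu=0$, $\sigma^2\in O\!\big(\log n/(\|G\|_2^2L)\big)$ and $L\in\Omega(\log^{1+\epsilon}n)$ for some $\epsilon>0$, then $$\mathbb V^L_{\rho,H}\ \ge\ F(n)\,(\ell_\rho,\ell_H),$$ where $F(n)\in\Omega(1/\mathrm{poly}(n))$.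
   Context: Locality. Let $\mathcal H=\bigotimes_{m=1}^M\mathcal H_m$ be the Hilbert space of $n$ qubits, where each $\mathcal H_m$ (of dimension $d_m$) is a single qubit or a group of qubits. Let $\mathcal B$ be the space of linear operators on $\mathcal H$. For $\kappa\in\{0,1\}^M$ let $\mathcal B_\kappa\subset\mathcal B$ be the span of the operators $\bigotimes_m A_m$ with $A_m=\mathbb 1$ if $\kappa_m=0$ and $\mathrm{Tr}[A_m]=0$ if $\kappa_m=1$. Then $\mathcal B=\bigoplus_\kappa\mathcal B_\kappa$ and $d_\kappa:=\dim\mathcal B_\kappa=\prod_m(d_m^2-1)^{\kappa_m}$. For $A\in\mathcal B$ the locality vector $\ell_A$, indexed by $\{0,1\}^M$, is $(\ell_A)_\kappa=\sum_{j=1}^{d_\kappa}\mathrm{Tr}[B_jA]^2$, for any basis $\{B_j\}$ of $\mathcal B_\kappa$ consisting of Hermitian operators and orthonormal for the Hilbert–Schmidt product (the value does not depend on the basis). For vectors indexed by $\{0,1\}^M$, $(a,b)=\sum_\kappa a_\kappa b_\kappa/d_\kappa$. $\|\cdot\|_2$ is the Hilbert–Schmidt norm. Circuit. $\Phi_{\theta,\phi}=\mathcal U_{\theta_{L+1}}\circ\mathcal E_{\phi_L}\circ\mathcal U_{\theta_L}\circ\cdots\circ\mathcal E_{\phi_1}\circ\mathcal U_{\theta_1}$, where $\phi_1,\dots,\phi_L$ are independent samples of the distribution of $\phi$, independent of $\theta$, and $\mathcal U_{\theta_l}(\rho)=U_{\theta_l}\rho U_{\theta_l}^\dagger$ with $U_{\theta_l}=\bigotimes_m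 U^{(m)}_{\theta_l}$. The random unitaries $U^{(m)}_{\theta_l}$ are independent over all $l$ and $m$, and each forms a unitary $2$-design on $U(d_m)$: $\mathbb E[U^{\otimes2}\otimes (U^{*})^{\otimes 2}]$ equals the corresponding Haar average over $U(d_m)$. Here $F(n)\in\Omega(1/\mathrm{poly}(n))$ means $F(n)\ge c\,n^{-k}$ for some $c,k>0$ and all sufficiently large $n$. *)

theory Defs
  imports
    "HOL-Probability.Probability"
    "HOL-Library.Landau_Symbols"
    "Jordan_Normal_Form.Schur_Decomposition"
    "Jordan_Normal_Form.VS_Connect"
begin

section \<open>Matrices\<close>

definition mat_trace :: "complex mat \<Rightarrow> complex" where
  "mat_trace A = (\<Sum>i<dim_row A. A $$ (i, i))"

definition hermitian_mat :: "complex mat \<Rightarrow> bool" where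
  "hermitian_mat A \<longleftrightarrow> mat_adjoint A = A"

definition unitary_group :: "nat \<Rightarrow> complex mat set" where
  "unitary_group d = {V \<in> carrier_mat d d. mat_adjoint V * V = 1\<^sub>m d \<and> V * mat_adjoint V = 1\<^sub>m d}"

definition density_mat :: "nat \<Rightarrow> complex mat \<Rightarrow> bool" where
  "density_mat D \<rho> \<longleftrightarrow> \<rho> \<in> carrier_mat D D \<and> hermitian_mat \<rho> \<and>
     (\<forall>v \<in> carrier_vec D. 0 \<le> Re ((\<rho> *\<^sub>v v) \<bullet>c v)) \<and> mat_trace \<rho> = 1"

definition hs_inner :: "complex mat \<Rightarrow> complex mat \<Rightarrow> complex" where
  "hs_inner A B = mat_trace (mat_adjoint A * B)"

definition hs_norm :: "complex mat \<Rightarrow> real" where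
  "hs_norm A = sqrt (Re (hs_inner A A))"

definition mat_exp :: "complex mat \<Rightarrow> complex mat" where
  "mat_exp A = mat (dim_row A) (dim_row A) (\<lambda>ij. \<Sum>k. (A ^\<^sub>m k) $$ ij / fact k)"

definition kronecker :: "complex mat \<Rightarrow> complex mat \<Rightarrow> complex mat" where
  "kronecker A B = mat (dim_row A * dim_row B) (dim_col A * dim_col B)
     (\<lambda>(i, j). A $$ (i div dim_row B, j div dim_col B) * B $$ (i mod dim_row B, j mod dim_col B))"

definition tensor_mats :: "complex mat list \<Rightarrow> complex mat" where
  "tensor_mats As = foldr kronecker As (1\<^sub>m 1)"


section \<open>Locality\<close>

text \<open>
  A list \<open>ds\<close> holds the dimensions of the tensor factors; for blocks of qubits of sizes \<open>qs\<close> it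
  is \<open>qubit_dims qs\<close>. Elements of \<open>{0,1}\<^sup>M\<close> are Boolean lists of length \<open>M = length ds\<close>.
\<close>

definition qubit_dims :: "nat list \<Rightarrow> nat list" where
  "qubit_dims qs = map (\<lambda>k. 2 ^ k) qs"

abbreviation operator_space :: "nat \<Rightarrow> (complex, complex mat) module" where
  "operator_space D \<equiv> module_mat TYPE(complex) D D"

definition sector_tensors :: "nat list \<Rightarrow> bool list \<Rightarrow> complex mat set" where
  "sector_tensors ds \<kappa> = {tensor_mats As | As. length As = length ds \<and>
     (\<forall>m < length ds. As ! m \<in> carrier_mat (ds ! m) (ds ! m) \<and>
        (if \<kappa> ! m then mat_trace (As ! m) = 0 else As ! m = 1\<^sub>m (ds ! m)))}"

definition sector :: "nat list \<Rightarrow> bool list \<Rightarrow> (complex, complex mat) module" where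
  "sector ds \<kappa> = (operator_space (prod_list ds))
     \<lparr>carrier := LinearCombinations.module.span class_ring (operator_space (prod_list ds))
        (sector_tensors ds \<kappa>)\<rparr>"

definition sector_dim :: "nat list \<Rightarrow> bool list \<Rightarrow> nat" where
  "sector_dim ds \<kappa> = vectorspace.dim class_ring (sector ds \<kappa>)"

definition hermitian_onb :: "nat list \<Rightarrow> bool list \<Rightarrow> complex mat set \<Rightarrow> bool" where
  "hermitian_onb ds \<kappa> S \<longleftrightarrow> vectorspace.basis class_ring (sector ds \<kappa>) S \<and>
     (\<forall>B \<in> S. hermitian_mat B) \<and>
     (\<forall>B \<in> S. \<forall>C \<in> S. hs_inner B C = (if B = C then 1 else 0))"

text \<open>
  A Hermitian orthonormal basis of the sector exists, and the sum does not depend on which one is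
  chosen. The locality vector is only used for Hermitian \<open>A\<close>, where \<open>Re\<close> drops nothing.
\<close>

definition locality :: "nat list \<Rightarrow> complex mat \<Rightarrow> bool list \<Rightarrow> real" where
  "locality ds A \<kappa> = Re (\<Sum>B \<in> (SOME S. hermitian_onb ds \<kappa> S). (mat_trace (B * A))\<^sup>2)"

definition locality_inner :: "nat list \<Rightarrow> (bool list \<Rightarrow> real) \<Rightarrow> (bool list \<Rightarrow> real) \<Rightarrow> real" where
  "locality_inner ds a b =
     (\<Sum>\<kappa> \<in> {\<kappa>. length \<kappa> = length ds}. a \<kappa> * b \<kappa> / real (sector_dim ds \<kappa>))"


section \<open>Random unitaries\<close>

text \<open>The Borel sigma-algebra of the unitary group, generated by the matrix entries.\<close>

definition unitary_borel :: "nat \<Rightarrow> complex mat measure" where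
  "unitary_borel d = vimage_algebra (unitary_group d)
     (\<lambda>V. \<lambda>ij \<in> {..<d} \<times> {..<d}. V $$ ij) (Pi\<^sub>M ({..<d} \<times> {..<d}) (\<lambda>_. borel))"

definition haar_unitary :: "nat \<Rightarrow> complex mat measure \<Rightarrow> bool" where
  "haar_unitary d \<mu> \<longleftrightarrow> prob_space \<mu> \<and> sets \<mu> = sets (unitary_borel d) \<and>
     (\<forall>W \<in> unitary_group d. distr \<mu> (unitary_borel d) (\<lambda>V. W * V) = \<mu> \<and>
                            distr \<mu> (unitary_borel d) (\<lambda>V. V * W) = \<mu>)"

definition second_moment :: "nat \<Rightarrow> complex mat measure \<Rightarrow> complex mat" where
  "second_moment d \<nu> = mat (d ^ 4) (d ^ 4)
     (\<lambda>ij. \<integral>V. tensor_mats [V, V, map_mat cnj V, map_mat cnj V] $$ ij \<partial>\<nu>)"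

text \<open>The Haar probability measure exists and is unique, so the quantifier merely names it.\<close>

definition unitary_2_design :: "nat \<Rightarrow> complex mat measure \<Rightarrow> bool" where
  "unitary_2_design d \<nu> \<longleftrightarrow> prob_space \<nu> \<and> sets \<nu> = sets (unitary_borel d) \<and>
     (\<exists>\<mu>. haar_unitary d \<mu> \<and> second_moment d \<nu> = second_moment d \<mu>)"


section \<open>The layered circuit\<close>

definition entangling_gate :: "complex mat \<Rightarrow> real \<Rightarrow> complex mat \<Rightarrow> complex mat" where
  "entangling_gate G x X =
     mat_exp ((\<i> * complex_of_real x) \<cdot>\<^sub>m G) * X * mat_exp ((- (\<i> * complex_of_real x)) \<cdot>\<^sub>m G)"

definition local_layer :: "nat \<Rightarrow> (nat \<Rightarrow> complex mat) \<Rightarrow> complex mat \<Rightarrow> complex mat" where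
  "local_layer M u X = tensor_mats (map u [0..<M]) * X * mat_adjoint (tensor_mats (map u [0..<M]))"

text \<open>
  \<open>u l m\<close> is the unitary on factor \<open>m < M\<close> in local layer \<open>l \<in> {1..L+1}\<close>, and \<open>x l\<close> the
  parameter of the entangling gate that follows local layer \<open>l \<in> {1..L}\<close>.
\<close>

primrec circuit :: "nat \<Rightarrow> complex mat \<Rightarrow> (nat \<Rightarrow> nat \<Rightarrow> complex mat) \<Rightarrow> (nat \<Rightarrow> real) \<Rightarrow>
    nat \<Rightarrow> complex mat \<Rightarrow> complex mat" where
  "circuit M G u x 0 X = local_layer M (u 1) X"
| "circuit M G u x (Suc L) X =
     local_layer M (u (L + 2)) (entangling_gate G (x (L + 1)) (circuit M G u x L X))"

definition layer_index :: "nat \<Rightarrow> nat \<Rightarrow> (nat \<times> nat) set" where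
  "layer_index M L = {1..L + 1} \<times> {..<M}"

locale random_layered_circuit = prob_space P for P :: "'w measure" +
  fixes ds :: "nat list" and L :: nat and \<nu> :: "real measure"
    and U :: "nat \<Rightarrow> nat \<Rightarrow> 'w \<Rightarrow> complex mat" and \<phi> :: "nat \<Rightarrow> 'w \<Rightarrow> real"
  assumes U_design: "\<And>l m. (l, m) \<in> layer_index (length ds) L \<Longrightarrow>
      U l m \<in> measurable P (unitary_borel (ds ! m)) \<and>
      unitary_2_design (ds ! m) (distr P (unitary_borel (ds ! m)) (U l m))"
    and U_indep: "indep_vars (\<lambda>(l, m). unitary_borel (ds ! m)) (\<lambda>(l, m). U l m)
      (layer_index (length ds) L)"
    and \<phi>_distr: "\<And>l. l \<in> {1..L} \<Longrightarrow> \<phi> l \<in> borel_measurable P \<and> distr P borel (\<phi> l) = \<nu>"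
    and \<phi>_indep: "indep_vars (\<lambda>_. borel) \<phi> {1..L}"
    and U_\<phi>_indep: "indep_set
      (sets (vimage_algebra (space P)
        (\<lambda>\<omega>. \<lambda>(l, m) \<in> layer_index (length ds) L. U l m \<omega>)
        (Pi\<^sub>M (layer_index (length ds) L) (\<lambda>(l, m). unitary_borel (ds ! m)))))
      (sets (vimage_algebra (space P)
        (\<lambda>\<omega>. \<lambda>l \<in> {1..L}. \<phi> l \<omega>)
        (Pi\<^sub>M {1..L} (\<lambda>_. borel))))"

text \<open>For Hermitian \<open>\<rho>\<close> and \<open>H\<close> the trace in the loss is real.\<close>

definition loss :: "nat \<Rightarrow> nat \<Rightarrow> complex mat \<Rightarrow> complex mat \<Rightarrow> complex mat \<Rightarrow>
    (nat \<Rightarrow> nat \<Rightarrow> 'w \<Rightarrow> complex mat) \<Rightarrow> (nat \<Rightarrow> 'w \<Rightarrow> real) \<Rightarrow> 'w \<Rightarrow> real" where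
  "loss M L G \<rho> H U \<phi> \<omega> =
     Re (mat_trace (circuit M G (\<lambda>l m. U l m \<omega>) (\<lambda>l. \<phi> l \<omega>) L \<rho> * H))"

definition loss_variance :: "'w measure \<Rightarrow> nat \<Rightarrow> nat \<Rightarrow> complex mat \<Rightarrow> complex mat \<Rightarrow>
    complex mat \<Rightarrow> (nat \<Rightarrow> nat \<Rightarrow> 'w \<Rightarrow> complex mat) \<Rightarrow> (nat \<Rightarrow> 'w \<Rightarrow> real) \<Rightarrow> real" where
  "loss_variance P M L G \<rho> H U \<phi> = prob_space.variance P (loss M L G \<rho> H U \<phi>)"

definition inverse_poly_bounded :: "(nat \<Rightarrow> real) \<Rightarrow> bool" where
  "inverse_poly_bounded F \<longleftrightarrow>
     (\<exists>c > 0. \<exists>k > 0. \<forall>\<^sub>F n in sequentially. c * real n powr (- k) \<le> F n)"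

end

theory Submission
  imports Defs "Jordan_Normal_Form.Spectral_Radius"
begin

text \<open>
  Expand operators in tensor products of Hermitian orthonormal bases of the factors that contain the
  normalised identity; such a product lies in the sector \<open>\<kappa>\<close> that records which factors differ from
  the identity. The second moment of a local layer is diagonal in this basis and, starting from one
  basis element, spreads the weight uniformly over its sector. Hence the second moments of the
  coefficients of the state evolve by a matrix with nonnegative entries, and keeping only its
  diagonal part gives the lower bound \<open>t ^ L\<close> times \<open>(\<ell>\<^sub>\<rho>, \<ell>\<^sub>H)\<close>. Here
  \<open>t = 1 - 2 \<sigma>\<^sup>2 \<parallel>G\<parallel>\<^sup>2\<close>, cut off at \<open>0\<close>, bounds from below the expected squared overlap of a
  basis element with its image under the gate: in the eigenbasis of \<open>G\<close> that overlap is an average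
  of cosines. The variance equals the second
  moment for the shifted observable \<open>H - m 1\<close>, whose locality vector dominates that of \<open>H\<close>. Finally
  \<open>t ^ L\<close> is inversely polynomial because \<open>\<sigma>\<^sup>2 \<parallel>G\<parallel>\<^sup>2 \<rightarrow> 0\<close> while \<open>\<sigma>\<^sup>2 \<parallel>G\<parallel>\<^sup>2 L = O(log n)\<close>.
\<close>


subsection \<open>Matrices and Kronecker products\<close>

text \<open>The gates do not have diagonal second moments:
  \<open>gate_coeff \<gamma> \<beta>\<close> and \<open>gate_coeff \<gamma>' \<beta>'\<close> may be
  correlated. The cross terms vanish only because each gate sits between two local layers: the
  earlier one forces \<open>\<beta> = \<beta>'\<close>, the later one
  \<open>\<gamma> = \<gamma>'\<close>. The induction over the layers therefore carries an arbitrary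
  product of test functions of the layers still to come, into which the coefficients of a layer are
  absorbed before independence is applied. The diagonal form for one block comes from classifying
  bilinear forms invariant under unitary conjugation: x Tr A Tr A' + y Tr (A A'). Monomial unitaries
  and one Hadamard matrix suffice. This is done for the Haar measure and passes to designs because
  only moments of degree two in V and two in its conjugate occur. The factor 2 in \<open>t\<close>
  comes from y^2 >= 2 y - 1, which asks only for the second moment of the parameter. The shift
  \<open>m\<close> is the mean of the loss; conjugations preserve the trace, so the variance becomes
  a second moment and no first moments have to be computed.\<close>

declare index_mult_mat(1) [simp del]

lemma mat_adjoint_dim [simp]: "dim_row (mat_adjoint A) = dim_col A" "dim_col (mat_adjoint A) = dim_row A"
  by (auto simp: mat_adjoint_def)

lemma mat_adjoint_carrier [simp]: "A \<in> carrier_mat n m \<Longrightarrow> mat_adjoint A \<in> carrier_mat m n"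
  by (intro carrier_matI) auto

lemma mat_adjoint_index [simp]:
  "i < dim_col A \<Longrightarrow> j < dim_row A \<Longrightarrow> mat_adjoint A $$ (i, j) = cnj (A $$ (j, i))"
  by (simp add: mat_adjoint_def mat_of_rows_index)

lemma mat_mult_index:
  fixes A B :: "complex mat"
  assumes "A \<in> carrier_mat n m" "B \<in> carrier_mat m p" "i < n" "j < p"
  shows "(A * B) $$ (i, j) = (\<Sum>k<m. A $$ (i, k) * B $$ (k, j))"
  using assms by (auto simp: index_mult_mat(1) scalar_prod_def lessThan_atLeast0 intro!: sum.cong)

lemma mat_mult3_index:
  fixes A B C :: "complex mat"
  assumes "A \<in> carrier_mat n m" "B \<in> carrier_mat m p" "C \<in> carrier_mat p q" "i < n" "j < q"
  shows "(A * B * C) $$ (i, j) = (\<Sum>k<m. \<Sum>l<p. A $$ (i, k) * B $$ (k, l) * C $$ (l, j))"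
proof -
  have "(A * B * C) $$ (i, j) = (\<Sum>l<p. (\<Sum>k<m. A $$ (i, k) * B $$ (k, l)) * C $$ (l, j))"
    using assms by (subst mat_mult_index[of _ n p _ q]) (auto simp: mat_mult_index[of A n m B p] intro!: sum.cong)
  also have "\<dots> = (\<Sum>k<m. \<Sum>l<p. A $$ (i, k) * B $$ (k, l) * C $$ (l, j))"
    by (subst sum.swap) (simp add: sum_distrib_right)
  finally show ?thesis .
qed

lemma mat_adjoint_adjoint [simp]: "mat_adjoint (mat_adjoint A) = (A :: complex mat)"
  by (rule eq_matI) auto

lemma mat_adjoint_mult:
  fixes A B :: "complex mat"
  assumes "A \<in> carrier_mat n m" "B \<in> carrier_mat m p"
  shows "mat_adjoint (A * B) = mat_adjoint B * mat_adjoint A"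
proof (rule eq_matI)
  fix i j assume "i < dim_row (mat_adjoint B * mat_adjoint A)" "j < dim_col (mat_adjoint B * mat_adjoint A)"
  then have ij: "i < p" "j < n" using assms by auto
  have "mat_adjoint (A * B) $$ (i, j) = cnj ((A * B) $$ (j, i))"
    using assms ij by simp
  also have "\<dots> = (\<Sum>k<m. mat_adjoint B $$ (i, k) * mat_adjoint A $$ (k, j))"
    unfolding mat_mult_index[OF assms ij(2,1)] using assms ij
    by (auto intro!: sum.cong)
  also have "\<dots> = (mat_adjoint B * mat_adjoint A) $$ (i, j)"
    by (rule mat_mult_index[symmetric]) (use assms ij in auto)
  finally show "mat_adjoint (A * B) $$ (i, j) = (mat_adjoint B * mat_adjoint A) $$ (i, j)" .
qed (use assms in auto)

lemma mat_adjoint_one [simp]: "mat_adjoint (1\<^sub>m n) = (1\<^sub>m n :: complex mat)"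
  by (rule eq_matI) auto

lemma mat_adjoint_smult: "mat_adjoint (c \<cdot>\<^sub>m A) = cnj c \<cdot>\<^sub>m mat_adjoint (A :: complex mat)"
  by (rule eq_matI) auto

lemma mat_adjoint_diff:
  fixes A B :: "complex mat"
  assumes "A \<in> carrier_mat n m" "B \<in> carrier_mat n m"
  shows "mat_adjoint (A - B) = mat_adjoint A - mat_adjoint B"
  using assms by (intro eq_matI) auto

lemma mat_trace_mult:
  assumes "A \<in> carrier_mat n m" "B \<in> carrier_mat m n"
  shows "mat_trace (A * B) = (\<Sum>i<n. \<Sum>j<m. A $$ (i, j) * B $$ (j, i))"
  unfolding mat_trace_def using assms by (auto simp: mat_mult_index[OF assms] intro!: sum.cong)

lemma mat_trace_mult_comm:
  assumes "A \<in> carrier_mat n m" "B \<in> carrier_mat m n"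
  shows "mat_trace (A * B) = mat_trace (B * A)"
  unfolding mat_trace_mult[OF assms] mat_trace_mult[OF assms(2,1)]
  by (subst sum.swap) (simp add: mult.commute)

lemma mat_trace_smult [simp]: "mat_trace (c \<cdot>\<^sub>m A) = c * mat_trace A" if "A \<in> carrier_mat n n"
  using that by (auto simp: mat_trace_def sum_distrib_left)

lemma mat_trace_one [simp]: "mat_trace (1\<^sub>m n) = of_nat n"
  by (simp add: mat_trace_def)

lemma mat_trace_diff:
  assumes "A \<in> carrier_mat n n" "B \<in> carrier_mat n n"
  shows "mat_trace (A - B) = mat_trace A - mat_trace B"
  using assms by (auto simp: mat_trace_def sum_subtractf)

text \<open>Conjugation swaps the two indices of each factor. The lemma lets complex coefficients be
  treated as real, so that their squares are nonnegative.\<close>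

lemma cnj_mat_trace_hermitian:
  assumes "A \<in> carrier_mat n n" "B \<in> carrier_mat n n" "hermitian_mat A" "hermitian_mat B"
  shows "cnj (mat_trace (A * B)) = mat_trace (A * B)"
proof -
  have A: "cnj (A $$ (i, j)) = A $$ (j, i)" if "i < n" "j < n" for i j
    using assms that mat_adjoint_index[of j A i] unfolding hermitian_mat_def by auto
  have B: "cnj (B $$ (i, j)) = B $$ (j, i)" if "i < n" "j < n" for i j
    using assms that mat_adjoint_index[of j B i] unfolding hermitian_mat_def by auto
  have "cnj (mat_trace (A * B)) = (\<Sum>i<n. \<Sum>j<n. A $$ (j, i) * B $$ (i, j))"
    unfolding mat_trace_mult[OF assms(1,2)] by (auto simp: A B intro!: sum.cong)
  also have "\<dots> = mat_trace (A * B)"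
    unfolding mat_trace_mult[OF assms(1,2)] by (rule sum.swap)
  finally show ?thesis .
qed

lemma hermitian_matI:
  assumes "A \<in> carrier_mat n n" "\<And>i j. i < n \<Longrightarrow> j < n \<Longrightarrow> cnj (A $$ (j, i)) = A $$ (i, j)"
  shows "hermitian_mat A"
  unfolding hermitian_mat_def by (rule eq_matI) (use assms in auto)

lemma hermitian_mat_index:
  assumes "A \<in> carrier_mat n n" "hermitian_mat A" "i < n" "j < n"
  shows "cnj (A $$ (j, i)) = A $$ (i, j)"
  using assms mat_adjoint_index[of i A j] unfolding hermitian_mat_def by auto

text \<open>Row-major coding of pairs, \<open>(i, j)\<close> as \<open>i * n + j\<close>, is the
  index convention of \<open>kronecker\<close>; sums over Kronecker indices are split this way. The
  decoding facts about \<open>div\<close> and \<open>mod\<close> need \<open>n\<close> positive,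
  hence the case split.\<close>

lemma sum_div_mod:
  fixes f :: "nat \<Rightarrow> nat \<Rightarrow> 'a :: comm_monoid_add"
  shows "(\<Sum>k<m * n. f (k div n) (k mod n)) = (\<Sum>i<m. \<Sum>j<n. f i j)"
proof (cases "n = 0")
  case False
  have "(\<Sum>i<m. \<Sum>j<n. f i j) = (\<Sum>(i, j)\<in>{..<m} \<times> {..<n}. f i j)"
    by (simp add: sum.cartesian_product)
  also have "\<dots> = (\<Sum>k<m * n. f (k div n) (k mod n))"
  proof (rule sum.reindex_bij_witness[of _ "\<lambda>k. (k div n, k mod n)" "\<lambda>(i, j). i * n + j"], goal_cases)
    case (2 a)
    obtain i j where a: "a = (i, j)" "i < m" "j < n" using 2 by auto
    have "i * n + j < Suc i * n" using a by simp
    also have "\<dots> \<le> m * n" using a by (intro mult_right_mono) auto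
    finally show ?case using a by simp
  next
    case (4 k) then show ?case using False by (auto simp: less_mult_imp_div_less)
  qed (use False in auto)
  finally show ?thesis ..
qed auto

lemma kronecker_carrier [simp]:
  "A \<in> carrier_mat a b \<Longrightarrow> B \<in> carrier_mat c d \<Longrightarrow> kronecker A B \<in> carrier_mat (a * c) (b * d)"
  by (auto simp: kronecker_def)

lemma kronecker_index:
  assumes "A \<in> carrier_mat a b" "B \<in> carrier_mat c d" "i < a * c" "j < b * d"
  shows "kronecker A B $$ (i, j) = A $$ (i div c, j div d) * B $$ (i mod c, j mod d)"
  using assms by (auto simp: kronecker_def)

text \<open>The mixed-product rule. With it, products, conjugations and traces of tensor operators
  are computed factor by factor.\<close>

lemma kronecker_mult:
  assumes A: "A \<in> carrier_mat a b" and B: "B \<in> carrier_mat c d"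
    and C: "C \<in> carrier_mat b e" and D: "D \<in> carrier_mat d f"
  shows "kronecker A B * kronecker C D = kronecker (A * C) (B * D)"
proof (rule eq_matI)
  fix i j assume "i < dim_row (kronecker (A * C) (B * D))" "j < dim_col (kronecker (A * C) (B * D))"
  then have ij: "i < a * c" "j < e * f" using assms by (auto simp: kronecker_def)
  have bd: "i div c < a" "j div f < e" using ij by (auto simp: less_mult_imp_div_less)
  have pos: "c > 0" "f > 0" using ij by (auto intro: Nat.gr0I)
  have bd': "i mod c < c" "j mod f < f" using pos by auto
  have "(kronecker A B * kronecker C D) $$ (i, j)
      = (\<Sum>k<b * d. kronecker A B $$ (i, k) * kronecker C D $$ (k, j))"
    by (rule mat_mult_index) (use assms ij in auto)
  also have "\<dots> = (\<Sum>k<b * d. (\<lambda>p q. A $$ (i div c, p) * B $$ (i mod c, q) *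
      (C $$ (p, j div f) * D $$ (q, j mod f))) (k div d) (k mod d))"
    using kronecker_index[OF A B ij(1)] kronecker_index[OF C D _ ij(2)] by (intro sum.cong) auto
  also have "\<dots> = (\<Sum>p<b. \<Sum>q<d. A $$ (i div c, p) * B $$ (i mod c, q) *
      (C $$ (p, j div f) * D $$ (q, j mod f)))"
    by (rule sum_div_mod)
  also have "\<dots> = (A * C) $$ (i div c, j div f) * (B * D) $$ (i mod c, j mod f)"
    unfolding mat_mult_index[OF A C bd] mat_mult_index[OF B D bd'] sum_product
    by (simp add: mult_ac)
  also have "\<dots> = kronecker (A * C) (B * D) $$ (i, j)"
    by (rule kronecker_index[symmetric]) (use assms ij in auto)
  finally show "(kronecker A B * kronecker C D) $$ (i, j) = kronecker (A * C) (B * D) $$ (i, j)" .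
qed (use assms in \<open>auto simp: kronecker_def\<close>)

lemma mat_adjoint_kronecker:
  "mat_adjoint (kronecker A B) = kronecker (mat_adjoint A) (mat_adjoint B)"
proof (rule eq_matI)
  fix i j assume "i < dim_row (kronecker (mat_adjoint A) (mat_adjoint B))"
    "j < dim_col (kronecker (mat_adjoint A) (mat_adjoint B))"
  then have ij: "i < dim_col A * dim_col B" "j < dim_row A * dim_row B" by (auto simp: kronecker_def)
  then have "i div dim_col B < dim_col A" "j div dim_row B < dim_row A"
    "i mod dim_col B < dim_col B" "j mod dim_row B < dim_row B"
    by (auto simp: less_mult_imp_div_less intro!: mod_less_divisor Nat.gr0I)
  then show "mat_adjoint (kronecker A B) $$ (i, j) = kronecker (mat_adjoint A) (mat_adjoint B) $$ (i, j)"
    using ij by (simp add: kronecker_def)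
qed (auto simp: kronecker_def)

lemma kronecker_one: "kronecker (1\<^sub>m a) (1\<^sub>m b) = 1\<^sub>m (a * b)"
proof (rule eq_matI)
  fix i j assume "i < dim_row (1\<^sub>m (a * b))" "j < dim_col (1\<^sub>m (a * b))"
  then have ij: "i < a * b" "j < a * b" by auto
  have "b > 0" using ij by (auto intro: Nat.gr0I)
  moreover have "i = j" if "i div b = j div b" "i mod b = j mod b"
    by (metis that div_mult_mod_eq)
  ultimately show "kronecker (1\<^sub>m a) (1\<^sub>m b) $$ (i, j) = (1\<^sub>m (a * b) :: complex mat) $$ (i, j)"
    using ij by (auto simp: kronecker_def less_mult_imp_div_less)
qed (auto simp: kronecker_def)

lemma kronecker_smult:
  "kronecker (c \<cdot>\<^sub>m A) (d \<cdot>\<^sub>m B) = (c * d) \<cdot>\<^sub>m kronecker A B"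
proof (rule eq_matI)
  fix i j assume "i < dim_row ((c * d) \<cdot>\<^sub>m kronecker A B)" "j < dim_col ((c * d) \<cdot>\<^sub>m kronecker A B)"
  then have ij: "i < dim_row A * dim_row B" "j < dim_col A * dim_col B" by (auto simp: kronecker_def)
  then have "i div dim_row B < dim_row A" "j div dim_col B < dim_col A"
    "i mod dim_row B < dim_row B" "j mod dim_col B < dim_col B"
    by (auto simp: less_mult_imp_div_less intro!: mod_less_divisor Nat.gr0I)
  then show "kronecker (c \<cdot>\<^sub>m A) (d \<cdot>\<^sub>m B) $$ (i, j) = ((c * d) \<cdot>\<^sub>m kronecker A B) $$ (i, j)"
    using ij by (simp add: kronecker_def)
qed (auto simp: kronecker_def)

lemma mat_trace_kronecker:
  assumes "A \<in> carrier_mat a a" "B \<in> carrier_mat b b"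
  shows "mat_trace (kronecker A B) = mat_trace A * mat_trace B"
proof -
  have "mat_trace (kronecker A B) = (\<Sum>k<a * b. (\<lambda>p q. A $$ (p, p) * B $$ (q, q)) (k div b) (k mod b))"
    unfolding mat_trace_def using assms kronecker_index[OF assms] by (auto simp: kronecker_def)
  also have "\<dots> = (\<Sum>p<a. \<Sum>q<b. A $$ (p, p) * B $$ (q, q))"
    by (rule sum_div_mod)
  also have "\<dots> = mat_trace A * mat_trace B"
    using assms by (auto simp: mat_trace_def sum_product)
  finally show ?thesis .
qed

section \<open>Tensor products of lists of square matrices\<close>

lemma tensor_mats_Nil [simp]: "tensor_mats [] = 1\<^sub>m 1"
  by (simp add: tensor_mats_def)

lemma tensor_mats_Cons [simp]: "tensor_mats (A # As) = kronecker A (tensor_mats As)"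
  by (simp add: tensor_mats_def)

abbreviation square_mats :: "nat list \<Rightarrow> complex mat list \<Rightarrow> bool" where
  "square_mats ds As \<equiv> list_all2 (\<lambda>d A. A \<in> carrier_mat d d) ds As"

lemma tensor_mats_carrier [simp]:
  "square_mats ds As \<Longrightarrow> tensor_mats As \<in> carrier_mat (prod_list ds) (prod_list ds)"
  by (induction rule: list_all2_induct) auto

lemma tensor_mats_mult:
  assumes "square_mats ds As" "square_mats ds Bs"
  shows "tensor_mats As * tensor_mats Bs = tensor_mats (map2 (*) As Bs)"
  using assms
proof (induction ds As arbitrary: Bs rule: list_all2_induct)
  case (Cons d ds A As)
  then obtain B Bs' where B: "Bs = B # Bs'" "B \<in> carrier_mat d d" "square_mats ds Bs'"
    by (auto simp: list_all2_Cons1)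
  have "tensor_mats (A # As) * tensor_mats Bs = kronecker (A * B) (tensor_mats As * tensor_mats Bs')"
    using Cons B by (simp add: kronecker_mult[where a=d and b=d and e=d and
        c="prod_list ds" and d="prod_list ds" and f="prod_list ds"])
  then show ?case using Cons.IH[OF B(3)] B(1) by simp
qed auto

lemma mat_trace_tensor_mats:
  "square_mats ds As \<Longrightarrow> mat_trace (tensor_mats As) = (\<Prod>A\<leftarrow>As. mat_trace A)"
proof (induction rule: list_all2_induct)
  case (Cons d ds A As)
  then show ?case by (simp add: mat_trace_kronecker[where b="prod_list ds"])
qed auto

lemma mat_adjoint_tensor_mats: "mat_adjoint (tensor_mats As) = tensor_mats (map mat_adjoint As)"
  by (induction As) (auto simp: mat_adjoint_kronecker)

lemma tensor_mats_smult:
  "length cs = length As \<Longrightarrow> tensor_mats (map2 (\<cdot>\<^sub>m) cs As) = prod_list cs \<cdot>\<^sub>m tensor_mats As"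
proof (induction cs As rule: list_induct2)
  case Nil show ?case by (simp, rule eq_matI) auto
qed (auto simp: kronecker_smult)

subsection \<open>Hermitian orthonormal operator bases\<close>

text \<open>Completeness is stated entrywise, as a resolution of the identity, instead of through
  spans or a count of elements: expansions then reduce to exchanging sums, and the condition factors
  over Kronecker products. For Hermitian elements \<open>mat_trace (B * C)\<close> is the
  Hilbert-Schmidt product.\<close>

definition hs_onb :: "nat \<Rightarrow> complex mat set \<Rightarrow> bool" where
  "hs_onb d S \<longleftrightarrow> finite S \<and> S \<subseteq> carrier_mat d d \<and> (\<forall>B\<in>S. hermitian_mat B) \<and>
     (\<forall>B\<in>S. \<forall>C\<in>S. mat_trace (B * C) = (if B = C then 1 else 0)) \<and>
     (\<forall>i<d. \<forall>j<d. \<forall>k<d. \<forall>l<d. (\<Sum>B\<in>S. B $$ (i, j) * cnj (B $$ (k, l))) = (if i = k \<and> j = l then 1 else 0))"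

lemma hs_onbD:
  assumes "hs_onb d S"
  shows "finite S" "\<And>B. B \<in> S \<Longrightarrow> B \<in> carrier_mat d d" "\<And>B. B \<in> S \<Longrightarrow> hermitian_mat B"
    "\<And>B C. B \<in> S \<Longrightarrow> C \<in> S \<Longrightarrow> mat_trace (B * C) = (if B = C then 1 else 0)"
    "\<And>i j k l. i < d \<Longrightarrow> j < d \<Longrightarrow> k < d \<Longrightarrow> l < d \<Longrightarrow>
      (\<Sum>B\<in>S. B $$ (i, j) * cnj (B $$ (k, l))) = (if i = k \<and> j = l then 1 else 0)"
  using assms unfolding hs_onb_def by auto

lemma sum_delta_pair:
  fixes f :: "nat \<Rightarrow> nat \<Rightarrow> 'a :: comm_monoid_add"
  assumes "i < n" "j < m"
  shows "(\<Sum>k<n. \<Sum>l<m. if i = k \<and> j = l then f k l else 0) = f i j"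
proof -
  have "(\<Sum>k<n. \<Sum>l<m. if i = k \<and> j = l then f k l else 0)
      = (\<Sum>k<n. if i = k then (\<Sum>l<m. if j = l then f k l else 0) else 0)"
    by (intro sum.cong) auto
  also have "\<dots> = f i j" using assms by (simp add: sum.delta')
  finally show ?thesis .
qed

text \<open>Hermiticity turns \<open>mat_trace (B * X)\<close> into a sum against
  \<open>cnj (B $$ (l, k))\<close>, and completeness then collapses the sum over the basis.\<close>

lemma hs_onb_expand:
  assumes S: "hs_onb d S" and X: "X \<in> carrier_mat d d" and ij: "i < d" "j < d"
  shows "X $$ (i, j) = (\<Sum>B\<in>S. mat_trace (B * X) * B $$ (i, j))"
proof -
  have "(\<Sum>B\<in>S. mat_trace (B * X) * B $$ (i, j))
      = (\<Sum>B\<in>S. \<Sum>k<d. \<Sum>l<d. B $$ (i, j) * cnj (B $$ (l, k)) * X $$ (l, k))"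
  proof (intro sum.cong refl)
    fix B assume B: "B \<in> S"
    note Bc = hs_onbD(2)[OF S B] and Bh = hs_onbD(3)[OF S B]
    show "mat_trace (B * X) * B $$ (i, j) =
      (\<Sum>k<d. \<Sum>l<d. B $$ (i, j) * cnj (B $$ (l, k)) * X $$ (l, k))"
      unfolding mat_trace_mult[OF Bc X] sum_distrib_right
      by (intro sum.cong refl) (simp add: hermitian_mat_index[OF Bc Bh] mult_ac)
  qed
  also have "\<dots> = (\<Sum>k<d. \<Sum>l<d. (\<Sum>B\<in>S. B $$ (i, j) * cnj (B $$ (l, k))) * X $$ (l, k))"
    by (subst sum.swap, intro sum.cong refl, subst sum.swap) (simp add: sum_distrib_right)
  also have "\<dots> = (\<Sum>k<d. \<Sum>l<d. if j = k \<and> i = l then X $$ (l, k) else 0)"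
    using hs_onbD(5)[OF S ij] by (intro sum.cong refl) auto
  also have "\<dots> = X $$ (i, j)" using ij by (simp add: sum_delta_pair)
  finally show ?thesis ..
qed

text \<open>Parseval's identity in bilinear form.\<close>

lemma hs_onb_trace_expand:
  assumes S: "hs_onb d S" and X: "X \<in> carrier_mat d d" and Y: "Y \<in> carrier_mat d d"
  shows "mat_trace (X * Y) = (\<Sum>B\<in>S. mat_trace (B * X) * mat_trace (B * Y))"
proof -
  have "mat_trace (X * Y) = (\<Sum>i<d. \<Sum>j<d. (\<Sum>B\<in>S. mat_trace (B * X) * B $$ (i, j)) * Y $$ (j, i))"
    unfolding mat_trace_mult[OF X Y]
    by (intro sum.cong refl) (simp add: hs_onb_expand[OF S X])
  also have "\<dots> = (\<Sum>B\<in>S. \<Sum>i<d. \<Sum>j<d. mat_trace (B * X) * B $$ (i, j) * Y $$ (j, i))"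
    by (simp add: sum_distrib_right, subst (2) sum.swap, subst sum.swap) simp
  also have "\<dots> = (\<Sum>B\<in>S. mat_trace (B * X) * mat_trace (B * Y))"
    using hs_onbD(2)[OF S]
    by (intro sum.cong refl) (simp add: mat_trace_mult[OF _ Y] sum_distrib_left mult.assoc)
  finally show ?thesis .
qed

lemma mat_trace_kronecker_mult:
  assumes "A \<in> carrier_mat a a" "B \<in> carrier_mat b b" "C \<in> carrier_mat a a" "D \<in> carrier_mat b b"
  shows "mat_trace (kronecker A B * kronecker C D) = mat_trace (A * C) * mat_trace (B * D)"
  unfolding kronecker_mult[OF assms] by (rule mat_trace_kronecker) (use assms in auto)

lemma hermitian_kronecker: "hermitian_mat A \<Longrightarrow> hermitian_mat B \<Longrightarrow> hermitian_mat (kronecker A B)"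
  by (simp add: hermitian_mat_def mat_adjoint_kronecker)

text \<open>A scalar could be moved from one Kronecker factor to the other, so injectivity is not
  automatic. It holds because equal products have overlap 1, while the overlap of basis products is
  1 only for equal factors. Orthonormality and completeness both factor over the two digits of an
  index.\<close>

lemma hs_onb_kronecker:
  assumes S: "hs_onb a S" and T: "hs_onb b T"
  shows "inj_on (\<lambda>(A, B). kronecker A B) (S \<times> T)"
    and "hs_onb (a * b) ((\<lambda>(A, B). kronecker A B) ` (S \<times> T))"
proof -
  note SC = hs_onbD(2)[OF S] and TC = hs_onbD(2)[OF T]
  have tr: "mat_trace (kronecker A B * kronecker C D) = (if A = C \<and> B = D then 1 else 0)"
    if "A \<in> S" "B \<in> T" "C \<in> S" "D \<in> T" for A B C D
    using that hs_onbD(4)[OF S] hs_onbD(4)[OF T]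
    by (simp add: mat_trace_kronecker_mult[OF SC TC SC TC])
  show inj: "inj_on (\<lambda>(A, B). kronecker A B) (S \<times> T)"
  proof (rule inj_onI, clarify)
    fix A B C D assume *: "A \<in> S" "B \<in> T" "C \<in> S" "D \<in> T" and eq: "kronecker A B = kronecker C D"
    have "mat_trace (kronecker A B * kronecker C D) = 1"
      unfolding eq using tr * by simp
    then show "A = C \<and> B = D" using tr * by (auto split: if_splits)
  qed
  have comp: "(\<Sum>X\<in>(\<lambda>(A, B). kronecker A B) ` (S \<times> T). X $$ (i, j) * cnj (X $$ (k, l)))
      = (if i = k \<and> j = l then 1 else 0)"
    if "i < a * b" "j < a * b" "k < a * b" "l < a * b" for i j k l
  proof -
    have bp: "b > 0" using that by (auto intro: Nat.gr0I)
    have d: "x div b < a" "x mod b < b" if "x < a * b" for x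
      using that bp by (auto simp: less_mult_imp_div_less)
    have eq: "x = y \<longleftrightarrow> x div b = y div b \<and> x mod b = y mod b" for x y
      by (metis div_mult_mod_eq)
    have "(\<Sum>X\<in>(\<lambda>(A, B). kronecker A B) ` (S \<times> T). X $$ (i, j) * cnj (X $$ (k, l)))
        = (\<Sum>(A, B)\<in>S \<times> T. kronecker A B $$ (i, j) * cnj (kronecker A B $$ (k, l)))"
      by (subst sum.reindex[OF inj]) (simp add: case_prod_unfold)
    also have "\<dots> = (\<Sum>(A, B)\<in>S \<times> T. (A $$ (i div b, j div b) * cnj (A $$ (k div b, l div b))) *
        (B $$ (i mod b, j mod b) * cnj (B $$ (k mod b, l mod b))))"
    proof (intro sum.cong refl, clarify)
      fix A B assume "A \<in> S" "B \<in> T"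
      then show "kronecker A B $$ (i, j) * cnj (kronecker A B $$ (k, l)) =
        (A $$ (i div b, j div b) * cnj (A $$ (k div b, l div b))) *
        (B $$ (i mod b, j mod b) * cnj (B $$ (k mod b, l mod b)))"
        using that by (simp add: kronecker_index[OF SC TC])
    qed
    also have "\<dots> = (\<Sum>A\<in>S. A $$ (i div b, j div b) * cnj (A $$ (k div b, l div b))) *
        (\<Sum>B\<in>T. B $$ (i mod b, j mod b) * cnj (B $$ (k mod b, l mod b)))"
      by (simp add: sum.cartesian_product[symmetric] sum_product)
    also have "\<dots> = (if i = k \<and> j = l then 1 else 0)"
      using that by (simp add: hs_onbD(5)[OF S] hs_onbD(5)[OF T] d eq[of i k] eq[of j l])
    finally show ?thesis .
  qed
  show "hs_onb (a * b) ((\<lambda>(A, B). kronecker A B) ` (S \<times> T))"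
    unfolding hs_onb_def
  proof (intro conjI allI impI ballI, goal_cases)
    case 1 show ?case using hs_onbD(1)[OF S] hs_onbD(1)[OF T] by simp
  next
    case 2 show ?case using SC TC by auto
  next
    case 3 then show ?case using hs_onbD(3)[OF S] hs_onbD(3)[OF T] by (auto intro: hermitian_kronecker)
  next
    case (4 X Y)
    then obtain A B C D where *: "A \<in> S" "B \<in> T" "C \<in> S" "D \<in> T"
      "X = kronecker A B" "Y = kronecker C D" by auto
    then show ?case using tr[OF *(1-4)] inj_onD[OF inj, of "(A, B)" "(C, D)"] by auto
  qed (rule comp)
qed

section \<open>Pauli-string bases of qubit blocks\<close>

definition normid :: "nat \<Rightarrow> complex mat" where
  "normid d = complex_of_real (1 / sqrt (real d)) \<cdot>\<^sub>m 1\<^sub>m d"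

lemma normid_carrier [simp]: "normid d \<in> carrier_mat d d"
  by (simp add: normid_def)

lemma kronecker_normid: "kronecker (normid a) (normid b) = normid (a * b)"
  by (simp add: normid_def kronecker_smult kronecker_one real_sqrt_mult)

lemma hs_onb_1: "hs_onb 1 {normid 1}"
  unfolding hs_onb_def normid_def by (auto simp: mat_trace_def hermitian_mat_def mat_adjoint_smult mat_mult_index[where n=1 and m=1 and p=1])

text \<open>The tuples are the rows of the identity and of the Pauli matrices X, Y, Z; the scalar
  factor gives them Hilbert-Schmidt norm 1.\<close>

definition pauli :: "complex mat set" where
  "pauli = (\<lambda>(a, b, c, d). complex_of_real (1 / sqrt 2) \<cdot>\<^sub>m mat_of_rows_list 2 [[a, b], [c, d]]) `
     {(1, 0, 0, 1), (0, 1, 1, 0), (0, -\<i>, \<i>, 0), (1, 0, 0, -1)}"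

lemma less_2_iff: "i < (2::nat) \<longleftrightarrow> i = 0 \<or> i = 1" by auto

lemma pauli_index: 
  "(complex_of_real (1 / sqrt 2) \<cdot>\<^sub>m mat_of_rows_list 2 [[a, b], [c, d]]) $$ (0,0) = a / sqrt 2"
  "(complex_of_real (1 / sqrt 2) \<cdot>\<^sub>m mat_of_rows_list 2 [[a, b], [c, d]]) $$ (0,1) = b / sqrt 2"
  "(complex_of_real (1 / sqrt 2) \<cdot>\<^sub>m mat_of_rows_list 2 [[a, b], [c, d]]) $$ (1,0) = c / sqrt 2"
  "(complex_of_real (1 / sqrt 2) \<cdot>\<^sub>m mat_of_rows_list 2 [[a, b], [c, d]]) $$ (1,1) = d / sqrt 2"
  "(complex_of_real (1 / sqrt 2) \<cdot>\<^sub>m mat_of_rows_list 2 [[a, b], [c, d]]) \<in> carrier_mat 2 2"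
  by (auto simp: mat_of_rows_list_def)

lemma pauli_inj: 
  "inj_on (\<lambda>(a, b, c, d). complex_of_real (1 / sqrt 2) \<cdot>\<^sub>m mat_of_rows_list 2 [[a, b], [c, d]]) S"
proof (rule inj_onI)
  fix p q :: "complex \<times> complex \<times> complex \<times> complex"
  assume eq: "(\<lambda>(a, b, c, d). complex_of_real (1 / sqrt 2) \<cdot>\<^sub>m mat_of_rows_list 2 [[a, b], [c, d]]) p
    = (\<lambda>(a, b, c, d). complex_of_real (1 / sqrt 2) \<cdot>\<^sub>m mat_of_rows_list 2 [[a, b], [c, d]]) q"
  obtain a b c d a' b' c' d' where pq: "p = (a, b, c, d)" "q = (a', b', c', d')"
    by (cases p, cases q) auto
  show "p = q"
    using pauli_index(1-4)[of a b c d] pauli_index(1-4)[of a' b' c' d'] eq unfolding pq by simp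
qed

lemma hs_onb_pauli: "hs_onb 2 pauli"
proof -
  let ?f = "\<lambda>(a, b, c, d). complex_of_real (1 / sqrt 2) \<cdot>\<^sub>m mat_of_rows_list 2 [[a, b], [c, d]]"
  let ?I = "{(1, 0, 0, 1), (0, 1, 1, 0), (0, -\<i>, \<i>, 0), (1, 0, 0, -1)} :: (complex \<times> complex \<times> complex \<times> complex) set"
  have s2: "complex_of_real (sqrt 2) * complex_of_real (sqrt 2) = 2"
    by (metis abs_numeral of_real_mult of_real_numeral real_sqrt_mult_self)
  have sum2: "(\<Sum>k<2. g k) = g 0 + g (1::nat)" for g :: "nat \<Rightarrow> complex"
    by (simp add: numeral_2_eq_2)
  have c: "?f p \<in> carrier_mat 2 2" for p
    using pauli_index(5) by (cases p) auto
  have tr: "mat_trace (?f p * ?f q) = (if p = q then 1 else 0)" if "p \<in> ?I" "q \<in> ?I" for p q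
    unfolding mat_trace_mult[OF c c] sum2 using that s2
    by (elim insertE emptyE) (simp_all add: pauli_index[simplified] pauli_index s2 field_simps)
  have comp: "(\<Sum>p\<in>?I. ?f p $$ (i, j) * cnj (?f p $$ (k, l))) = (if i = k \<and> j = l then 1 else 0)"
    if "i < 2" "j < 2" "k < 2" "l < 2" for i j k l
    using that unfolding less_2_iff
    by (elim disjE) (simp_all add: pauli_index[simplified] pauli_index s2 field_simps)
  have herm: "hermitian_mat (?f p)" if "p \<in> ?I" for p
    using that by (intro hermitian_matI[OF c])
      (unfold less_2_iff, elim insertE emptyE disjE; simp add: pauli_index[simplified] pauli_index)
  show ?thesis
    unfolding hs_onb_def pauli_def
  proof (intro conjI allI impI ballI, goal_cases)
    case (4 B C) 
    then show ?case using tr inj_onD[OF pauli_inj] by (smt (verit, best) imageE)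
  next
    case (5 i j k l)
    then show ?case using comp[OF 5] by (subst sum.reindex[OF pauli_inj]) (simp add: case_prod_unfold)
  qed (use c herm in auto)
qed

lemma normid_pauli: "normid 2 \<in> pauli"
  unfolding normid_def pauli_def
  by (rule image_eqI[of _ _ "(1,0,0,1)"], simp, rule arg_cong[of _ _ "(\<cdot>\<^sub>m) _"], rule eq_matI)
    (auto simp: mat_of_rows_list_def numeral_2_eq_2 less_Suc_eq)

text \<open>Pauli strings: each further qubit tensors on one more factor from \<open>pauli\<close>,
  and normalised identities multiply to a normalised identity. This is where the dimension enters as
  a power of two.\<close>

lemma ex_hs_onb_normid: "\<exists>S. hs_onb (2 ^ k) S \<and> normid (2 ^ k) \<in> S"
proof (induction k)
  case 0 show ?case using hs_onb_1 by (intro exI[of _ "{normid 1}"]) simp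
next
  case (Suc k)
  then obtain S where S: "hs_onb (2 ^ k) S" "normid (2 ^ k) \<in> S" by blast
  have "normid (2 ^ Suc k) \<in> (\<lambda>(A, B). kronecker A B) ` (pauli \<times> S)"
    using normid_pauli S(2) kronecker_normid[of 2 "2 ^ k"] by force
  then show ?case using hs_onb_kronecker(2)[OF hs_onb_pauli S(1)]
    by (intro exI[of _ "(\<lambda>(A, B). kronecker A B) ` (pauli \<times> S)"]) simp
qed

text \<open>One fixed basis per dimension. The choice does no harm, since the locality vector does
  not depend on the basis (\<open>sum_trace_sq_basis_indep\<close>).\<close>

definition block_basis :: "nat \<Rightarrow> complex mat set" where
  "block_basis d = (SOME S. hs_onb d S \<and> normid d \<in> S)"

definition qubit_block :: "nat \<Rightarrow> bool" where "qubit_block d \<longleftrightarrow> (\<exists>k. d = 2 ^ k)"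

lemma block_basis:
  assumes "qubit_block d"
  shows "hs_onb d (block_basis d)" "normid d \<in> block_basis d"
proof -
  have "\<exists>S. hs_onb d S \<and> normid d \<in> S" using assms ex_hs_onb_normid unfolding qubit_block_def by blast
  from someI_ex[OF this] show "hs_onb d (block_basis d)" "normid d \<in> block_basis d"
    unfolding block_basis_def by auto
qed

text \<open>Basis tensors are indexed by their lists of factors, not by the product matrices: the
  sector of a basis tensor and its factorwise moments are read off from the list.\<close>

definition tensor_index :: "nat list \<Rightarrow> complex mat list set" where
  "tensor_index ds = listset (map block_basis ds)"

lemma tensor_index_Cons:
  "tensor_index (d # ds) = (\<lambda>(A, As). A # As) ` (block_basis d \<times> tensor_index ds)"
  by (auto simp: tensor_index_def set_Cons_def)

lemma tensor_index_iff: "As \<in> tensor_index ds \<longleftrightarrow> list_all2 (\<lambda>d A. A \<in> block_basis d) ds As"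
  by (induction ds arbitrary: As) (auto simp: tensor_index_def set_Cons_def list_all2_Cons1)

lemma tensor_index_square:
  "(\<And>d. d \<in> set ds \<Longrightarrow> qubit_block d) \<Longrightarrow> As \<in> tensor_index ds \<Longrightarrow> square_mats ds As"
  unfolding tensor_index_iff
  using hs_onbD(2)[OF block_basis(1)] by (auto simp: list_all2_conv_all_nth)

lemma hs_onb_tensor:
  assumes "\<And>d. d \<in> set ds \<Longrightarrow> qubit_block d"
  shows "inj_on tensor_mats (tensor_index ds) \<and> hs_onb (prod_list ds) (tensor_mats ` tensor_index ds)"
  using assms
proof (induction ds)
  case Nil
  have "normid 1 = 1\<^sub>m 1" by (rule eq_matI) (auto simp: normid_def)
  then show ?case using hs_onb_1 by (simp add: tensor_index_def)
next
  case (Cons d ds)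
  note S = block_basis(1)[of d] and IH = conjunct1[OF Cons.IH] conjunct2[OF Cons.IH]
  have q: "qubit_block d" using Cons.prems by simp
  note K = hs_onb_kronecker[OF S[OF q] IH(2)]
  have im: "tensor_mats ` tensor_index (d # ds) =
      (\<lambda>(A, B). kronecker A B) ` (block_basis d \<times> tensor_mats ` tensor_index ds)"
    unfolding tensor_index_Cons by force
  have "inj_on tensor_mats (tensor_index (d # ds))"
  proof (rule inj_onI)
    fix As Bs assume *: "As \<in> tensor_index (d # ds)" "Bs \<in> tensor_index (d # ds)" "tensor_mats As = tensor_mats Bs"
    obtain A As' B Bs' where **: "As = A # As'" "Bs = B # Bs'" "A \<in> block_basis d" "B \<in> block_basis d"
      "As' \<in> tensor_index ds" "Bs' \<in> tensor_index ds"
      using *(1,2) unfolding tensor_index_Cons by auto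
    have "(A, tensor_mats As') = (B, tensor_mats Bs')"
      by (rule inj_onD[OF K(1)]) (use * ** Cons.prems in auto)
    then show "As = Bs" using ** IH(1) Cons.prems by (auto dest: inj_onD)
  qed
  then show ?case using K(2) Cons.prems unfolding im by simp
qed

subsection \<open>Sectors and the locality vector\<close>

abbreviation op_span :: "nat \<Rightarrow> complex mat set \<Rightarrow> complex mat set" where
  "op_span D S \<equiv> LinearCombinations.module.span class_ring (operator_space D) S"

abbreviation op_lincomb :: "nat \<Rightarrow> (complex mat \<Rightarrow> complex) \<Rightarrow> complex mat set \<Rightarrow> complex mat" where
  "op_lincomb D a S \<equiv> LinearCombinations.module.lincomb (operator_space D) a S"

text \<open>The bridge from abstract linear combinations in the module to matrix entries. Both
  conclusions are proved in one induction because the entry formula for a sum needs the dimensions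
  of the summands.\<close>

lemma op_lincomb:
  assumes "finite A" "A \<subseteq> carrier_mat D D"
  shows "op_lincomb D a A \<in> carrier_mat D D"
    and "i < D \<Longrightarrow> j < D \<Longrightarrow> op_lincomb D a A $$ (i, j) = (\<Sum>B\<in>A. a B * B $$ (i, j))"
proof -
  interpret M: matrix_vs D D "TYPE(complex)" .
  have "op_lincomb D a A \<in> carrier_mat D D \<and>
    (i < D \<longrightarrow> j < D \<longrightarrow> op_lincomb D a A $$ (i, j) = (\<Sum>B\<in>A. a B * B $$ (i, j)))"
    using assms
  proof (induction A rule: finite_induct)
    case empty
    show ?case by (simp add: M.lincomb_def)
  next
    case (insert B A)
    have "op_lincomb D a (A \<union> {B}) = a B \<cdot>\<^sub>m B + op_lincomb D a A"
      using insert by (intro M.lincomb_insert) auto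
    moreover have c: "op_lincomb D a A \<in> carrier_mat D D" using insert by auto
    moreover have "(a B \<cdot>\<^sub>m B + op_lincomb D a A) $$ (i, j) = a B * B $$ (i, j) + op_lincomb D a A $$ (i, j)"
      if "i < D" "j < D"
      using that insert.prems by (subst index_add_mat(1)) (simp_all only: carrier_matD[OF c], auto)
    moreover have "i < D \<longrightarrow> j < D \<longrightarrow> op_lincomb D a A $$ (i, j) = (\<Sum>B\<in>A. a B * B $$ (i, j))"
      using insert by simp
    ultimately have "i < D \<longrightarrow> j < D \<longrightarrow>
        op_lincomb D a (insert B A) $$ (i, j) = (\<Sum>B\<in>insert B A. a B * B $$ (i, j))"
      unfolding sum.insert[OF insert.hyps] by (metis Un_insert_right sup_bot_right)
    moreover have "op_lincomb D a (insert B A) \<in> carrier_mat D D"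
      using insert.prems insert.hyps by (intro M.lincomb_closed) auto
    ultimately show ?case by blast
  qed
  then show "op_lincomb D a A \<in> carrier_mat D D"
    and "i < D \<Longrightarrow> j < D \<Longrightarrow> op_lincomb D a A $$ (i, j) = (\<Sum>B\<in>A. a B * B $$ (i, j))" by auto
qed

lemma op_lincomb_dim:
  assumes "finite A" "A \<subseteq> carrier_mat D D"
  shows "dim_row (op_lincomb D a A) = D" "dim_col (op_lincomb D a A) = D"
  using carrier_matD[OF op_lincomb(1)[OF assms]] by this+

lemma mat_trace_op_lincomb:
  assumes A: "finite A" "A \<subseteq> carrier_mat D D" and C: "C \<in> carrier_mat D D"
  shows "mat_trace (C * op_lincomb D a A) = (\<Sum>B\<in>A. a B * mat_trace (C * B))"
proof -
  have "mat_trace (C * op_lincomb D a A) = (\<Sum>i<D. \<Sum>j<D. \<Sum>B\<in>A. a B * (C $$ (i, j) * B $$ (j, i)))"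
    unfolding mat_trace_mult[OF C op_lincomb(1)[OF A]]
    by (intro sum.cong refl) (simp add: op_lincomb(2)[OF A] sum_distrib_left mult_ac)
  also have "\<dots> = (\<Sum>B\<in>A. \<Sum>i<D. \<Sum>j<D. a B * (C $$ (i, j) * B $$ (j, i)))"
    by (subst (2) sum.swap, subst sum.swap) simp
  also have "\<dots> = (\<Sum>B\<in>A. a B * mat_trace (C * B))"
    using A by (intro sum.cong refl) (auto simp: mat_trace_mult[OF C] sum_distrib_left)
  finally show ?thesis .
qed

text \<open>Bilinear on purpose: no adjoint occurs, and for sets of Hermitian matrices this agrees
  with orthonormality for \<open>hs_inner\<close>.\<close>

definition hs_orthonormal :: "complex mat set \<Rightarrow> bool" where
  "hs_orthonormal S \<longleftrightarrow> (\<forall>B\<in>S. \<forall>C\<in>S. mat_trace (B * C) = (if B = C then 1 else 0))"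

lemma hs_orthonormal_lin_indpt:
  assumes "S \<subseteq> carrier_mat D D" "hs_orthonormal S"
  shows "\<not> LinearCombinations.module.lin_dep class_ring (operator_space D) S"
proof
  interpret M: matrix_vs D D "TYPE(complex)" .
  assume "M.lin_dep S"
  then obtain A a v where *: "finite A" "A \<subseteq> S" "M.lincomb a A = 0\<^sub>m D D" "v \<in> A" "a v \<noteq> 0"
    unfolding M.lin_dep_def by auto
  have AC: "A \<subseteq> carrier_mat D D" and vC: "v \<in> carrier_mat D D" using * assms by auto
  have tr: "mat_trace (v * B) = (if v = B then 1 else 0)" if "B \<in> A" for B
    using assms(2) *(2,4) that unfolding hs_orthonormal_def by (meson subsetD)
  have "mat_trace (v * M.lincomb a A) = (\<Sum>B\<in>A. if v = B then a B else 0)"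
    unfolding mat_trace_op_lincomb[OF *(1) AC vC] by (intro sum.cong refl) (simp add: tr)
  also have "\<dots> = a v" using * by simp
  finally show False using *(3,5) vC by (simp add: mat_trace_def)
qed

lemma op_span_expand:
  assumes S: "finite S" "S \<subseteq> carrier_mat D D" "hs_orthonormal S" and X: "X \<in> op_span D S"
  shows "X = op_lincomb D (\<lambda>B. mat_trace (B * X)) S"
proof -
  interpret M: matrix_vs D D "TYPE(complex)" .
  obtain a where a: "X = M.lincomb a S"
    using X M.finite_span[OF S(1,2)] by auto
  have "mat_trace (B * X) = a B" if "B \<in> S" for B
  proof -
    have BC: "B \<in> carrier_mat D D" using that S by auto
    have tr: "mat_trace (B * C) = (if B = C then 1 else 0)" if "C \<in> S" for C
      using S(3) \<open>B \<in> S\<close> that unfolding hs_orthonormal_def by blast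
    have "mat_trace (B * X) = (\<Sum>C\<in>S. if B = C then a C else 0)"
      unfolding a mat_trace_op_lincomb[OF S(1,2) BC] by (intro sum.cong refl) (simp add: tr)
    then show ?thesis using that S by simp
  qed
  then have "M.lincomb (\<lambda>B. mat_trace (B * X)) S = M.lincomb a S"
    by (intro eq_matI; simp only: op_lincomb_dim[OF S(1,2)] op_lincomb(2)[OF S(1,2)] cong: sum.cong)
  then show ?thesis using a by simp
qed

text \<open>Both sides are the squared norm of the projection onto the span.\<close>

lemma sum_trace_sq_basis_indep:
  assumes S: "finite S" "S \<subseteq> carrier_mat D D" "hs_orthonormal S"
    and T: "finite T" "T \<subseteq> carrier_mat D D" "hs_orthonormal T"
    and eq: "op_span D S = op_span D T" and X: "X \<in> carrier_mat D D"
  shows "(\<Sum>B\<in>S. (mat_trace (B * X))\<^sup>2) = (\<Sum>C\<in>T. (mat_trace (C * X))\<^sup>2)"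
proof -
  interpret M: matrix_vs D D "TYPE(complex)" .
  have trX: "mat_trace (B * X) = (\<Sum>C\<in>T. mat_trace (C * B) * mat_trace (C * X))"
    if T: "finite T" "T \<subseteq> carrier_mat D D" "hs_orthonormal T" and B: "B \<in> op_span D T" for B T
  proof -
    have Bc: "B \<in> carrier_mat D D" using B M.span_is_subset2[OF T(2)] by auto
    have "mat_trace (B * X) = mat_trace (X * op_lincomb D (\<lambda>C. mat_trace (C * B)) T)"
      using op_span_expand[OF T B] mat_trace_mult_comm[OF Bc X] by simp
    also have "\<dots> = (\<Sum>C\<in>T. mat_trace (C * B) * mat_trace (C * X))"
      unfolding mat_trace_op_lincomb[OF T(1,2) X]
      using T(2) by (intro sum.cong refl) (auto intro!: mat_trace_mult_comm[OF X])
    finally show ?thesis .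
  qed
  have ST: "B \<in> op_span D T" if "B \<in> S" for B using that M.in_own_span[OF S(2)] eq by auto
  have TS: "C \<in> op_span D S" if "C \<in> T" for C using that M.in_own_span[OF T(2)] eq by auto
  \<comment> \<open>One factor of each square is expanded over \<open>T\<close>; after the exchange
    of sums the inner sum is the expansion of \<open>C\<close> over \<open>S\<close>.\<close>
  have "(\<Sum>B\<in>S. (mat_trace (B * X))\<^sup>2)
      = (\<Sum>B\<in>S. \<Sum>C\<in>T. mat_trace (C * B) * mat_trace (C * X) * mat_trace (B * X))"
    unfolding power2_eq_square sum_distrib_right[symmetric]
    by (intro sum.cong refl) (simp only: trX[OF T ST, symmetric])
  also have "\<dots> = (\<Sum>C\<in>T. mat_trace (C * X) * (\<Sum>B\<in>S. mat_trace (B * C) * mat_trace (B * X)))"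
  proof (subst sum.swap, intro sum.cong refl)
    fix C assume "C \<in> T"
    then have "mat_trace (C * B) = mat_trace (B * C)" if "B \<in> S" for B
      using that S(2) T(2) by (intro mat_trace_mult_comm[of _ D D]) auto
    then show "(\<Sum>B\<in>S. mat_trace (C * B) * mat_trace (C * X) * mat_trace (B * X)) =
        mat_trace (C * X) * (\<Sum>B\<in>S. mat_trace (B * C) * mat_trace (B * X))"
      by (simp add: sum_distrib_left mult_ac)
  qed
  also have "\<dots> = (\<Sum>C\<in>T. (mat_trace (C * X))\<^sup>2)"
    unfolding power2_eq_square
    by (intro sum.cong refl) (simp only: trX[OF S TS, symmetric])
  finally show ?thesis .
qed

section \<open>Sectors and their product bases\<close>

definition pattern :: "nat list \<Rightarrow> complex mat list \<Rightarrow> bool list" where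
  "pattern ds As = map2 (\<lambda>d A. A \<noteq> normid d) ds As"

definition sector_index :: "nat list \<Rightarrow> bool list \<Rightarrow> complex mat list set" where
  "sector_index ds \<kappa> = {As \<in> tensor_index ds. pattern ds As = \<kappa>}"

locale qubit_blocks =
  fixes ds :: "nat list"
  assumes qubit_blocks: "\<And>d. d \<in> set ds \<Longrightarrow> qubit_block d"
begin

abbreviation D where "D \<equiv> prod_list ds"

lemma tensor_index_squareD: "As \<in> tensor_index ds \<Longrightarrow> square_mats ds As"
  using tensor_index_square qubit_blocks by blast

lemma tensor_index_carrier: "As \<in> tensor_index ds \<Longrightarrow> tensor_mats As \<in> carrier_mat D D"
  using tensor_index_squareD by simp

lemma tensor_inj: "inj_on tensor_mats (tensor_index ds)"
  and tensor_onb: "hs_onb D (tensor_mats ` tensor_index ds)"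
  using hs_onb_tensor qubit_blocks by auto

lemma finite_tensor_index [simp]: "finite (tensor_index ds)"
  using hs_onbD(1)[OF tensor_onb] tensor_inj finite_image_iff by blast

lemma tensor_hermitian: "As \<in> tensor_index ds \<Longrightarrow> hermitian_mat (tensor_mats As)"
  using hs_onbD(3)[OF tensor_onb] by auto

lemma tensor_orthonormal:
  assumes "As \<in> tensor_index ds" "Bs \<in> tensor_index ds"
  shows "mat_trace (tensor_mats As * tensor_mats Bs) = (if As = Bs then 1 else 0)"
  using assms hs_onbD(4)[OF tensor_onb] inj_onD[OF tensor_inj] by (metis imageI)

lemma tensor_expand:
  assumes "X \<in> carrier_mat D D" "i < D" "j < D"
  shows "X $$ (i, j) = (\<Sum>As\<in>tensor_index ds. mat_trace (tensor_mats As * X) * tensor_mats As $$ (i, j))"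
  using hs_onb_expand[OF tensor_onb assms] by (simp add: sum.reindex[OF tensor_inj])

lemma tensor_trace_expand:
  assumes "X \<in> carrier_mat D D" "Y \<in> carrier_mat D D"
  shows "mat_trace (X * Y) = (\<Sum>As\<in>tensor_index ds. mat_trace (tensor_mats As * X) * mat_trace (tensor_mats As * Y))"
  using hs_onb_trace_expand[OF tensor_onb assms] by (simp add: sum.reindex[OF tensor_inj])

lemma mat_trace_tensor_mult:
  assumes "square_mats ds As" "square_mats ds Bs"
  shows "mat_trace (tensor_mats As * tensor_mats Bs) = (\<Prod>m<length ds. mat_trace (As ! m * Bs ! m))"
proof -
  have l: "length As = length ds" "length Bs = length ds" using assms by (auto simp: list_all2_conv_all_nth)
  have "square_mats ds (map2 (*) As Bs)"
    using assms l by (auto simp: list_all2_conv_all_nth)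
  then have "mat_trace (tensor_mats As * tensor_mats Bs) = (\<Prod>A\<leftarrow>map2 (*) As Bs. mat_trace A)"
    using tensor_mats_mult[OF assms] mat_trace_tensor_mats by simp
  also have "\<dots> = (\<Prod>m<length ds. mat_trace (As ! m * Bs ! m))"
    using l by (simp add: prod.list_conv_set_nth lessThan_atLeast0)
  finally show ?thesis .
qed

lemma block_basisD:
  assumes "m < length ds"
  shows "hs_onb (ds ! m) (block_basis (ds ! m))" "normid (ds ! m) \<in> block_basis (ds ! m)"
  using block_basis qubit_blocks assms by auto

lemma dim_pos: "m < length ds \<Longrightarrow> 0 < ds ! m"
  using qubit_blocks[of "ds ! m"] by (auto simp: qubit_block_def)

text \<open>The overlap with \<open>normid d\<close> is the trace divided by \<open>sqrt d\<close>,
  so orthonormality decides the trace.\<close>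

lemma mat_trace_block:
  assumes "m < length ds" "A \<in> block_basis (ds ! m)" 
  shows "mat_trace A = (if A = normid (ds ! m) then complex_of_real (sqrt (ds ! m)) else 0)"
proof -
  note A = hs_onbD(2)[OF block_basisD(1)[OF assms(1)] assms(2)]
  have "normid (ds ! m) * A = complex_of_real (1 / sqrt (ds ! m)) \<cdot>\<^sub>m A"
    using A by (simp add: normid_def mult_smult_assoc_mat[OF one_carrier_mat A])
  then have "complex_of_real (1 / sqrt (ds ! m)) * mat_trace A = mat_trace (normid (ds ! m) * A)"
    using A by simp
  also have "\<dots> = (if A = normid (ds ! m) then 1 else 0)"
    using hs_onbD(4)[OF block_basisD(1)[OF assms(1)] block_basisD(2)[OF assms(1)] assms(2)] by auto
  finally show ?thesis using dim_pos[OF assms(1)] by (auto simp: field_simps)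
qed

lemma tensor_index_nth: "As \<in> tensor_index ds \<Longrightarrow> m < length ds \<Longrightarrow> As ! m \<in> block_basis (ds ! m)"
  by (auto simp: tensor_index_iff list_all2_conv_all_nth)

lemma tensor_index_length: "As \<in> tensor_index ds \<Longrightarrow> length As = length ds"
  by (auto simp: tensor_index_iff list_all2_lengthD)

lemma pattern_nth: "As \<in> tensor_index ds \<Longrightarrow> m < length ds \<Longrightarrow> pattern ds As ! m \<longleftrightarrow> As ! m \<noteq> normid (ds ! m)"
  by (simp add: pattern_def tensor_index_length)

lemma pattern_length: "As \<in> tensor_index ds \<Longrightarrow> length (pattern ds As) = length ds"
  by (simp add: pattern_def tensor_index_length)

lemma sector_index_subset: "sector_index ds \<kappa> \<subseteq> tensor_index ds"
  by (auto simp: sector_index_def)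

lemma finite_sector_index [simp]: "finite (sector_index ds \<kappa>)"
  using finite_subset[OF sector_index_subset] by simp

lemma sector_tensors_carrier: "sector_tensors ds \<kappa> \<subseteq> carrier_mat D D"
  unfolding sector_tensors_def by (auto simp: list_all2_conv_all_nth intro!: tensor_mats_carrier)

lemma sector_basis_orthonormal:
  "finite (tensor_mats ` sector_index ds \<kappa>)" "tensor_mats ` sector_index ds \<kappa> \<subseteq> carrier_mat D D"
  "hs_orthonormal (tensor_mats ` sector_index ds \<kappa>)"
  using tensor_orthonormal inj_on_eq_iff[OF tensor_inj]
  by (auto simp: hs_orthonormal_def tensor_index_carrier sector_index_def)

text \<open>The sector described by vanishing coordinates. The span of the defining tensors and the
  span of the basis tensors are both compared with this set.\<close>

definition sector_space :: "bool list \<Rightarrow> complex mat set" where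
  "sector_space \<kappa> = {X \<in> carrier_mat D D. \<forall>As\<in>tensor_index ds. pattern ds As \<noteq> \<kappa> \<longrightarrow> mat_trace (tensor_mats As * X) = 0}"

lemma op_span_sector_space:
  assumes "S \<subseteq> sector_space \<kappa>"
  shows "op_span D S \<subseteq> sector_space \<kappa>"
proof
  interpret M: matrix_vs D D "TYPE(complex)" .
  fix X assume "X \<in> op_span D S"
  then obtain a A where A: "X = M.lincomb a A" "finite A" "A \<subseteq> S" unfolding M.span_def by auto
  have AC: "A \<subseteq> carrier_mat D D" using A assms by (auto simp: sector_space_def)
  show "X \<in> sector_space \<kappa>"
    unfolding sector_space_def A(1)
  proof (intro CollectI conjI ballI impI)
    show "M.lincomb a A \<in> carrier_mat D D" using op_lincomb[OF A(2) AC] by blast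
    fix As assume As: "As \<in> tensor_index ds" "pattern ds As \<noteq> \<kappa>"
    then have "mat_trace (tensor_mats As * B) = 0" if "B \<in> A" for B
      using that A(3) assms by (auto simp: sector_space_def)
    then show "mat_trace (tensor_mats As * M.lincomb a A) = 0"
      by (simp add: mat_trace_op_lincomb[OF A(2) AC tensor_index_carrier[OF As(1)]])
  qed
qed

lemma span_sector_basis: "op_span D (tensor_mats ` sector_index ds \<kappa>) = sector_space \<kappa>"
proof
  interpret M: matrix_vs D D "TYPE(complex)" .
  show "op_span D (tensor_mats ` sector_index ds \<kappa>) \<subseteq> sector_space \<kappa>"
    by (rule op_span_sector_space)
      (auto simp: sector_space_def sector_index_def tensor_index_carrier tensor_orthonormal)
  show "sector_space \<kappa> \<subseteq> op_span D (tensor_mats ` sector_index ds \<kappa>)"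
  proof
    fix X assume X: "X \<in> sector_space \<kappa>"
    then have XC: "X \<in> carrier_mat D D" by (simp add: sector_space_def)
    note S = sector_basis_orthonormal[of \<kappa>]
    have inj: "inj_on tensor_mats (sector_index ds \<kappa>)"
      using tensor_inj sector_index_subset by (rule inj_on_subset)
    have "X = M.lincomb (\<lambda>B. mat_trace (B * X)) (tensor_mats ` sector_index ds \<kappa>)"
    proof (rule eq_matI)
      fix i j assume "i < dim_row (M.lincomb (\<lambda>B. mat_trace (B * X)) (tensor_mats ` sector_index ds \<kappa>))"
        "j < dim_col (M.lincomb (\<lambda>B. mat_trace (B * X)) (tensor_mats ` sector_index ds \<kappa>))"
      then have ij: "i < D" "j < D" unfolding carrier_matD[OF op_lincomb(1)[OF S(1,2)]] .
      \<comment> \<open>Coordinates outside the sector vanish, so the full expansion shrinks to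
        \<open>sector_index\<close>.\<close>
      have "X $$ (i, j) = (\<Sum>As\<in>sector_index ds \<kappa>. mat_trace (tensor_mats As * X) * tensor_mats As $$ (i, j))"
        unfolding tensor_expand[OF XC ij] using X
        by (intro sum.mono_neutral_right) (auto simp: sector_index_def sector_space_def)
      then show "X $$ (i, j) = M.lincomb (\<lambda>B. mat_trace (B * X)) (tensor_mats ` sector_index ds \<kappa>) $$ (i, j)"
        unfolding op_lincomb(2)[OF S(1,2) ij] by (simp add: sum.reindex[OF inj])
    qed (use XC in \<open>simp_all only: op_lincomb_dim[OF S(1,2)] carrier_matD\<close>)
    then show "X \<in> op_span D (tensor_mats ` sector_index ds \<kappa>)"
      unfolding M.span_def using S(1) by blast
  qed
qed

text \<open>A basis tensor of another pattern differs from \<open>\<kappa>\<close> at some factor;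
  there a multiple of the identity meets a traceless matrix, so the overlap has a zero factor.
  Conversely, a basis tensor is a scalar multiple of a defining tensor, obtained by replacing its
  \<open>normid\<close> factors by identities.\<close>

lemma span_sector_tensors:
  assumes "length \<kappa> = length ds"
  shows "op_span D (sector_tensors ds \<kappa>) = sector_space \<kappa>"
proof
  interpret M: matrix_vs D D "TYPE(complex)" .
  show "op_span D (sector_tensors ds \<kappa>) \<subseteq> sector_space \<kappa>"
  proof (rule op_span_sector_space, rule subsetI)
    fix X assume X: "X \<in> sector_tensors ds \<kappa>"
    then obtain Ts where Ts: "X = tensor_mats Ts" "length Ts = length ds"
      "\<And>m. m < length ds \<Longrightarrow> Ts ! m \<in> carrier_mat (ds ! m) (ds ! m)"
      "\<And>m. m < length ds \<Longrightarrow> (if \<kappa> ! m then mat_trace (Ts ! m) = 0 else Ts ! m = 1\<^sub>m (ds ! m))"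
      unfolding sector_tensors_def by auto
    have sq: "square_mats ds Ts" using Ts by (auto simp: list_all2_conv_all_nth)
    show "X \<in> sector_space \<kappa>"
      unfolding sector_space_def
    proof (intro CollectI conjI ballI impI)
      show "X \<in> carrier_mat D D" using X sector_tensors_carrier by auto
      fix As assume As: "As \<in> tensor_index ds" "pattern ds As \<noteq> \<kappa>"
      then obtain m where m: "m < length ds" "pattern ds As ! m \<noteq> \<kappa> ! m"
        using nth_equalityI[of "pattern ds As" \<kappa>] pattern_length[OF As(1)] assms by auto
      note Am = tensor_index_nth[OF As(1) m(1)]
      note Ac = hs_onbD(2)[OF block_basisD(1)[OF m(1)] Am]
      have "mat_trace (As ! m * Ts ! m) = 0"
      proof (cases "\<kappa> ! m")
        case True
        then have "As ! m = normid (ds ! m)" using m pattern_nth[OF As(1) m(1)] by simp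
        then show ?thesis using Ts(3,4)[OF m(1)] True
          by (simp add: normid_def mult_smult_assoc_mat[OF one_carrier_mat Ts(3)[OF m(1)]])
      next
        case False
        then show ?thesis using Ts(3,4)[OF m(1)] pattern_nth[OF As(1) m(1)] m Ac mat_trace_block[OF m(1) Am] by simp
      qed
      then show "mat_trace (tensor_mats As * X) = 0"
        unfolding Ts(1) mat_trace_tensor_mult[OF tensor_index_squareD[OF As(1)] sq]
        using m(1) by (intro prod_zero) auto
    qed
  qed
  have "tensor_mats ` sector_index ds \<kappa> \<subseteq> op_span D (sector_tensors ds \<kappa>)"
  proof (rule image_subsetI)
    fix As assume As': "As \<in> sector_index ds \<kappa>"
    then have As: "As \<in> tensor_index ds" and pat: "pattern ds As = \<kappa>" by (auto simp: sector_index_def)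
    note l = tensor_index_length[OF As]
    \<comment> \<open>The scalars \<open>1 / sqrt d\<close> of the \<open>normid\<close> factors are
      collected in \<open>cs\<close>.\<close>
    define Ts where "Ts = map (\<lambda>m. if \<kappa> ! m then As ! m else 1\<^sub>m (ds ! m)) [0..<length ds]"
    define cs where "cs = map (\<lambda>m. if \<kappa> ! m then 1 else complex_of_real (1 / sqrt (real (ds ! m)))) [0..<length ds]"
    have Ac: "As ! m \<in> carrier_mat (ds ! m) (ds ! m)" if "m < length ds" for m
      using tensor_index_squareD[OF As] that by (auto simp: list_all2_conv_all_nth)
    have "As = map2 (\<cdot>\<^sub>m) cs Ts"
    proof (rule nth_equalityI)
      fix m assume "m < length As"
      then have m: "m < length ds" using l by simp
      have "(1::complex) \<cdot>\<^sub>m As ! m = As ! m" by (rule eq_matI) auto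
      then show "As ! m = map2 (\<cdot>\<^sub>m) cs Ts ! m"
        using m pattern_nth[OF As m] unfolding pat by (auto simp: cs_def Ts_def normid_def)
    qed (simp add: l cs_def Ts_def)
    then have *: "tensor_mats As = prod_list cs \<cdot>\<^sub>m tensor_mats Ts"
      using tensor_mats_smult[of cs Ts] by (simp add: cs_def Ts_def)
    have "tensor_mats Ts \<in> sector_tensors ds \<kappa>"
      unfolding sector_tensors_def
      by (intro CollectI exI[of _ Ts] conjI refl allI impI)
        (use Ac pattern_nth[OF As] mat_trace_block[OF _ tensor_index_nth[OF As]] pat in \<open>auto simp: Ts_def\<close>)
    then have "tensor_mats Ts \<in> op_span D (sector_tensors ds \<kappa>)"
      using M.in_own_span[OF sector_tensors_carrier] by auto
    moreover have "submodule class_ring (op_span D (sector_tensors ds \<kappa>)) (operator_space D)"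
      by (rule M.span_is_submodule[OF sector_tensors_carrier])
    ultimately have "prod_list cs \<odot>\<^bsub>operator_space D\<^esub> tensor_mats Ts \<in> op_span D (sector_tensors ds \<kappa>)"
      by (intro submodule.smult_closed) auto
    then show "tensor_mats As \<in> op_span D (sector_tensors ds \<kappa>)"
      unfolding * by (simp add: module_mat_simps)
  qed
  then show "sector_space \<kappa> \<subseteq> op_span D (sector_tensors ds \<kappa>)"
    unfolding span_sector_basis[symmetric]
    by (intro M.span_is_subset M.span_is_submodule sector_tensors_carrier)
qed

lemma sector_vectorspace: "vectorspace class_ring (sector ds \<kappa>)"
proof -
  interpret M: matrix_vs D D "TYPE(complex)" .
  show ?thesis unfolding sector_def
    by (intro M.subspace_is_vs M.span_is_subspace sector_tensors_carrier)
qed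

text \<open>Span and linear dependence inside the sector agree with those in the full operator
  space, and orthonormality already gives linear independence. So the abstract notion of basis
  becomes a statement about \<open>op_span\<close>.\<close>

lemma hermitian_onb_iff:
  assumes l: "length \<kappa> = length ds"
  shows "hermitian_onb ds \<kappa> S \<longleftrightarrow> S \<subseteq> carrier_mat D D \<and> op_span D S = sector_space \<kappa> \<and>
    (\<forall>B\<in>S. hermitian_mat B) \<and> hs_orthonormal S"
proof -
  interpret M: matrix_vs D D "TYPE(complex)" .
  interpret N: vectorspace class_ring "sector ds \<kappa>" by (rule sector_vectorspace)
  note eq = span_sector_tensors[OF l]
  have sub: "submodule class_ring (sector_space \<kappa>) (operator_space D)"
    unfolding eq[symmetric] by (rule M.span_is_submodule[OF sector_tensors_carrier])
  have sec: "sector ds \<kappa> = (operator_space D)\<lparr>carrier := sector_space \<kappa>\<rparr>"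
    unfolding sector_def eq ..
  have carr: "carrier (sector ds \<kappa>) = sector_space \<kappa>" unfolding sec by simp
  have spC: "sector_space \<kappa> \<subseteq> carrier_mat D D" by (auto simp: sector_space_def)
  have nd: "N.span S = op_span D S" "N.lin_dep S \<longleftrightarrow> M.lin_dep S" if "S \<subseteq> sector_space \<kappa>"
    using M.span_li_not_depend[OF that sub] unfolding sec by auto
  have inner: "(\<forall>B\<in>S. \<forall>C\<in>S. hs_inner B C = (if B = C then 1 else 0)) \<longleftrightarrow> hs_orthonormal S"
    if "\<forall>B\<in>S. hermitian_mat B"
    using that unfolding hs_orthonormal_def hs_inner_def hermitian_mat_def by auto
  have own: "S \<subseteq> sector_space \<kappa>" if "S \<subseteq> carrier_mat D D" "op_span D S = sector_space \<kappa>"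
    using M.in_own_span[of S] that by auto
  show ?thesis
    unfolding hermitian_onb_def N.basis_def carr
    using nd inner own spC hs_orthonormal_lin_indpt[of S D] by auto
qed

lemma hermitian_onb_sector_basis:
  "length \<kappa> = length ds \<Longrightarrow> hermitian_onb ds \<kappa> (tensor_mats ` sector_index ds \<kappa>)"
  using hermitian_onb_iff sector_basis_orthonormal span_sector_basis sector_index_subset tensor_hermitian
  by (auto simp: subset_iff)

lemma sector_dim_eq:
  assumes "length \<kappa> = length ds"
  shows "sector_dim ds \<kappa> = card (sector_index ds \<kappa>)"
proof -
  interpret N: vectorspace class_ring "sector ds \<kappa>" by (rule sector_vectorspace)
  have "N.basis (tensor_mats ` sector_index ds \<kappa>)"
    using hermitian_onb_sector_basis[OF assms] by (simp add: hermitian_onb_def)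
  then have "sector_dim ds \<kappa> = card (tensor_mats ` sector_index ds \<kappa>)"
    unfolding sector_dim_def by (intro N.dim_basis) simp_all
  also have "\<dots> = card (sector_index ds \<kappa>)"
    by (rule card_image, rule inj_on_subset[OF tensor_inj sector_index_subset])
  finally show ?thesis .
qed

text \<open>Replaces the basis chosen in \<open>locality\<close> by the basis tensors; later
  computations of locality vectors start from this.\<close>

lemma locality_eq:
  assumes l: "length \<kappa> = length ds" and X: "X \<in> carrier_mat D D"
  shows "locality ds X \<kappa> = Re (\<Sum>As\<in>sector_index ds \<kappa>. (mat_trace (tensor_mats As * X))\<^sup>2)"
proof -
  interpret N: vectorspace class_ring "sector ds \<kappa>" by (rule sector_vectorspace)
  define S where "S = (SOME S. hermitian_onb ds \<kappa> S)"
  note B = hermitian_onb_sector_basis[OF l]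
  have S: "hermitian_onb ds \<kappa> S" unfolding S_def by (rule someI, rule B)
  have "N.basis (tensor_mats ` sector_index ds \<kappa>)" "N.basis S"
    using B S by (simp_all add: hermitian_onb_def)
  \<comment> \<open>A sum over an infinite set would be 0 by convention, so finiteness of the chosen
    basis is derived from the finite dimension of the sector.\<close>
  then have "finite S"
    unfolding N.basis_def N.fin_dim_def[symmetric]
    by (intro N.fin_dim_li_fin[unfolded N.fin_dim_def])
      (blast intro: sector_basis_orthonormal(1))+
  then have "(\<Sum>B\<in>S. (mat_trace (B * X))\<^sup>2) = (\<Sum>B\<in>tensor_mats ` sector_index ds \<kappa>. (mat_trace (B * X))\<^sup>2)"
    using S[unfolded hermitian_onb_iff[OF l]] sector_basis_orthonormal X span_sector_basis
    by (intro sum_trace_sq_basis_indep) auto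
  also have "\<dots> = (\<Sum>As\<in>sector_index ds \<kappa>. (mat_trace (tensor_mats As * X))\<^sup>2)"
    by (simp add: sum.reindex[OF inj_on_subset[OF tensor_inj sector_index_subset]])
  finally show ?thesis unfolding locality_def S_def by simp
qed

end

subsection \<open>Bounded measurable functions\<close>

text \<open>A class closed under sums, products and conjugation, and contained in the integrable
  functions of every finite measure. Integrability of the polynomial expressions below then follows
  from their shape.\<close>

definition bdd_measurable :: "'a measure \<Rightarrow> ('a \<Rightarrow> complex) \<Rightarrow> bool" where
  "bdd_measurable M f \<longleftrightarrow> f \<in> borel_measurable M \<and> (\<exists>C. \<forall>x\<in>space M. norm (f x) \<le> C)"

lemma bdd_measurable_const [simp]: "bdd_measurable M (\<lambda>_. c)"
  by (auto simp: bdd_measurable_def)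

lemma bdd_measurable_mult:
  assumes "bdd_measurable M f" "bdd_measurable M g"
  shows "bdd_measurable M (\<lambda>x. f x * g x)"
proof -
  obtain C D where CD: "\<And>x. x \<in> space M \<Longrightarrow> norm (f x) \<le> C" "\<And>x. x \<in> space M \<Longrightarrow> norm (g x) \<le> D"
    using assms unfolding bdd_measurable_def by auto
  have "norm (f x * g x) \<le> \<bar>C\<bar> * \<bar>D\<bar>" if "x \<in> space M" for x
    unfolding norm_mult using CD[OF that] by (intro mult_mono) auto
  then show ?thesis using assms unfolding bdd_measurable_def by auto
qed

lemma bdd_measurable_add:
  assumes "bdd_measurable M f" "bdd_measurable M g"
  shows "bdd_measurable M (\<lambda>x. f x + g x)"
proof -
  obtain C D where CD: "\<And>x. x \<in> space M \<Longrightarrow> norm (f x) \<le> C" "\<And>x. x \<in> space M \<Longrightarrow> norm (g x) \<le> D"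
    using assms unfolding bdd_measurable_def by auto
  have "norm (f x + g x) \<le> C + D" if "x \<in> space M" for x
    using CD[OF that] norm_triangle_ineq[of "f x" "g x"] by linarith
  then show ?thesis using assms unfolding bdd_measurable_def by auto
qed

lemma bdd_measurable_sum:
  assumes "\<And>i. i \<in> I \<Longrightarrow> bdd_measurable M (f i)"
  shows "bdd_measurable M (\<lambda>x. \<Sum>i\<in>I. f i x)"
  using assms by (induction I rule: infinite_finite_induct) (auto intro: bdd_measurable_add)

lemma bdd_measurable_prod:
  assumes "\<And>i. i \<in> I \<Longrightarrow> bdd_measurable M (f i)"
  shows "bdd_measurable M (\<lambda>x. \<Prod>i\<in>I. f i x)"
  using assms by (induction I rule: infinite_finite_induct) (auto intro: bdd_measurable_mult)

lemma bdd_measurable_cnj: "bdd_measurable M f \<Longrightarrow> bdd_measurable M (\<lambda>x. cnj (f x))"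
  by (auto simp: bdd_measurable_def intro!: borel_measurable_continuous_on[OF continuous_on_cnj])

lemma bdd_measurable_compose:
  assumes "bdd_measurable N f" "X \<in> measurable M N"
  shows "bdd_measurable M (\<lambda>x. f (X x))"
  using assms measurable_space[OF assms(2)] unfolding bdd_measurable_def
  by (auto intro: measurable_compose)

lemma bdd_measurable_cong:
  assumes "\<And>x. x \<in> space M \<Longrightarrow> f x = g x"
  shows "bdd_measurable M f \<longleftrightarrow> bdd_measurable M g"
  using assms measurable_cong[of M f g borel] unfolding bdd_measurable_def by auto

lemma (in finite_measure) bdd_measurable_integrable: "bdd_measurable M f \<Longrightarrow> integrable M f"
  unfolding bdd_measurable_def by (auto intro: integrable_const_bound[OF AE_I2])

lemma bdd_measurable_cong_sets:
  "sets M = sets N \<Longrightarrow> bdd_measurable M f \<longleftrightarrow> bdd_measurable N f"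
  using measurable_cong_sets[of M N borel borel] sets_eq_imp_space_eq[of M N]
  unfolding bdd_measurable_def by auto

subsection \<open>The unitary group\<close>

lemma unitary_groupD:
  assumes "V \<in> unitary_group d"
  shows "V \<in> carrier_mat d d" "mat_adjoint V * V = 1\<^sub>m d" "V * mat_adjoint V = 1\<^sub>m d"
  using assms by (auto simp: unitary_group_def)

text \<open>For square matrices a right inverse is also a left inverse.\<close>

lemma unitary_groupI:
  assumes "V \<in> carrier_mat d d" "V * mat_adjoint V = 1\<^sub>m d"
  shows "V \<in> unitary_group d"
  using assms mat_mult_left_right_inverse[of V d "mat_adjoint V"] by (auto simp: unitary_group_def)

lemma unitary_group_adjoint: "V \<in> unitary_group d \<Longrightarrow> mat_adjoint V \<in> unitary_group d"
  by (auto simp: unitary_group_def)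

lemma unitary_group_mult:
  assumes "V \<in> unitary_group d" "W \<in> unitary_group d"
  shows "V * W \<in> unitary_group d"
proof (rule unitary_groupI)
  note V = unitary_groupD[OF assms(1)] and W = unitary_groupD[OF assms(2)]
  note c = V(1) W(1) mat_adjoint_carrier[OF V(1)] mat_adjoint_carrier[OF W(1)]
  have "V * W * (mat_adjoint W * mat_adjoint V) = V * W * mat_adjoint W * mat_adjoint V"
    by (rule assoc_mult_mat[symmetric, of _ d d _ d _ d]) (use c in auto)
  also have "V * W * mat_adjoint W = V * (W * mat_adjoint W)"
    by (rule assoc_mult_mat[of _ d d _ d _ d]) (use c in auto)
  finally show "V * W * mat_adjoint (V * W) = 1\<^sub>m d"
    unfolding mat_adjoint_mult[OF V(1) W(1)] W(3) using V by simp
  show "V * W \<in> carrier_mat d d" using c by simp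
qed

text \<open>Each row is a unit vector. This is the source of the boundedness of functions of random
  unitaries.\<close>

lemma norm_unitary_entry:
  assumes V: "V \<in> unitary_group d" and "i < d" "j < d"
  shows "norm (V $$ (i, j)) \<le> 1"
proof -
  note Vc = unitary_groupD(1)[OF V]
  have "(V * mat_adjoint V) $$ (i, i) = (\<Sum>k<d. V $$ (i, k) * mat_adjoint V $$ (k, i))"
    using assms Vc by (intro mat_mult_index[of V d d "mat_adjoint V" d]) auto
  also have "\<dots> = (\<Sum>k<d. complex_of_real ((norm (V $$ (i, k)))\<^sup>2))"
    using assms Vc by (intro sum.cong refl) (simp add: complex_norm_square del: of_real_power)
  finally have "complex_of_real (\<Sum>k<d. (norm (V $$ (i, k)))\<^sup>2) = 1"
    using assms unitary_groupD(3)[OF V] by simp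
  then have "(\<Sum>k<d. (norm (V $$ (i, k)))\<^sup>2) = 1" using of_real_eq_1_iff by blast
  moreover have "(norm (V $$ (i, j)))\<^sup>2 \<le> (\<Sum>k<d. (norm (V $$ (i, k)))\<^sup>2)"
    using assms by (intro member_le_sum) auto
  ultimately have "(norm (V $$ (i, j)))\<^sup>2 \<le> 1\<^sup>2" by simp
  then show ?thesis by (rule power2_le_imp_le) simp
qed

lemma space_unitary_borel [simp]: "space (unitary_borel d) = unitary_group d"
  by (simp add: unitary_borel_def)

lemma measurable_unitary_entry:
  assumes "i < d" "j < d"
  shows "(\<lambda>V. V $$ (i, j)) \<in> borel_measurable (unitary_borel d)"
proof -
  have "(\<lambda>V. \<lambda>ij\<in>{..<d} \<times> {..<d}. V $$ ij) \<in> measurable (unitary_borel d) (Pi\<^sub>M ({..<d} \<times> {..<d}) (\<lambda>_. borel))"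
    unfolding unitary_borel_def by (rule measurable_vimage_algebra1) (auto simp: space_PiM)
  from measurable_compose[OF this measurable_component_singleton[of "(i, j)"]]
  show ?thesis using assms by simp
qed

lemma measurable_into_unitary_borel:
  assumes "\<And>x. x \<in> space M \<Longrightarrow> f x \<in> unitary_group d"
    and "\<And>i j. i < d \<Longrightarrow> j < d \<Longrightarrow> (\<lambda>x. f x $$ (i, j)) \<in> borel_measurable M"
  shows "f \<in> measurable M (unitary_borel d)"
  unfolding unitary_borel_def
proof (rule measurable_vimage_algebra2)
  show "(\<lambda>x. \<lambda>ij\<in>{..<d} \<times> {..<d}. f x $$ ij) \<in> measurable M (Pi\<^sub>M ({..<d} \<times> {..<d}) (\<lambda>_. borel))"
    by (rule measurable_restrict) (use assms in auto)
qed (use assms in auto)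

lemma bdd_measurable_unitary_entry:
  "i < d \<Longrightarrow> j < d \<Longrightarrow> bdd_measurable (unitary_borel d) (\<lambda>V. V $$ (i, j))"
  unfolding bdd_measurable_def using measurable_unitary_entry norm_unitary_entry
  by (auto intro!: exI[of _ 1])

lemma bdd_measurable_conj_entry:
  assumes B: "B \<in> carrier_mat d d" and ij: "i < d" "j < d"
  shows "bdd_measurable (unitary_borel d) (\<lambda>V. (V * B * mat_adjoint V) $$ (i, j))"
proof -
  have "bdd_measurable (unitary_borel d) (\<lambda>V. \<Sum>k<d. \<Sum>l<d. V $$ (i, k) * B $$ (k, l) * cnj (V $$ (j, l)))"
    by (intro bdd_measurable_sum bdd_measurable_mult bdd_measurable_cnj bdd_measurable_unitary_entry
      bdd_measurable_const) (use ij in auto)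
  then show ?thesis
  proof (rule iffD1[OF bdd_measurable_cong, rotated])
    fix V assume "V \<in> space (unitary_borel d)"
    then have V: "V \<in> carrier_mat d d" using unitary_groupD by auto
    show "(\<Sum>k<d. \<Sum>l<d. V $$ (i, k) * B $$ (k, l) * cnj (V $$ (j, l))) = (V * B * mat_adjoint V) $$ (i, j)"
      unfolding mat_mult3_index[OF V B mat_adjoint_carrier[OF V] ij]
      by (intro sum.cong refl) (use V ij in auto)
  qed
qed

lemma bdd_measurable_adjoint_conj_entry:
  assumes B: "B \<in> carrier_mat d d" and ij: "i < d" "j < d"
  shows "bdd_measurable (unitary_borel d) (\<lambda>V. (mat_adjoint V * B * V) $$ (i, j))"
proof -
  have "bdd_measurable (unitary_borel d) (\<lambda>V. \<Sum>k<d. \<Sum>l<d. cnj (V $$ (k, i)) * B $$ (k, l) * V $$ (l, j))"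
    by (intro bdd_measurable_sum bdd_measurable_mult bdd_measurable_cnj bdd_measurable_unitary_entry
      bdd_measurable_const) (use ij in auto)
  then show ?thesis
  proof (rule iffD1[OF bdd_measurable_cong, rotated])
    fix V assume "V \<in> space (unitary_borel d)"
    then have V: "V \<in> carrier_mat d d" using unitary_groupD by auto
    show "(\<Sum>k<d. \<Sum>l<d. cnj (V $$ (k, i)) * B $$ (k, l) * V $$ (l, j)) = (mat_adjoint V * B * V) $$ (i, j)"
      unfolding mat_mult3_index[OF mat_adjoint_carrier[OF V] B V ij]
      by (intro sum.cong refl) (use V ij in auto)
  qed
qed

lemma bdd_measurable_trace:
  assumes "A \<in> carrier_mat d d" "\<And>x. x \<in> space M \<Longrightarrow> Z x \<in> carrier_mat d d"
    "\<And>i j. i < d \<Longrightarrow> j < d \<Longrightarrow> bdd_measurable M (\<lambda>x. Z x $$ (i, j))"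
  shows "bdd_measurable M (\<lambda>x. mat_trace (A * Z x))"
proof -
  have "bdd_measurable M (\<lambda>x. \<Sum>i<d. \<Sum>j<d. A $$ (i, j) * Z x $$ (j, i))"
    by (intro bdd_measurable_sum bdd_measurable_mult assms(3)) auto
  then show ?thesis
    by (rule iffD1[OF bdd_measurable_cong, rotated]) (simp add: mat_trace_mult[OF assms(1,2)])
qed

subsection \<open>Invariant bilinear forms\<close>

text \<open>Permutations with phases, the first kind of test unitaries in the classification of
  invariant forms.\<close>

lemma unitary_monomial:
  assumes q: "q permutes {..<d}" and w: "\<And>i. i < d \<Longrightarrow> norm (w i :: complex) = 1"
  shows "mat d d (\<lambda>(i, a). if a = q i then w i else 0) \<in> unitary_group d"
proof (rule unitary_groupI)
  let ?W = "mat d d (\<lambda>(i, a). if a = q i then w i else 0)"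
  have W: "?W \<in> carrier_mat d d" by simp
  show "?W * mat_adjoint ?W = 1\<^sub>m d"
  proof (rule eq_matI)
    fix i j assume "i < dim_row (1\<^sub>m d :: complex mat)" "j < dim_col (1\<^sub>m d :: complex mat)"
    then have ij: "i < d" "j < d" by auto
    have qi: "q i < d" using permutes_in_image[OF q, of i] ij by simp
    have "(?W * mat_adjoint ?W) $$ (i, j) = (\<Sum>a<d. if a = q i then (if q i = q j then w i * cnj (w j) else 0) else 0)"
      unfolding mat_mult_index[OF W mat_adjoint_carrier[OF W] ij]
      using ij by (intro sum.cong refl) auto
    also have "\<dots> = (if i = j then 1 else 0)"
      using qi w[OF ij(1)] permutes_inj[OF q] by (auto simp: inj_eq complex_norm_square[symmetric])
    finally show "(?W * mat_adjoint ?W) $$ (i, j) = (1\<^sub>m d :: complex mat) $$ (i, j)" using ij by simp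
  qed auto
qed auto

text \<open>Twofold transitivity: the first transposition sends \<open>i\<close> to
  \<open>a\<close>; the second moves the image of \<open>k\<close> to \<open>b\<close> and leaves
  \<open>a\<close> alone, since \<open>a\<close> is neither of its two points.\<close>

lemma ex_permutes_pair:
  assumes "a < d" "b < d" "a \<noteq> b" "i < d" "k < d" "i \<noteq> k"
  shows "\<exists>q. q permutes {..<d} \<and> q i = a \<and> q k = (b::nat)"
proof -
  let ?k = "Transposition.transpose i a k"
  have k: "?k < d" "?k \<noteq> a" using assms by (auto simp: Transposition.transpose_def split: if_splits)
  show ?thesis
    by (rule exI[of _ "Transposition.transpose ?k b \<circ> Transposition.transpose i a"])
      (use k assms in \<open>auto intro!: permutes_compose permutes_swap_id simp: Transposition.transpose_def\<close>)
qed

text \<open>The Hadamard matrix on the first two coordinates, the identity on the rest. In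
  \<open>invariant_form\<close> its row 0 relates \<open>m 0 0 0 0\<close> to entries with mixed
  indices.\<close>

lemma unitary_hadamard:
  assumes "2 \<le> d"
  shows "\<exists>W\<in>unitary_group d. \<forall>a<d. W $$ (0, a) = (if a < 2 then complex_of_real (1 / sqrt 2) else 0)"
proof -
  let ?h = "\<lambda>i a. if i < 2 \<and> a < 2 then (if i = 1 \<and> a = 1 then - complex_of_real (1 / sqrt 2) else complex_of_real (1 / sqrt 2))
    else if i = (a::nat) then 1 else 0"
  let ?W = "mat d d (\<lambda>(i, a). ?h i a)"
  have W: "?W \<in> carrier_mat d d" by simp
  have s2: "complex_of_real (sqrt 2) * complex_of_real (sqrt 2) = 2"
    by (metis abs_numeral of_real_mult of_real_numeral real_sqrt_mult_self)
  have "?W * mat_adjoint ?W = 1\<^sub>m d"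
  proof (rule eq_matI)
    fix i j assume "i < dim_row (1\<^sub>m d :: complex mat)" "j < dim_col (1\<^sub>m d :: complex mat)"
    then have ij: "i < d" "j < d" by auto
    have split: "{..<d} = {..<2} \<union> {2..<d}" using assms by auto
    have "(?W * mat_adjoint ?W) $$ (i, j) = (\<Sum>a<d. ?h i a * cnj (?h j a))"
      unfolding mat_mult_index[OF W mat_adjoint_carrier[OF W] ij]
      using ij by (intro sum.cong refl) auto
    also have "\<dots> = (\<Sum>a<2. ?h i a * cnj (?h j a)) + (\<Sum>a\<in>{2..<d}. ?h i a * cnj (?h j a))"
      unfolding split by (rule sum.union_disjoint) auto
    also have "(\<Sum>a<2. ?h i a * cnj (?h j a)) = (if i < 2 \<and> i = j then 1 else 0)"
      using s2 by (auto simp: numeral_2_eq_2 less_Suc_eq field_simps)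
    also have "(\<Sum>a\<in>{2..<d}. ?h i a * cnj (?h j a)) = (\<Sum>a\<in>{2..<d}. if i = a then (if i = j then 1 else 0) else 0)"
      by (intro sum.cong refl) auto
    also have "\<dots> = (if 2 \<le> i \<and> i = j then 1 else 0)" using ij by auto
    finally show "(?W * mat_adjoint ?W) $$ (i, j) = (1\<^sub>m d :: complex mat) $$ (i, j)" using ij by auto
  qed auto
  then have "?W \<in> unitary_group d" by (intro unitary_groupI) auto
  then show ?thesis using assms by (intro bexI[of _ ?W]) auto
qed

text \<open>Schur-Weyl duality for two copies, in coordinates: the invariant tensors are spanned by
  the identity and the swap. Phases kill all entries whose indices do not pair up, permutations
  leave the values \<open>x\<close>, \<open>y\<close> and \<open>m 0 0 0 0\<close>, and the Hadamard
  matrix yields \<open>m 0 0 0 0 = x + y\<close>.\<close>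

lemma invariant_form:
  fixes m :: "nat \<Rightarrow> nat \<Rightarrow> nat \<Rightarrow> nat \<Rightarrow> complex"
  assumes inv: "\<And>W i j k l. W \<in> unitary_group d \<Longrightarrow> i < d \<Longrightarrow> j < d \<Longrightarrow> k < d \<Longrightarrow> l < d \<Longrightarrow>
    m i j k l = (\<Sum>a<d. \<Sum>b<d. \<Sum>c<d. \<Sum>e<d.
      W $$ (i, a) * cnj (W $$ (j, b)) * (W $$ (k, c) * cnj (W $$ (l, e))) * m a b c e)"
  shows "\<exists>x y. \<forall>i<d. \<forall>j<d. \<forall>k<d. \<forall>l<d.
    m i j k l = (if i = j \<and> k = l then x else 0) + (if i = l \<and> j = k then y else 0)"
proof -
  have mono: "m i j k l = w i * cnj (w j) * (w k * cnj (w l)) * m (q i) (q j) (q k) (q l)"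
    if q: "q permutes {..<d}" and w: "\<And>i. i < d \<Longrightarrow> norm (w i :: complex) = 1"
      and ij: "i < d" "j < d" "k < d" "l < d" for q w i j k l
  proof -
    have qd: "q i < d" if "i < d" for i using permutes_in_image[OF q, of i] that by simp
    have "m i j k l = (\<Sum>a<d. \<Sum>b<d. \<Sum>c<d. \<Sum>e<d. (if a = q i then w i else 0) *
        cnj (if b = q j then w j else 0) * ((if c = q k then w k else 0) *
        cnj (if e = q l then w l else 0)) * m a b c e)"
      by (rule trans[OF inv[OF unitary_monomial[OF q w] ij]], assumption)
        (intro sum.cong refl, use ij in simp)
    \<comment> \<open>The sums are nested so that the four deltas collapse one after the
      other.\<close>
    also have "\<dots> = (\<Sum>a<d. (if a = q i then w i else 0) *
        (\<Sum>b<d. (if b = q j then cnj (w j) else 0) * (\<Sum>c<d. (if c = q k then w k else 0) *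
        (\<Sum>e<d. (if e = q l then cnj (w l) else 0) * m a b c e))))"
      by (simp only: sum_distrib_left mult.assoc if_distrib[of cnj] complex_cnj_zero)
    also have "\<dots> = w i * cnj (w j) * (w k * cnj (w l)) * m (q i) (q j) (q k) (q l)"
      using qd ij by (simp add: mult_delta_left)
    finally show ?thesis .
  qed
  have perm: "m i j k l = m (q i) (q j) (q k) (q l)"
    if "q permutes {..<d}" "i < d" "j < d" "k < d" "l < d" for q i j k l
    using mono[OF that(1) _ that(2-), of "\<lambda>_. 1"] by simp
  have zero: "m i j k l = 0" if ij: "i < d" "j < d" "k < d" "l < d"
    and ne: "\<not> (i = j \<and> k = l)" "\<not> (i = l \<and> j = k)" for i j k l
  proof -
    \<comment> \<open>The total phase is \<open>\<i>\<close> to the power p - q, where p counts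
      \<open>x\<close> in \<open>(i, k)\<close> and q counts it in \<open>(j, l)\<close>. As p - q
      lies between -2 and 2, a phase of order four detects every imbalance; a sign would miss a
      difference of 2.\<close>
    define w where "w x t = (if t = x then \<i> else 1)" for x t :: nat
    have ph: "m i j k l = w x i * cnj (w x j) * (w x k * cnj (w x l)) * m i j k l" for x
      using mono[OF permutes_id _ ij, of "w x"] by (simp add: w_def)
    show ?thesis
      using ph[of i] ph[of k] ne unfolding w_def by (auto split: if_splits)
  qed
  show ?thesis
  proof (cases "2 \<le> d")
    case False
    \<comment> \<open>With at most one index value both deltas hold at once, so \<open>x\<close> can
      take the whole entry and \<open>y\<close> be 0.\<close>
    show ?thesis
      by (rule exI[of _ "m 0 0 0 0"], rule exI[of _ 0]) (use False in \<open>auto simp: not_le less_2_iff\<close>)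
  next
    case d: True
    define x y where "x = m 0 0 1 1" and "y = m 0 1 1 0"
    have X: "m i i k k = x" if ik: "i < d" "k < d" "i \<noteq> k" for i k
    proof -
      obtain q where "q permutes {..<d}" "q i = 0" "q k = 1"
        using ex_permutes_pair[of 0 d 1 i k] d ik by auto
      then show ?thesis using perm[of q i i k k] ik unfolding x_def by simp
    qed
    have Y: "m i k k i = y" if ik: "i < d" "k < d" "i \<noteq> k" for i k
    proof -
      obtain q where "q permutes {..<d}" "q i = 0" "q k = 1"
        using ex_permutes_pair[of 0 d 1 i k] d ik by auto
      then show ?thesis using perm[of q i k k i] ik unfolding y_def by simp
    qed
    have C: "m i i i i = m 0 0 0 0" if i: "i < d" for i
    proof (cases "i = 0")
      case False
      then obtain q where "q permutes {..<d}" "q i = 0" "q 0 = 1"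
        using ex_permutes_pair[of 0 d 1 i 0] d i by auto
      then show ?thesis using perm[of q i i i i] i by simp
    qed auto
    obtain W where W: "W \<in> unitary_group d" "\<And>a. a < d \<Longrightarrow> W $$ (0, a) = (if a < 2 then complex_of_real (1 / sqrt 2) else 0)"
      using unitary_hadamard[OF d] by auto
    let ?s = "complex_of_real (1 / sqrt 2)"
    have s4: "?s * ?s * (?s * ?s) = 1 / 4"
      unfolding of_real_mult[symmetric] by simp
    have sum2: "(\<Sum>a<d. if a < 2 then g a else 0) = g 0 + (g 1 :: complex)" for g
    proof -
      have "(\<Sum>a<d. if a < 2 then g a else 0) = (\<Sum>a<2. g a)"
        using d by (intro sum.mono_neutral_cong_right) auto
      then show ?thesis by (simp add: numeral_2_eq_2)
    qed
    have z: "0 < d" "1 < d" using d by auto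
    have "m 0 0 0 0 = (\<Sum>a<d. if a < 2 then (\<Sum>b<d. if b < 2 then (\<Sum>c<d. if c < 2 then
      (\<Sum>e<d. if e < 2 then ?s * ?s * (?s * ?s) * m a b c e else 0) else 0) else 0) else 0)"
      by (rule trans[OF inv[OF W(1) z(1) z(1) z(1) z(1)]]) (auto simp: W(2) intro!: sum.neutral sum.cong)
    \<comment> \<open>Of the 16 index patterns over 0 and 1 the six balanced ones survive; each
      carries the weight (1 / sqrt 2)^4.\<close>
    also have "\<dots> = 1 / 4 * (m 0 0 0 0 + m 1 1 1 1 + m 0 0 1 1 + m 1 1 0 0 + m 0 1 1 0 + m 1 0 0 1)"
      unfolding s4 sum2 using z by (simp add: zero algebra_simps)
    also have "\<dots> = 1 / 4 * (2 * m 0 0 0 0 + 2 * x + 2 * y)"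
      using X[of 0 1] X[of 1 0] Y[of 0 1] Y[of 1 0] C[of 1] z by simp
    finally have "2 * m 0 0 0 0 = 2 * (x + y)" by (simp add: field_simps)
    then have c: "m 0 0 0 0 = x + y" by (metis mult_cancel_left zero_neq_numeral)
    show ?thesis
    proof (intro exI allI impI)
      fix i j k l assume ij: "i < d" "j < d" "k < d" "l < d"
      show "m i j k l = (if i = j \<and> k = l then x else 0) + (if i = l \<and> j = k then y else 0)"
      proof -
        consider "i = j" "k = l" "i = k" | "i = j" "k = l" "i \<noteq> k" | "i = l" "j = k" "i \<noteq> j"
          | "\<not> (i = j \<and> k = l)" "\<not> (i = l \<and> j = k)" by blast
        then show ?thesis
        proof cases
          case 1 then show ?thesis using C[OF ij(1)] c by simp
        next
          case 2 then show ?thesis using X[OF ij(1,3)] by simp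
        next
          case 3 then show ?thesis using Y[OF ij(1,2)] by simp
        next
          case 4
          show ?thesis unfolding zero[OF ij 4] if_not_P[OF 4(1)] if_not_P[OF 4(2)] by simp
        qed
      qed
    qed
  qed
qed

lemma integral_sum4:
  fixes f :: "nat \<Rightarrow> nat \<Rightarrow> nat \<Rightarrow> nat \<Rightarrow> 'a \<Rightarrow> complex"
  assumes "\<And>a b c e. a < d \<Longrightarrow> b < d \<Longrightarrow> c < d \<Longrightarrow> e < d \<Longrightarrow> integrable M (f a b c e)"
  shows "(\<integral>x. (\<Sum>a<d. \<Sum>b<d. \<Sum>c<d. \<Sum>e<d. f a b c e x) \<partial>M) =
    (\<Sum>a<d. \<Sum>b<d. \<Sum>c<d. \<Sum>e<d. \<integral>x. f a b c e x \<partial>M)"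
  using assms
  by (intro trans[OF Bochner_Integration.integral_sum] sum.cong refl Bochner_Integration.integrable_sum) auto

text \<open>Stated for arbitrary matrix-valued \<open>Z\<close> and \<open>Z'\<close>, so that left
  invariance can be used with \<open>V * B * mat_adjoint V\<close> and right invariance with
  \<open>mat_adjoint V * A * V\<close>. The entrywise moments satisfy the hypothesis of
  \<open>invariant_form\<close>.\<close>

lemma invariant_moment_form:
  fixes Z Z' :: "'a \<Rightarrow> complex mat"
  assumes fin: "finite_measure \<mu>"
    and Z: "\<And>x. x \<in> space \<mu> \<Longrightarrow> Z x \<in> carrier_mat d d" "\<And>x. x \<in> space \<mu> \<Longrightarrow> Z' x \<in> carrier_mat d d"
    and bm: "\<And>i j. i < d \<Longrightarrow> j < d \<Longrightarrow> bdd_measurable \<mu> (\<lambda>x. Z x $$ (i, j))"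
      "\<And>i j. i < d \<Longrightarrow> j < d \<Longrightarrow> bdd_measurable \<mu> (\<lambda>x. Z' x $$ (i, j))"
    and inv: "\<And>W i j k l. W \<in> unitary_group d \<Longrightarrow> i < d \<Longrightarrow> j < d \<Longrightarrow> k < d \<Longrightarrow> l < d \<Longrightarrow>
      (\<integral>x. Z x $$ (i, j) * Z' x $$ (k, l) \<partial>\<mu>) =
      (\<integral>x. (W * Z x * mat_adjoint W) $$ (i, j) * (W * Z' x * mat_adjoint W) $$ (k, l) \<partial>\<mu>)"
  shows "\<exists>x y. \<forall>A\<in>carrier_mat d d. \<forall>A'\<in>carrier_mat d d.
    (\<integral>v. mat_trace (A * Z v) * mat_trace (A' * Z' v) \<partial>\<mu>) = x * (mat_trace A * mat_trace A') + y * mat_trace (A * A')"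
proof -
  interpret finite_measure \<mu> by (rule fin)
  note int = bdd_measurable_integrable
  define m where "m i j k l = (\<integral>x. Z x $$ (i, j) * Z' x $$ (k, l) \<partial>\<mu>)" for i j k l
  have "m i j k l = (\<Sum>a<d. \<Sum>b<d. \<Sum>c<d. \<Sum>e<d.
      W $$ (i, a) * cnj (W $$ (j, b)) * (W $$ (k, c) * cnj (W $$ (l, e))) * m a b c e)"
    if W: "W \<in> unitary_group d" and ij: "i < d" "j < d" "k < d" "l < d" for W i j k l
  proof -
    note Wc = unitary_groupD(1)[OF W]
    have "m i j k l = (\<integral>x. (\<Sum>a<d. \<Sum>b<d. \<Sum>c<d. \<Sum>e<d.
      W $$ (i, a) * cnj (W $$ (j, b)) * (W $$ (k, c) * cnj (W $$ (l, e))) * (Z x $$ (a, b) * Z' x $$ (c, e))) \<partial>\<mu>)"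
      unfolding m_def inv[OF W ij]
    proof (rule Bochner_Integration.integral_cong[OF refl])
      fix x assume x: "x \<in> space \<mu>"
      show "(W * Z x * mat_adjoint W) $$ (i, j) * (W * Z' x * mat_adjoint W) $$ (k, l) =
        (\<Sum>a<d. \<Sum>b<d. \<Sum>c<d. \<Sum>e<d. W $$ (i, a) * cnj (W $$ (j, b)) * (W $$ (k, c) * cnj (W $$ (l, e))) *
          (Z x $$ (a, b) * Z' x $$ (c, e)))"
        unfolding mat_mult3_index[OF Wc Z(1)[OF x] mat_adjoint_carrier[OF Wc] ij(1,2)]
          mat_mult3_index[OF Wc Z(2)[OF x] mat_adjoint_carrier[OF Wc] ij(3,4)] sum_distrib_right
        unfolding sum_distrib_left
        by (intro sum.cong refl) (use Wc ij in simp)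
    qed
    also have "\<dots> = (\<Sum>a<d. \<Sum>b<d. \<Sum>c<d. \<Sum>e<d.
      W $$ (i, a) * cnj (W $$ (j, b)) * (W $$ (k, c) * cnj (W $$ (l, e))) * m a b c e)"
      by (subst integral_sum4) (simp_all add: m_def int bdd_measurable_mult bm)
    finally show ?thesis .
  qed
  from invariant_form[of d m, OF this] obtain x y where xy: "\<And>i j k l. i < d \<Longrightarrow> j < d \<Longrightarrow> k < d \<Longrightarrow> l < d \<Longrightarrow>
    m i j k l = (if i = j \<and> k = l then x else 0) + (if i = l \<and> j = k then y else 0)" by blast
  show ?thesis
  proof (intro exI ballI)
    fix A A' :: "complex mat" assume A: "A \<in> carrier_mat d d" "A' \<in> carrier_mat d d"
    have "(\<integral>v. mat_trace (A * Z v) * mat_trace (A' * Z' v) \<partial>\<mu>) =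
      (\<integral>v. (\<Sum>j<d. \<Sum>i<d. \<Sum>l<d. \<Sum>k<d. A $$ (j, i) * A' $$ (l, k) * (Z v $$ (i, j) * Z' v $$ (k, l))) \<partial>\<mu>)"
    proof (rule Bochner_Integration.integral_cong[OF refl])
      fix v assume v: "v \<in> space \<mu>"
      show "mat_trace (A * Z v) * mat_trace (A' * Z' v) =
        (\<Sum>j<d. \<Sum>i<d. \<Sum>l<d. \<Sum>k<d. A $$ (j, i) * A' $$ (l, k) * (Z v $$ (i, j) * Z' v $$ (k, l)))"
        unfolding mat_trace_mult[OF A(1) Z(1)[OF v]] mat_trace_mult[OF A(2) Z(2)[OF v]] sum_distrib_right
        unfolding sum_distrib_left by (intro sum.cong refl) simp
    qed
    also have "\<dots> = (\<Sum>j<d. \<Sum>i<d. \<Sum>l<d. \<Sum>k<d. A $$ (j, i) * A' $$ (l, k) * m i j k l)"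
      by (subst integral_sum4) (simp_all add: m_def int bdd_measurable_mult bm)
    also have "\<dots> = (\<Sum>j<d. \<Sum>i<d. \<Sum>l<d. \<Sum>k<d. (if i = j then (if k = l then x * (A $$ (j, i) * A' $$ (l, k)) else 0) else 0))
      + (\<Sum>j<d. \<Sum>i<d. \<Sum>l<d. \<Sum>k<d. (if i = l \<and> j = k then y * (A $$ (j, i) * A' $$ (l, k)) else 0))"
      unfolding sum.distrib[symmetric] by (intro sum.cong refl) (simp add: xy algebra_simps)
    also have "(\<Sum>j<d. \<Sum>i<d. \<Sum>l<d. \<Sum>k<d. (if i = l \<and> j = k then y * (A $$ (j, i) * A' $$ (l, k)) else 0))
      = (\<Sum>j<d. \<Sum>i<d. y * (A $$ (j, i) * A' $$ (i, j)))"
      by (intro sum.cong refl sum_delta_pair) auto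
    also have "\<dots> = y * mat_trace (A * A')"
      unfolding mat_trace_mult[OF A] by (simp add: sum_distrib_left)
    also have "(\<Sum>j<d. \<Sum>i<d. \<Sum>l<d. \<Sum>k<d. (if i = j then (if k = l then x * (A $$ (j, i) * A' $$ (l, k)) else 0) else 0))
      = (\<Sum>j<d. \<Sum>i<d. if i = j then (\<Sum>l<d. x * (A $$ (j, i) * A' $$ (l, l))) else 0)"
      by (intro sum.cong refl) simp
    also have "\<dots> = x * (mat_trace A * mat_trace A')"
    proof -
      have "mat_trace A * mat_trace A' = (\<Sum>j<d. \<Sum>l<d. A $$ (j, j) * A' $$ (l, l))"
        using A by (simp add: mat_trace_def sum_product)
      then show ?thesis by (simp add: sum_distrib_left)
    qed
    finally show "(\<integral>v. mat_trace (A * Z v) * mat_trace (A' * Z' v) \<partial>\<mu>) =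
      x * (mat_trace A * mat_trace A') + y * mat_trace (A * A')" .
  qed
qed

subsection \<open>Second moments of the Haar measure and of 2-designs\<close>

text \<open>Matrix element of the twofold twirling channel: the bilinear pairing of \<open>A\<close>
  tensor \<open>A'\<close> with the averaged conjugate of \<open>B\<close> tensor
  \<open>B'\<close>.\<close>

definition twirl :: "complex mat measure \<Rightarrow> complex mat \<Rightarrow> complex mat \<Rightarrow> complex mat \<Rightarrow> complex mat \<Rightarrow> complex" where
  "twirl \<mu> A A' B B' = (\<integral>V. mat_trace (A * (V * B * mat_adjoint V)) * mat_trace (A' * (V * B' * mat_adjoint V)) \<partial>\<mu>)"

lemma measurable_unitary_mult:
  assumes W: "W \<in> unitary_group d"
  shows "(\<lambda>V. W * V) \<in> measurable (unitary_borel d) (unitary_borel d)"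
    "(\<lambda>V. V * W) \<in> measurable (unitary_borel d) (unitary_borel d)"
proof -
  note Wc = unitary_groupD(1)[OF W]
  show "(\<lambda>V. W * V) \<in> measurable (unitary_borel d) (unitary_borel d)"
  proof (rule measurable_into_unitary_borel)
    fix i j assume ij: "i < d" "j < d"
    have "(\<lambda>V. \<Sum>k<d. W $$ (i, k) * V $$ (k, j)) \<in> borel_measurable (unitary_borel d)"
      using ij by (intro borel_measurable_sum borel_measurable_times measurable_unitary_entry borel_measurable_const) auto
    then show "(\<lambda>V. (W * V) $$ (i, j)) \<in> borel_measurable (unitary_borel d)"
      by (rule iffD1[OF measurable_cong, rotated])
        (auto intro!: mat_mult_index[symmetric] Wc ij dest: unitary_groupD(1))
  qed (use W in \<open>auto intro: unitary_group_mult\<close>)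
  show "(\<lambda>V. V * W) \<in> measurable (unitary_borel d) (unitary_borel d)"
  proof (rule measurable_into_unitary_borel)
    fix i j assume ij: "i < d" "j < d"
    have "(\<lambda>V. \<Sum>k<d. V $$ (i, k) * W $$ (k, j)) \<in> borel_measurable (unitary_borel d)"
      using ij by (intro borel_measurable_sum borel_measurable_times measurable_unitary_entry borel_measurable_const) auto
    then show "(\<lambda>V. (V * W) $$ (i, j)) \<in> borel_measurable (unitary_borel d)"
      by (rule iffD1[OF measurable_cong, rotated])
        (auto intro!: mat_mult_index[symmetric] Wc ij dest: unitary_groupD(1))
  qed (use W in \<open>auto intro: unitary_group_mult\<close>)
qed

lemma haar_invariant:
  fixes f :: "complex mat \<Rightarrow> complex"
  assumes \<mu>: "haar_unitary d \<mu>" and W: "W \<in> unitary_group d" and f: "f \<in> borel_measurable (unitary_borel d)"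
  shows "(\<integral>V. f (W * V) \<partial>\<mu>) = (\<integral>V. f V \<partial>\<mu>)" "(\<integral>V. f (V * W) \<partial>\<mu>) = (\<integral>V. f V \<partial>\<mu>)"
proof -
  have s: "sets \<mu> = sets (unitary_borel d)"
    and e: "distr \<mu> (unitary_borel d) (\<lambda>V. W * V) = \<mu>" "distr \<mu> (unitary_borel d) (\<lambda>V. V * W) = \<mu>"
    using \<mu> W by (auto simp: haar_unitary_def)
  have m: "(\<lambda>V. W * V) \<in> measurable \<mu> (unitary_borel d)" "(\<lambda>V. V * W) \<in> measurable \<mu> (unitary_borel d)"
    using measurable_unitary_mult[OF W] measurable_cong_sets[OF s refl] by auto
  show "(\<integral>V. f (W * V) \<partial>\<mu>) = (\<integral>V. f V \<partial>\<mu>)"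
    using integral_distr[OF m(1) f] unfolding e by simp
  show "(\<integral>V. f (V * W) \<partial>\<mu>) = (\<integral>V. f V \<partial>\<mu>)"
    using integral_distr[OF m(2) f] unfolding e by simp
qed

text \<open>By left invariance the average is a form in \<open>A\<close> and \<open>A'\<close> that
  is invariant under conjugation; \<open>x\<close> and \<open>y\<close> may depend on
  \<open>B\<close> and \<open>B'\<close>.\<close>

lemma haar_twirl_form:
  assumes \<mu>: "haar_unitary d \<mu>" and B: "B \<in> carrier_mat d d" "B' \<in> carrier_mat d d"
  shows "\<exists>x y. \<forall>A\<in>carrier_mat d d. \<forall>A'\<in>carrier_mat d d.
    twirl \<mu> A A' B B' = x * (mat_trace A * mat_trace A') + y * mat_trace (A * A')"
  unfolding twirl_def
proof (rule invariant_moment_form)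
  have s: "sets \<mu> = sets (unitary_borel d)" using \<mu> by (simp add: haar_unitary_def)
  have sp: "space \<mu> = unitary_group d" using sets_eq_imp_space_eq[OF s] by simp
  show "finite_measure \<mu>" using \<mu> prob_space.finite_measure by (auto simp: haar_unitary_def)
  have c: "V * B * mat_adjoint V \<in> carrier_mat d d" if "V \<in> unitary_group d" "B \<in> carrier_mat d d" for V B
    using unitary_groupD(1)[OF that(1)] that(2) mat_adjoint_carrier[OF unitary_groupD(1)[OF that(1)]]
      by (intro mult_carrier_mat)
  show "x \<in> space \<mu> \<Longrightarrow> x * B * mat_adjoint x \<in> carrier_mat d d" 
    "x \<in> space \<mu> \<Longrightarrow> x * B' * mat_adjoint x \<in> carrier_mat d d" for x
    using B c sp by auto
  show "bdd_measurable \<mu> (\<lambda>x. (x * B * mat_adjoint x) $$ (i, j))"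
    "bdd_measurable \<mu> (\<lambda>x. (x * B' * mat_adjoint x) $$ (i, j))" if "i < d" "j < d" for i j
    unfolding bdd_measurable_cong_sets[OF s] using B that by (auto intro: bdd_measurable_conj_entry)
  fix W i j k l assume W: "W \<in> unitary_group d" and ij: "i < d" "j < d" "k < d" "l < d"
  have eq: "W * V * B * mat_adjoint (W * V) = W * (V * B * mat_adjoint V) * mat_adjoint W"
    if V: "V \<in> unitary_group d" and B: "B \<in> carrier_mat d d" for V B
  proof -
    note Vc = unitary_groupD(1)[OF V] and Wc = unitary_groupD(1)[OF W]
    note cc = Vc Wc mat_adjoint_carrier[OF Vc] mat_adjoint_carrier[OF Wc] B
    have 1: "W * V * B * (mat_adjoint V * mat_adjoint W) = W * V * B * mat_adjoint V * mat_adjoint W"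
      by (rule assoc_mult_mat[symmetric, of _ d d _ d _ d]) (use cc in auto)
    have 2: "W * V * B = W * (V * B)" by (rule assoc_mult_mat[of _ d d _ d _ d]) (use cc in auto)
    have 3: "W * (V * B) * mat_adjoint V = W * (V * B * mat_adjoint V)"
      by (rule assoc_mult_mat[of _ d d _ d _ d]) (use cc in auto)
    show ?thesis unfolding mat_adjoint_mult[OF Wc Vc] 1 unfolding 2 unfolding 3 ..
  qed
  have "bdd_measurable (unitary_borel d) (\<lambda>V. (V * B * mat_adjoint V) $$ (i, j) * (V * B' * mat_adjoint V) $$ (k, l))"
    using B ij by (intro bdd_measurable_mult bdd_measurable_conj_entry)
  then have "(\<lambda>V. (V * B * mat_adjoint V) $$ (i, j) * (V * B' * mat_adjoint V) $$ (k, l)) \<in> borel_measurable (unitary_borel d)"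
    by (simp add: bdd_measurable_def)
  from haar_invariant(1)[OF \<mu> W this]
  show "(\<integral>x. (x * B * mat_adjoint x) $$ (i, j) * (x * B' * mat_adjoint x) $$ (k, l) \<partial>\<mu>) =
      (\<integral>x. (W * (x * B * mat_adjoint x) * mat_adjoint W) $$ (i, j) * (W * (x * B' * mat_adjoint x) * mat_adjoint W) $$ (k, l) \<partial>\<mu>)"
    by (subst (asm) Bochner_Integration.integral_cong[OF refl]) (auto simp: sp eq B)
qed

lemma mat_trace_conj_cyclic:
  assumes V: "V \<in> carrier_mat d d" and B: "B \<in> carrier_mat d d" and A: "A \<in> carrier_mat d d"
  shows "mat_trace (A * (V * B * mat_adjoint V)) = mat_trace (B * (mat_adjoint V * A * V))"
proof -
  note cc = V mat_adjoint_carrier[OF V] A B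
  have "A * (V * B * mat_adjoint V) = A * (V * B) * mat_adjoint V"
    by (rule assoc_mult_mat[symmetric, of _ d d _ d _ d]) (use cc in auto)
  also have "A * (V * B) = A * V * B"
    by (rule assoc_mult_mat[symmetric, of _ d d _ d _ d]) (use cc in auto)
  also have "mat_trace (A * V * B * mat_adjoint V) = mat_trace (mat_adjoint V * (A * V * B))"
    by (rule mat_trace_mult_comm[of _ d d]) (use cc in auto)
  also have "mat_adjoint V * (A * V * B) = mat_adjoint V * (A * V) * B"
    by (rule assoc_mult_mat[symmetric, of _ d d _ d _ d]) (use cc in auto)
  also have "mat_adjoint V * (A * V) = mat_adjoint V * A * V"
    by (rule assoc_mult_mat[symmetric, of _ d d _ d _ d]) (use cc in auto)
  also have "mat_trace (mat_adjoint V * A * V * B) = mat_trace (B * (mat_adjoint V * A * V))"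
    by (rule mat_trace_mult_comm[of _ d d]) (use cc in auto)
  finally show ?thesis .
qed

text \<open>The mirror statement. Cyclicity of the trace moves the conjugation onto \<open>A\<close>
  and \<open>A'\<close>; right multiplication of \<open>V\<close> by \<open>mat_adjoint W\<close>
  then conjugates \<open>mat_adjoint V * A * V\<close> by \<open>W\<close>. Together the two forms
  give orthogonality in either pair of arguments.\<close>

lemma haar_twirl_form':
  assumes \<mu>: "haar_unitary d \<mu>" and A: "A \<in> carrier_mat d d" "A' \<in> carrier_mat d d"
  shows "\<exists>x y. \<forall>B\<in>carrier_mat d d. \<forall>B'\<in>carrier_mat d d.
    twirl \<mu> A A' B B' = x * (mat_trace B * mat_trace B') + y * mat_trace (B * B')"
proof -
  have s: "sets \<mu> = sets (unitary_borel d)" using \<mu> by (simp add: haar_unitary_def)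
  have sp: "space \<mu> = unitary_group d" using sets_eq_imp_space_eq[OF s] by simp
  have tw: "twirl \<mu> A A' B B' = (\<integral>V. mat_trace (B * (mat_adjoint V * A * V)) * mat_trace (B' * (mat_adjoint V * A' * V)) \<partial>\<mu>)"
    if "B \<in> carrier_mat d d" "B' \<in> carrier_mat d d" for B B'
    unfolding twirl_def
    by (rule Bochner_Integration.integral_cong[OF refl])
      (simp add: sp mat_trace_conj_cyclic[OF unitary_groupD(1)] that A)
  have "\<exists>x y. \<forall>B\<in>carrier_mat d d. \<forall>B'\<in>carrier_mat d d.
    (\<integral>V. mat_trace (B * (mat_adjoint V * A * V)) * mat_trace (B' * (mat_adjoint V * A' * V)) \<partial>\<mu>)
      = x * (mat_trace B * mat_trace B') + y * mat_trace (B * B')"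
  proof (rule invariant_moment_form)
    show "finite_measure \<mu>" using \<mu> prob_space.finite_measure by (auto simp: haar_unitary_def)
    have c: "mat_adjoint V * B * V \<in> carrier_mat d d" if "V \<in> unitary_group d" "B \<in> carrier_mat d d" for V B
      using unitary_groupD(1)[OF that(1)] that(2) mat_adjoint_carrier[OF unitary_groupD(1)[OF that(1)]]
      by (intro mult_carrier_mat)
    show "x \<in> space \<mu> \<Longrightarrow> mat_adjoint x * A * x \<in> carrier_mat d d" 
      "x \<in> space \<mu> \<Longrightarrow> mat_adjoint x * A' * x \<in> carrier_mat d d" for x
      using A c sp by auto
    show "bdd_measurable \<mu> (\<lambda>x. (mat_adjoint x * A * x) $$ (i, j))"
      "bdd_measurable \<mu> (\<lambda>x. (mat_adjoint x * A' * x) $$ (i, j))" if "i < d" "j < d" for i j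
      unfolding bdd_measurable_cong_sets[OF s] using A that by (auto intro: bdd_measurable_adjoint_conj_entry)
    fix W i j k l assume W: "W \<in> unitary_group d" and ij: "i < d" "j < d" "k < d" "l < d"
    have eq: "mat_adjoint (V * mat_adjoint W) * A * (V * mat_adjoint W) = W * (mat_adjoint V * A * V) * mat_adjoint W"
      if V: "V \<in> unitary_group d" and A: "A \<in> carrier_mat d d" for V A
    proof -
      note Vc = unitary_groupD(1)[OF V] and Wc = unitary_groupD(1)[OF W]
      note cc = Vc Wc mat_adjoint_carrier[OF Vc] mat_adjoint_carrier[OF Wc] A
      have 1: "W * mat_adjoint V * A * (V * mat_adjoint W) = W * mat_adjoint V * A * V * mat_adjoint W"
        by (rule assoc_mult_mat[symmetric, of _ d d _ d _ d]) (use cc in auto)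
      have 2: "W * mat_adjoint V * A = W * (mat_adjoint V * A)"
        by (rule assoc_mult_mat[of _ d d _ d _ d]) (use cc in auto)
      have 3: "W * (mat_adjoint V * A) * V = W * (mat_adjoint V * A * V)"
        by (rule assoc_mult_mat[of _ d d _ d _ d]) (use cc in auto)
      show ?thesis
        unfolding mat_adjoint_mult[OF Vc mat_adjoint_carrier[OF Wc]] mat_adjoint_adjoint 1
        unfolding 2 unfolding 3 ..
    qed
    have "bdd_measurable (unitary_borel d) (\<lambda>V. (mat_adjoint V * A * V) $$ (i, j) * (mat_adjoint V * A' * V) $$ (k, l))"
      using A ij by (intro bdd_measurable_mult bdd_measurable_adjoint_conj_entry)
    then have "(\<lambda>V. (mat_adjoint V * A * V) $$ (i, j) * (mat_adjoint V * A' * V) $$ (k, l)) \<in> borel_measurable (unitary_borel d)"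
      by (simp add: bdd_measurable_def)
    from haar_invariant(2)[OF \<mu> unitary_group_adjoint[OF W] this]
    show "(\<integral>x. (mat_adjoint x * A * x) $$ (i, j) * (mat_adjoint x * A' * x) $$ (k, l) \<partial>\<mu>) =
        (\<integral>x. (W * (mat_adjoint x * A * x) * mat_adjoint W) $$ (i, j) * (W * (mat_adjoint x * A' * x) * mat_adjoint W) $$ (k, l) \<partial>\<mu>)"
      by (subst (asm) Bochner_Integration.integral_cong[OF refl]) (auto simp: sp eq A)
  qed
  then show ?thesis using tw by simp
qed

lemma mat_trace_conj:
  assumes V: "V \<in> unitary_group d" and B: "B \<in> carrier_mat d d"
  shows "mat_trace (V * B * mat_adjoint V) = mat_trace B"
proof -
  note Vc = unitary_groupD(1)[OF V]
  have "mat_trace (V * B * mat_adjoint V) = mat_trace (mat_adjoint V * (V * B))"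
    by (rule mat_trace_mult_comm[of _ d d]) (use Vc B in auto)
  also have "mat_adjoint V * (V * B) = mat_adjoint V * V * B"
    by (rule assoc_mult_mat[symmetric, of _ d d _ d _ d]) (use Vc B in auto)
  finally show ?thesis using unitary_groupD(2)[OF V] B by simp
qed

lemma mat_conj_mult:
  assumes V: "V \<in> unitary_group d" and B: "B \<in> carrier_mat d d" "C \<in> carrier_mat d d"
  shows "(V * B * mat_adjoint V) * (V * C * mat_adjoint V) = V * (B * C) * mat_adjoint V"
proof -
  note Vc = unitary_groupD(1)[OF V]
  note cc = Vc mat_adjoint_carrier[OF Vc] B
  have c: "V * B \<in> carrier_mat d d" "V * C \<in> carrier_mat d d" "C * mat_adjoint V \<in> carrier_mat d d"
    using cc by (auto intro: mult_carrier_mat)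
  have 1: "(V * B * mat_adjoint V) * (V * (C * mat_adjoint V)) = V * B * (mat_adjoint V * (V * (C * mat_adjoint V)))"
    by (rule assoc_mult_mat[of _ d d _ d _ d]) (use cc c in \<open>auto intro: mult_carrier_mat\<close>)
  have 2: "V * C * mat_adjoint V = V * (C * mat_adjoint V)"
    by (rule assoc_mult_mat[of _ d d _ d _ d]) (use cc c in auto)
  have "mat_adjoint V * (V * (C * mat_adjoint V)) = mat_adjoint V * V * (C * mat_adjoint V)"
    by (rule assoc_mult_mat[symmetric, of _ d d _ d _ d]) (use cc c in auto)
  also have "\<dots> = C * mat_adjoint V" using unitary_groupD(2)[OF V] left_mult_one_mat[OF c(3)] by simp
  finally have 3: "mat_adjoint V * (V * (C * mat_adjoint V)) = C * mat_adjoint V" .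
  have 4: "V * B * (C * mat_adjoint V) = V * B * C * mat_adjoint V"
    by (rule assoc_mult_mat[symmetric, of _ d d _ d _ d]) (use cc c in auto)
  have 5: "V * B * C = V * (B * C)"
    by (rule assoc_mult_mat[of _ d d _ d _ d]) (use cc c in auto)
  show ?thesis unfolding 2 unfolding 1 unfolding 3 4 unfolding 5 ..
qed

lemma mat_conj_carrier:
  "V \<in> unitary_group d \<Longrightarrow> B \<in> carrier_mat d d \<Longrightarrow> V * B * mat_adjoint V \<in> carrier_mat d d"
  using unitary_groupD(1)[of V d] mat_adjoint_carrier[of V d d] by (auto intro: mult_carrier_mat)

lemma normid_mult: "A \<in> carrier_mat d d \<Longrightarrow> normid d * A = complex_of_real (1 / sqrt d) \<cdot>\<^sub>m A"
  by (simp add: normid_def mult_smult_assoc_mat[OF one_carrier_mat])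

lemma mat_conj_normid:
  assumes "V \<in> unitary_group d" shows "V * normid d * mat_adjoint V = normid d"
proof -
  note V = unitary_groupD[OF assms]
  have "V * normid d = complex_of_real (1 / sqrt d) \<cdot>\<^sub>m V"
    using V by (simp add: normid_def mult_smult_distrib[OF V(1) one_carrier_mat])
  then show ?thesis
    using V by (simp add: normid_def mult_smult_assoc_mat[OF V(1) mat_adjoint_carrier[OF V(1)]])
qed

text \<open>The Markov kernel of the twirl on squared coefficients: the identity stays, every other
  element spreads evenly over the rest. The number \<open>card (block_basis d) - 1\<close>, in value
  d^2 - 1, is left as a cardinality to match \<open>card_sector_index\<close>.\<close>

definition design_coeff :: "nat \<Rightarrow> complex mat \<Rightarrow> complex mat \<Rightarrow> real" where
  "design_coeff d A B = (if A = normid d \<and> B = normid d then 1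
     else if A = normid d \<or> B = normid d then 0 else 1 / (real (card (block_basis d)) - 1))"

text \<open>Two distinct basis elements are orthogonal and one of them is traceless, so both terms
  of the invariant form vanish. On the diagonal, for \<open>B\<close> other than the identity,
  Parseval gives total weight 1; the identity takes none of it and the remaining elements share it
  equally.\<close>

lemma haar_twirl_onb:
  assumes \<mu>: "haar_unitary d \<mu>" and d: "qubit_block d"
    and mem: "A \<in> block_basis d" "A' \<in> block_basis d" "B \<in> block_basis d" "B' \<in> block_basis d"
  shows "twirl \<mu> A A' B B' = (if A = A' \<and> B = B' then complex_of_real (design_coeff d A B) else 0)"
proof -
  note S = block_basis(1)[OF d] and N = block_basis(2)[OF d]
  note Sc = hs_onbD(2)[OF S]
  have dpos: "d > 0" using d by (auto simp: qubit_block_def)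
  interpret prob_space \<mu> using \<mu> by (simp add: haar_unitary_def)
  have s: "sets \<mu> = sets (unitary_borel d)" using \<mu> by (simp add: haar_unitary_def)
  have sp: "space \<mu> = unitary_group d" using sets_eq_imp_space_eq[OF s] by simp
  have trS: "mat_trace A = 0" if "A \<in> block_basis d" "A \<noteq> normid d" for A
    using hs_onbD(4)[OF S N that(1)] that normid_mult[OF Sc[OF that(1)]] Sc[OF that(1)] dpos by auto
  have trN: "mat_trace (normid d) = complex_of_real (sqrt d)"
    unfolding normid_def mat_trace_smult[OF one_carrier_mat] mat_trace_one
    by (metis of_real_mult of_real_of_nat_eq mult.commute times_divide_eq_right mult_1_right real_div_sqrt of_nat_0_le_iff)
  show ?thesis
  proof (cases "A = A' \<and> B = B'")
    case False
    then consider "A \<noteq> A'" | "B \<noteq> B'" by blast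
    then have "twirl \<mu> A A' B B' = 0"
    proof cases
      case 1
      obtain x y where "twirl \<mu> A A' B B' = x * (mat_trace A * mat_trace A') + y * mat_trace (A * A')"
        using haar_twirl_form[OF \<mu> Sc Sc] mem Sc by blast
      moreover have "mat_trace A = 0 \<or> mat_trace A' = 0" using 1 trS mem by metis
      ultimately show ?thesis using 1 hs_onbD(4)[OF S mem(1,2)] by auto
    next
      case 2
      obtain x y where "twirl \<mu> A A' B B' = x * (mat_trace B * mat_trace B') + y * mat_trace (B * B')"
        using haar_twirl_form'[OF \<mu> Sc Sc] mem Sc by blast
      moreover have "mat_trace B = 0 \<or> mat_trace B' = 0" using 2 trS mem by metis
      ultimately show ?thesis using 2 hs_onbD(4)[OF S mem(3,4)] by auto
    qed
    then show ?thesis using False by auto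
  next
    case True
    have A_norm: "twirl \<mu> (normid d) (normid d) B B = complex_of_real (design_coeff d (normid d) B)" if B: "B \<in> block_basis d" for B
    proof -
      have "mat_trace (normid d * (V * B * mat_adjoint V)) = complex_of_real (1 / sqrt d) * mat_trace B"
        if "V \<in> unitary_group d" for V
        unfolding normid_mult[OF mat_conj_carrier[OF that Sc[OF B]]] mat_trace_smult[OF mat_conj_carrier[OF that Sc[OF B]]]
          mat_trace_conj[OF that Sc[OF B]] ..
      then have "twirl \<mu> (normid d) (normid d) B B = (\<integral>V. (complex_of_real (1 / sqrt d) * mat_trace B)^2 \<partial>\<mu>)"
        unfolding twirl_def
        by (intro Bochner_Integration.integral_cong refl)
          (simp add: sp power2_eq_square)
      also have "\<dots> = complex_of_real (design_coeff d (normid d) B)"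
        using trS[OF B] trN dpos unfolding design_coeff_def by (auto simp: prob_space)
      finally show ?thesis .
    qed
    have B_norm: "twirl \<mu> A A (normid d) (normid d) = complex_of_real (design_coeff d A (normid d))" if A: "A \<in> block_basis d" for A
    proof -
      have "twirl \<mu> A A (normid d) (normid d) = (\<integral>V. (if A = normid d then 1 else 0)^2 \<partial>\<mu>)"
        unfolding twirl_def
        by (rule Bochner_Integration.integral_cong[OF refl])
          (use hs_onbD(4)[OF S A N] in \<open>auto simp: sp mat_conj_normid\<close>)
      then show ?thesis unfolding design_coeff_def by (auto simp: prob_space)
    qed
    show ?thesis
    proof (cases "A = normid d \<or> B = normid d")
      case False
      obtain x y where xy: "\<And>C. C \<in> carrier_mat d d \<Longrightarrow> twirl \<mu> C C B B = x * (mat_trace C * mat_trace C) + y * mat_trace (C * C)"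
        using haar_twirl_form[OF \<mu> Sc[OF mem(3)] Sc[OF mem(3)]] by blast
      have y: "twirl \<mu> C C B B = y" if "C \<in> block_basis d - {normid d}" for C
        using xy[OF Sc] that trS hs_onbD(4)[OF S] by auto
      have "(\<Sum>C\<in>block_basis d. twirl \<mu> C C B B) = (\<integral>V. (\<Sum>C\<in>block_basis d. mat_trace (C * (V * B * mat_adjoint V)) * mat_trace (C * (V * B * mat_adjoint V))) \<partial>\<mu>)"
        unfolding twirl_def
      proof (rule Bochner_Integration.integral_sum[symmetric])
        fix C assume C: "C \<in> block_basis d"
        have "bdd_measurable \<mu> (\<lambda>V. mat_trace (C * (V * B * mat_adjoint V)))"
          by (rule bdd_measurable_trace[where d=d])
            (use Sc C mem mat_conj_carrier in \<open>auto simp: sp bdd_measurable_cong_sets[OF s] intro: bdd_measurable_conj_entry\<close>)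
        then show "integrable \<mu> (\<lambda>V. mat_trace (C * (V * B * mat_adjoint V)) * mat_trace (C * (V * B * mat_adjoint V)))"
          by (intro bdd_measurable_integrable bdd_measurable_mult)
      qed
      \<comment> \<open>By Parseval the integrand is the trace of the square of the conjugated
        \<open>B\<close>, which is 1 for every unitary.\<close>
      also have "\<dots> = (\<integral>V. 1 \<partial>\<mu>)"
      proof (rule Bochner_Integration.integral_cong[OF refl])
        fix V assume "V \<in> space \<mu>"
        then have V: "V \<in> unitary_group d" using sp by simp
        note Bc = Sc[OF mem(3)]
        note c = mat_conj_carrier[OF V Bc]
        show "(\<Sum>C\<in>block_basis d. mat_trace (C * (V * B * mat_adjoint V)) * mat_trace (C * (V * B * mat_adjoint V))) = 1"
          unfolding hs_onb_trace_expand[OF S c c, symmetric] mat_conj_mult[OF V Bc Bc]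
          using mat_trace_conj[OF V mult_carrier_mat[OF Bc Bc]] hs_onbD(4)[OF S mem(3) mem(3)] by simp
      qed
      finally have "(\<Sum>C\<in>block_basis d. twirl \<mu> C C B B) = 1" by (simp add: prob_space)
      moreover have "(\<Sum>C\<in>block_basis d. twirl \<mu> C C B B) = twirl \<mu> (normid d) (normid d) B B + (\<Sum>C\<in>block_basis d - {normid d}. y)"
        unfolding sum.remove[OF hs_onbD(1)[OF S] N] using y by simp
      moreover have "twirl \<mu> (normid d) (normid d) B B = 0"
        using A_norm[OF mem(3)] False by (simp add: design_coeff_def)
      ultimately have "of_nat (card (block_basis d) - 1) * y = 1"
        using hs_onbD(1)[OF S] N by simp
      moreover have "card (block_basis d) \<ge> 1"
        using hs_onbD(1)[OF S] N by (metis One_nat_def Suc_leI card_gt_0_iff empty_iff)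
      ultimately have "(complex_of_real (real (card (block_basis d)) - 1)) * y = 1"
        by (simp add: of_nat_diff)
      then have "y = 1 / complex_of_real (real (card (block_basis d)) - 1)"
        by (metis nonzero_mult_div_cancel_left mult_zero_left zero_neq_one)
      then show ?thesis using True False y[of A] mem by (simp add: design_coeff_def)
    qed (use True A_norm B_norm mem in auto)
  qed
qed

section \<open>From the Haar measure to 2-designs\<close>

lemma tensor4_index:
  assumes V: "A \<in> carrier_mat d d" "B \<in> carrier_mat d d" "C \<in> carrier_mat d d" "E \<in> carrier_mat d d"
    and i: "i1 < d" "i2 < d" "i3 < d" "i4 < d" and j: "j1 < d" "j2 < d" "j3 < d" "j4 < d"
  shows "tensor_mats [A, B, C, E] $$ (((i1 * d + i2) * d + i3) * d + i4, ((j1 * d + j2) * d + j3) * d + j4)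
    = A $$ (i1, j1) * (B $$ (i2, j2) * (C $$ (i3, j3) * E $$ (i4, j4)))"
    and "((i1 * d + i2) * d + i3) * d + i4 < d ^ 4"
proof -
  have lt: "x * b + y < a * b" if "x < a" "y < b" for a b x y :: nat
  proof -
    have "x * b + y < Suc x * b" using that by simp
    also have "\<dots> \<le> a * b" using that by (intro mult_right_mono) auto
    finally show ?thesis .
  qed
  have K: "kronecker X Y $$ (x * b + y, x' * b + y') = X $$ (x, x') * Y $$ (y, y')"
    if "X \<in> carrier_mat a a" "Y \<in> carrier_mat b b" "x < a" "x' < a" "y < b" "y' < b" for X Y a b x x' y y'
    using that lt[of x a y b] lt[of x' a y' b] by (subst kronecker_index[OF that(1,2)]) auto
  \<comment> \<open>\<open>tensor_mats\<close> nests to the right, while the index is written with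
    base-\<open>d\<close> digits from the left.\<close>
  have e: "((i1 * d + i2) * d + i3) * d + i4 = i1 * (d * (d * d)) + (i2 * (d * d) + (i3 * d + i4))" for i1 i2 i3 i4 :: nat
    by (simp add: algebra_simps)
  \<comment> \<open>The empty product at the end of \<open>tensor_mats\<close> leaves a trivial
    one-dimensional factor.\<close>
  have one: "kronecker E (1\<^sub>m 1) = E"
  proof (rule eq_matI)
    fix i j assume "i < dim_row E" "j < dim_col E"
    then show "kronecker E (1\<^sub>m 1) $$ (i, j) = E $$ (i, j)"
      using V(4) by (subst kronecker_index[OF V(4) one_carrier_mat]) auto
  qed (auto simp: kronecker_def)
  have c: "kronecker C E \<in> carrier_mat (d * d) (d * d)" "kronecker B (kronecker C E) \<in> carrier_mat (d * (d * d)) (d * (d * d))"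
    using V by simp_all
  note l2 = lt[OF i(3,4)] lt[OF j(3,4)]
  note l3 = lt[OF i(2) l2(1)] lt[OF j(2) l2(2)]
  show "tensor_mats [A, B, C, E] $$ (((i1 * d + i2) * d + i3) * d + i4, ((j1 * d + j2) * d + j3) * d + j4)
    = A $$ (i1, j1) * (B $$ (i2, j2) * (C $$ (i3, j3) * E $$ (i4, j4)))"
    unfolding e tensor_mats_Cons tensor_mats_Nil one
    unfolding K[OF V(1) c(2) i(1) j(1) l3] K[OF V(2) c(1) i(2) j(2) l2] K[OF V(3,4) i(3) j(3) i(4) j(4)] ..
  show "((i1 * d + i2) * d + i3) * d + i4 < d ^ 4"
    unfolding e using lt[OF i(1) l3(1)] by (simp add: eval_nat_numeral mult.assoc)
qed

text \<open>Reads the matrix equation in \<open>unitary_2_design\<close> entry by entry, as equality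
  of the moments of degree two in \<open>V\<close> and two in its conjugate.\<close>

lemma design_moment_eq:
  assumes eq: "second_moment d \<nu> = second_moment d \<mu>"
    and s: "space \<nu> = unitary_group d" "space \<mu> = unitary_group d"
    and i: "i1 < d" "i2 < d" "i3 < d" "i4 < d" and j: "j1 < d" "j2 < d" "j3 < d" "j4 < d"
  shows "(\<integral>V. V $$ (i1, j1) * (V $$ (i2, j2) * (cnj (V $$ (i3, j3)) * cnj (V $$ (i4, j4)))) \<partial>\<nu>) =
    (\<integral>V. V $$ (i1, j1) * (V $$ (i2, j2) * (cnj (V $$ (i3, j3)) * cnj (V $$ (i4, j4)))) \<partial>\<mu>)"
proof -
  let ?i = "((i1 * d + i2) * d + i3) * d + i4" and ?j = "((j1 * d + j2) * d + j3) * d + j4"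
  have ij: "?i < d ^ 4" "?j < d ^ 4"
    using tensor4_index(2)[OF one_carrier_mat one_carrier_mat one_carrier_mat one_carrier_mat i j]
      tensor4_index(2)[OF one_carrier_mat one_carrier_mat one_carrier_mat one_carrier_mat j i] by this+
  have "second_moment d N $$ (?i, ?j) = (\<integral>V. V $$ (i1, j1) * (V $$ (i2, j2) * (cnj (V $$ (i3, j3)) * cnj (V $$ (i4, j4)))) \<partial>N)"
    if "space N = unitary_group d" for N
  proof -
    have "second_moment d N $$ (?i, ?j) = (\<integral>V. tensor_mats [V, V, map_mat cnj V, map_mat cnj V] $$ (?i, ?j) \<partial>N)"
      using ij by (simp add: second_moment_def)
    also have "\<dots> = (\<integral>V. V $$ (i1, j1) * (V $$ (i2, j2) * (cnj (V $$ (i3, j3)) * cnj (V $$ (i4, j4)))) \<partial>N)"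
    proof (rule Bochner_Integration.integral_cong[OF refl])
      fix V assume "V \<in> space N"
      then have V: "V \<in> carrier_mat d d" using that unitary_groupD(1) by auto
      then have V': "map_mat cnj V \<in> carrier_mat d d" by simp
      show "tensor_mats [V, V, map_mat cnj V, map_mat cnj V] $$ (?i, ?j) =
        V $$ (i1, j1) * (V $$ (i2, j2) * (cnj (V $$ (i3, j3)) * cnj (V $$ (i4, j4))))"
        unfolding tensor4_index(1)[OF V V V' V' i j] using V i j by simp
    qed
    finally show ?thesis .
  qed
  from this[OF s(1)] this[OF s(2)] show ?thesis using eq by simp
qed

text \<open>Each trace in \<open>twirl\<close> has degree one in \<open>V\<close> and one in its
  conjugate, so the integrand is a linear combination of the moments fixed by
  \<open>second_moment\<close>.\<close>

lemma design_twirl_eq: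
  assumes eq: "second_moment d \<nu> = second_moment d \<mu>"
    and P: "prob_space \<nu>" "prob_space \<mu>"
    and s: "sets \<nu> = sets (unitary_borel d)" "sets \<mu> = sets (unitary_borel d)"
    and A: "A \<in> carrier_mat d d" "A' \<in> carrier_mat d d" and B: "B \<in> carrier_mat d d" "B' \<in> carrier_mat d d"
  shows "twirl \<nu> A A' B B' = twirl \<mu> A A' B B'"
proof -
  let ?c = "\<lambda>A B (i, j, k, l). A $$ (i, j) * B $$ (k, l)"
  let ?I = "{..<d} \<times> {..<d} \<times> {..<d} \<times> {..<d}"
  let ?f = "\<lambda>(i, j, k, l) (i', j', k', l') V. V $$ (j, k) * (V $$ (j', k') * (cnj (V $$ (i, l)) * cnj (V $$ (i', l'))))"
  have sp: "space \<nu> = unitary_group d" "space \<mu> = unitary_group d"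
    using sets_eq_imp_space_eq[OF s(1)] sets_eq_imp_space_eq[OF s(2)] by auto
  have tr: "mat_trace (A * (V * B * mat_adjoint V)) = (\<Sum>(i, j, k, l)\<in>?I. A $$ (i, j) * B $$ (k, l) * (V $$ (j, k) * cnj (V $$ (i, l))))"
    if V: "V \<in> unitary_group d" and A: "A \<in> carrier_mat d d" and B: "B \<in> carrier_mat d d" for V A B
  proof -
    note Vc = unitary_groupD(1)[OF V]
    have "mat_trace (A * (V * B * mat_adjoint V)) =
        (\<Sum>i<d. \<Sum>j<d. \<Sum>k<d. \<Sum>l<d. A $$ (i, j) * B $$ (k, l) * (V $$ (j, k) * cnj (V $$ (i, l))))"
      unfolding mat_trace_mult[OF A mat_conj_carrier[OF V B]]
    proof (intro sum.cong refl)
      fix i j assume ij: "i \<in> {..<d}" "j \<in> {..<d}"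
      then have ij': "j < d" "i < d" by auto
      show "A $$ (i, j) * (V * B * mat_adjoint V) $$ (j, i) =
        (\<Sum>k<d. \<Sum>l<d. A $$ (i, j) * B $$ (k, l) * (V $$ (j, k) * cnj (V $$ (i, l))))"
        unfolding mat_mult3_index[OF Vc B mat_adjoint_carrier[OF Vc] ij'] sum_distrib_left
        by (intro sum.cong refl) (use Vc ij in auto)
    qed
    then show ?thesis by (simp add: sum.cartesian_product)
  qed
  have tw: "twirl N A A' B B' = (\<Sum>p\<in>?I. \<Sum>q\<in>?I. ?c A B p * ?c A' B' q * (\<integral>V. ?f p q V \<partial>N))"
    if P: "prob_space N" and s: "sets N = sets (unitary_borel d)" for N
  proof -
    interpret prob_space N by (rule P)
    have sp: "space N = unitary_group d" using sets_eq_imp_space_eq[OF s] by simp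
    have int: "integrable N (\<lambda>V. ?c A B p * ?c A' B' q * ?f p q V)" if "p \<in> ?I" "q \<in> ?I" for p q
    proof (rule bdd_measurable_integrable)
      obtain i j k l where p: "p = (i, j, k, l)" by (cases p)
      obtain i' j' k' l' where q: "q = (i', j', k', l')" by (cases q)
      show "bdd_measurable N (\<lambda>V. ?c A B p * ?c A' B' q * ?f p q V)"
        using that unfolding bdd_measurable_cong_sets[OF s] p q prod.case
        by (intro bdd_measurable_mult bdd_measurable_const bdd_measurable_cnj bdd_measurable_unitary_entry) auto
    qed
    have "twirl N A A' B B' = (\<integral>V. (\<Sum>p\<in>?I. \<Sum>q\<in>?I. ?c A B p * ?c A' B' q * ?f p q V) \<partial>N)"
      unfolding twirl_def
    proof (rule Bochner_Integration.integral_cong[OF refl])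
      fix V assume "V \<in> space N"
      then have V: "V \<in> unitary_group d" using sp by simp
      show "mat_trace (A * (V * B * mat_adjoint V)) * mat_trace (A' * (V * B' * mat_adjoint V)) =
        (\<Sum>p\<in>?I. \<Sum>q\<in>?I. ?c A B p * ?c A' B' q * ?f p q V)"
        unfolding tr[OF V assms(6) assms(8)] tr[OF V assms(7) assms(9)] sum_product
        by (intro sum.cong refl) (auto simp: case_prod_unfold)
    qed
    also have "\<dots> = (\<Sum>p\<in>?I. \<Sum>q\<in>?I. \<integral>V. ?c A B p * ?c A' B' q * ?f p q V \<partial>N)"
      by (intro trans[OF Bochner_Integration.integral_sum] sum.cong refl Bochner_Integration.integrable_sum int)
    also have "\<dots> = (\<Sum>p\<in>?I. \<Sum>q\<in>?I. ?c A B p * ?c A' B' q * (\<integral>V. ?f p q V \<partial>N))"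
      by (simp add: case_prod_unfold)
    finally show ?thesis .
  qed
  show ?thesis
    unfolding tw[OF P(1) s(1)] tw[OF P(2) s(2)]
  proof (intro sum.cong refl arg_cong2[of _ _ _ _ "(*)"])
    fix p q assume pq: "p \<in> ?I" "q \<in> ?I"
    obtain i j k l where p: "p = (i, j, k, l)" by (cases p)
    obtain i' j' k' l' where q: "q = (i', j', k', l')" by (cases q)
    show "(\<integral>V. ?f p q V \<partial>\<nu>) = (\<integral>V. ?f p q V \<partial>\<mu>)"
      unfolding p q prod.case by (rule design_moment_eq[OF eq sp]) (use pq p q in auto)
  qed
qed

theorem design_twirl_onb:
  assumes \<nu>: "unitary_2_design d \<nu>" and d: "qubit_block d"
    and mem: "A \<in> block_basis d" "A' \<in> block_basis d" "B \<in> block_basis d" "B' \<in> block_basis d"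
  shows "twirl \<nu> A A' B B' = (if A = A' \<and> B = B' then complex_of_real (design_coeff d A B) else 0)"
proof -
  obtain \<mu> where \<mu>: "haar_unitary d \<mu>" "second_moment d \<nu> = second_moment d \<mu>"
    using \<nu> by (auto simp: unitary_2_design_def)
  have "twirl \<nu> A A' B B' = twirl \<mu> A A' B B'"
    by (rule design_twirl_eq[OF \<mu>(2)])
      (use \<nu> \<mu>(1) hs_onbD(2)[OF block_basis(1)[OF d]] mem in \<open>auto simp: unitary_2_design_def haar_unitary_def\<close>)
  then show ?thesis using haar_twirl_onb[OF \<mu>(1) d mem] by simp
qed

subsection \<open>Hermitian matrices are unitarily diagonalisable\<close>

definition diagm :: "nat \<Rightarrow> (nat \<Rightarrow> complex) \<Rightarrow> complex mat" where
  "diagm n f = mat n n (\<lambda>(i, j). if i = j then f i else 0)"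

lemma diagm_carrier [simp]: "diagm n f \<in> carrier_mat n n"
  by (simp add: diagm_def)

lemma mat_conj_diagm_index:
  assumes V: "V \<in> carrier_mat n n" and ij: "i < n" "j < n"
  shows "(V * diagm n f * mat_adjoint V) $$ (i, j) = (\<Sum>a<n. V $$ (i, a) * f a * cnj (V $$ (j, a)))"
proof -
  have "(V * diagm n f * mat_adjoint V) $$ (i, j) = (\<Sum>a<n. \<Sum>b<n. if a = b then V $$ (i, a) * f a * cnj (V $$ (j, a)) else 0)"
    unfolding mat_mult3_index[OF V diagm_carrier mat_adjoint_carrier[OF V] ij]
    by (intro sum.cong refl) (use V ij in \<open>auto simp: diagm_def\<close>)
  then show ?thesis by (simp add: sum.delta')
qed

text \<open>A Householder reflection; the phase \<open>c\<close> makes the reflecting vector nonzero.\<close>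

lemma ex_unitary_first_column:
  fixes v :: "nat \<Rightarrow> complex"
  assumes v: "(\<Sum>i<n. (norm (v i))\<^sup>2) = 1" and n: "0 < n"
  shows "\<exists>W\<in>unitary_group n. \<exists>c. \<forall>i<n. W $$ (i, 0) = c * v i"
proof -
  define c where "c = (if v 0 = 0 then 1 else - cnj (v 0) / complex_of_real (norm (v 0)))"
  define w where "w i = c * v i" for i
  have cn: "norm c = 1" by (auto simp: c_def norm_divide)
  define r where "r = norm (v 0)"
  have w0: "w 0 = - complex_of_real r"
    by (auto simp: w_def c_def r_def complex_norm_square power2_eq_square divide_simps mult.commute)
      (metis complex_norm_square mult.commute of_real_mult power2_eq_square)
  have r: "r \<ge> 0" by (simp add: r_def)
  define u where "u i = w i - (if i = 0 then 1 else 0)" for i :: nat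
  have wn: "(\<Sum>i<n. w i * cnj (w i)) = 1"
  proof -
    have "(\<Sum>i<n. w i * cnj (w i)) = complex_of_real (\<Sum>i<n. (norm (v i))\<^sup>2)"
      unfolding of_real_sum
      by (intro sum.cong refl, subst complex_norm_square[symmetric]) (simp add: w_def norm_mult cn)
    then show ?thesis using v by simp
  qed
  \<comment> \<open>The squared norm of \<open>u\<close>: both \<open>w\<close> and the first unit
    vector are normalised and \<open>w 0 = - r\<close>, which gives 2 + 2 r, hence a positive
    number.\<close>
  define s where "s = 2 + 2 * r"
  have spos: "s > 0" using r by (simp add: s_def)
  have d0: "(\<Sum>i<n. if i = 0 then f i else 0) = (f 0 :: complex)" for f using n by simp
  have us: "(\<Sum>i<n. u i * cnj (u i)) = complex_of_real s"
  proof -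
    have "(\<Sum>i<n. u i * cnj (u i)) = (\<Sum>i<n. w i * cnj (w i)) + (\<Sum>i<n. if i = 0 then 1 - w i - cnj (w i) else 0)"
      unfolding sum.distrib[symmetric] by (intro sum.cong refl) (auto simp: u_def algebra_simps)
    then show ?thesis unfolding d0 wn w0 by (simp add: s_def)
  qed
  define W where "W = mat n n (\<lambda>(i, j). (if i = j then 1 else 0) - 2 / complex_of_real s * u i * cnj (u j))"
  have Wc: "W \<in> carrier_mat n n" by (simp add: W_def)
  have "W * mat_adjoint W = 1\<^sub>m n"
  proof (rule eq_matI)
    fix i j assume "i < dim_row (1\<^sub>m n :: complex mat)" "j < dim_col (1\<^sub>m n :: complex mat)"
    then have ij: "i < n" "j < n" by auto
    let ?t = "2 / complex_of_real s"
    have "(W * mat_adjoint W) $$ (i, j) = (\<Sum>k<n. ((if i = k then 1 else 0) - ?t * u i * cnj (u k)) *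
        ((if j = k then 1 else 0) - ?t * cnj (u j) * u k))"
      unfolding mat_mult_index[OF Wc mat_adjoint_carrier[OF Wc] ij]
      using ij by (intro sum.cong refl) (auto simp: W_def)
    also have "\<dots> = (\<Sum>k<n. (if i = k then (if j = k then 1 else 0) - ?t * cnj (u j) * u k else 0)
        + (if j = k then - (?t * u i * cnj (u k)) else 0) + ?t * ?t * u i * cnj (u j) * (u k * cnj (u k)))"
      by (intro sum.cong refl) (auto simp: algebra_simps)
    also have "\<dots> = (if i = j then 1 else 0) - ?t * cnj (u j) * u i - ?t * u i * cnj (u j)
        + ?t * ?t * u i * cnj (u j) * complex_of_real s"
      unfolding sum.distrib sum_distrib_left[symmetric] us using ij by (auto simp: sum.delta')
    also have "\<dots> = (if i = j then 1 else 0)"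
      using spos by (simp add: field_simps)
    finally show "(W * mat_adjoint W) $$ (i, j) = (1\<^sub>m n :: complex mat) $$ (i, j)" using ij by simp
  qed (use Wc in auto)
  then have WU: "W \<in> unitary_group n" by (rule unitary_groupI[OF Wc])
  have "W $$ (i, 0) = c * v i" if "i < n" for i
  proof -
    \<comment> \<open>Since \<open>cnj (u 0)\<close> is -(1 + r) = - s / 2, column 0 of the
      reflection is the first unit vector plus \<open>u\<close>, that is \<open>w\<close>.\<close>
    have "complex_of_real s = - 2 * cnj (u 0)" by (simp add: u_def w0 s_def)
    moreover have "complex_of_real s \<noteq> 0" using spos by simp
    ultimately have "2 / complex_of_real s * u i * cnj (u 0) = - u i"
      by (simp add: field_simps)
    then show ?thesis using that n by (simp add: W_def u_def w_def)
  qed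
  then show ?thesis using WU by blast
qed

lemma ex_unit_eigenvector:
  fixes A :: "complex mat"
  assumes A: "A \<in> carrier_mat n n" and n: "0 < n"
  shows "\<exists>v e. (\<Sum>i<n. (norm (v i :: complex))\<^sup>2) = 1 \<and> (\<forall>i<n. (\<Sum>k<n. A $$ (i, k) * v k) = e * v i)"
proof -
  obtain e where "eigenvalue A e" using spectrum_non_empty[OF A n] by (auto simp: spectrum_def)
  then obtain x where x: "x \<in> carrier_vec n" "x \<noteq> 0\<^sub>v n" "A *\<^sub>v x = e \<cdot>\<^sub>v x"
    using A by (auto simp: eigenvalue_def eigenvector_def)
  define N where "N = (\<Sum>i<n. (norm (x $ i))\<^sup>2)"
  have "N \<noteq> 0"
  proof
    assume "N = 0"
    then have "\<forall>i<n. x $ i = 0" unfolding N_def by (subst (asm) sum_nonneg_eq_0_iff) auto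
    then have "x = 0\<^sub>v n" using x(1) by (intro eq_vecI) auto
    then show False using x(2) by simp
  qed
  moreover have "N \<ge> 0" unfolding N_def by (intro sum_nonneg) auto
  ultimately have N: "N > 0" by simp
  have eig: "(\<Sum>k<n. A $$ (i, k) * x $ k) = e * x $ i" if "i < n" for i
  proof -
    have "(A *\<^sub>v x) $ i = (\<Sum>k<n. A $$ (i, k) * x $ k)"
      using A x(1) that by (auto simp: scalar_prod_def lessThan_atLeast0 intro!: sum.cong)
    then show ?thesis unfolding x(3) using x(1) that by simp
  qed
  show ?thesis
  proof (intro exI conjI allI impI)
    show "(\<Sum>i<n. (norm (x $ i / complex_of_real (sqrt N)))\<^sup>2) = 1"
      using N by (simp add: norm_divide power_divide sum_divide_distrib[symmetric] N_def[symmetric])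
    fix i assume "i < n"
    then show "(\<Sum>k<n. A $$ (i, k) * (x $ k / complex_of_real (sqrt N))) = e * (x $ i / complex_of_real (sqrt N))"
      using eig[of i] by (simp add: sum_divide_distrib[symmetric])
  qed
qed

lemma mat_conj_conj:
  assumes V: "V \<in> unitary_group d" and W: "W \<in> unitary_group d" and B: "B \<in> carrier_mat d d"
  shows "V * (W * B * mat_adjoint W) * mat_adjoint V = (V * W) * B * mat_adjoint (V * W)"
proof -
  note Vc = unitary_groupD(1)[OF V] and Wc = unitary_groupD(1)[OF W]
  note cc = Vc Wc mat_adjoint_carrier[OF Vc] mat_adjoint_carrier[OF Wc] B
  have 1: "V * W * B * (mat_adjoint W * mat_adjoint V) = V * W * B * mat_adjoint W * mat_adjoint V"
    by (rule assoc_mult_mat[symmetric, of _ d d _ d _ d]) (use cc in auto)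
  have 2: "V * W * B = V * (W * B)"
    by (rule assoc_mult_mat[of _ d d _ d _ d]) (use cc in auto)
  have 3: "V * (W * B) * mat_adjoint W = V * (W * B * mat_adjoint W)"
    by (rule assoc_mult_mat[of _ d d _ d _ d]) (use cc in auto)
  show ?thesis unfolding mat_adjoint_mult[OF Vc Wc] 1 unfolding 2 unfolding 3 ..
qed

lemma mat_conj_cancel:
  assumes V: "V \<in> unitary_group d" and B: "B \<in> carrier_mat d d"
  shows "V * (mat_adjoint V * B * V) * mat_adjoint V = B" "mat_adjoint V * (V * B * mat_adjoint V) * V = B"
  using mat_conj_conj[OF V unitary_group_adjoint[OF V] B] mat_conj_conj[OF unitary_group_adjoint[OF V] V B]
    unitary_groupD[OF V] B by auto

lemma hermitian_conj:
  assumes V: "V \<in> carrier_mat d d" and B: "B \<in> carrier_mat d d" "hermitian_mat B"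
  shows "hermitian_mat (V * B * mat_adjoint V)"
proof -
  have "mat_adjoint (V * B * mat_adjoint V) = mat_adjoint (mat_adjoint V) * mat_adjoint (V * B)"
    by (rule mat_adjoint_mult[of _ d d _ d]) (use V B in auto)
  also have "\<dots> = V * (mat_adjoint B * mat_adjoint V)"
    using mat_adjoint_mult[OF V B(1)] by simp
  also have "\<dots> = V * B * mat_adjoint V"
    using V B by (simp add: hermitian_mat_def assoc_mult_mat[of _ d d _ d _ d])
  finally show ?thesis by (simp add: hermitian_mat_def)
qed

text \<open>Deflation. A unit eigenvector becomes, up to a scalar, the first column of
  \<open>W\<close>, so the first column of the conjugated matrix is \<open>e\<close> times the first
  unit vector. Hermiticity clears the first row and makes \<open>e\<close> real, and the induction
  hypothesis treats the lower right block.\<close>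

theorem hermitian_diagonalisation:
  assumes "A \<in> carrier_mat n n" "hermitian_mat A"
  shows "\<exists>W\<in>unitary_group n. \<exists>l. A = W * diagm n (\<lambda>i. complex_of_real (l i)) * mat_adjoint W"
  using assms
proof (induction n arbitrary: A)
  case 0
  have "(1\<^sub>m 0 :: complex mat) \<in> unitary_group 0" by (intro unitary_groupI) auto
  moreover have "A = 1\<^sub>m 0 * diagm 0 (\<lambda>i. complex_of_real 0) * mat_adjoint (1\<^sub>m 0)"
    using 0 by (intro eq_matI) (auto simp: diagm_def)
  ultimately show ?case by (intro bexI exI)
next
  case (Suc k)
  let ?n = "Suc k"
  note A = Suc.prems(1)
  obtain v e where v: "(\<Sum>i<?n. (norm (v i :: complex))\<^sup>2) = 1"
    and eig: "\<And>i. i < ?n \<Longrightarrow> (\<Sum>k<?n. A $$ (i, k) * v k) = e * v i"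
    using ex_unit_eigenvector[OF A] by auto
  obtain W c where W: "W \<in> unitary_group ?n" and col: "\<And>i. i < ?n \<Longrightarrow> W $$ (i, 0) = c * v i"
    using ex_unitary_first_column[OF v] by auto
  note Wc = unitary_groupD(1)[OF W] and W' = unitary_group_adjoint[OF W]
  define A' where "A' = mat_adjoint W * A * W"
  have A'c: "A' \<in> carrier_mat ?n ?n" using mat_conj_carrier[OF W' A] by (simp add: A'_def)
  have A'h: "hermitian_mat A'"
    using hermitian_conj[OF unitary_groupD(1)[OF W'] A Suc.prems(2)] by (simp add: A'_def)
  have AA': "A = W * A' * mat_adjoint W" using mat_conj_cancel(1)[OF W A] by (simp add: A'_def)
  have A'0: "A' $$ (i, 0) = (if i = 0 then e else 0)" if i: "i < ?n" for i
  proof -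
    have aw: "(A * W) $$ (j, 0) = e * W $$ (j, 0)" if j: "j < ?n" for j
    proof -
      have "(A * W) $$ (j, 0) = (\<Sum>k<?n. A $$ (j, k) * W $$ (k, 0))"
        by (rule mat_mult_index[OF A Wc j]) simp
      also have "\<dots> = c * (\<Sum>k<?n. A $$ (j, k) * v k)"
        unfolding sum_distrib_left by (intro sum.cong refl) (simp add: col)
      finally show ?thesis using eig[OF j] col[OF j] by simp
    qed
    have c2: "mat_adjoint W \<in> carrier_mat ?n ?n" "A * W \<in> carrier_mat ?n ?n" using Wc A by auto
    have "A' = mat_adjoint W * (A * W)"
      unfolding A'_def by (rule assoc_mult_mat[of _ ?n ?n _ ?n _ ?n]) (use Wc A in auto)
    then have "A' $$ (i, 0) = (\<Sum>j<?n. mat_adjoint W $$ (i, j) * (A * W) $$ (j, 0))"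
      using mat_mult_index[OF c2 i] by simp
    also have "\<dots> = e * (\<Sum>j<?n. mat_adjoint W $$ (i, j) * W $$ (j, 0))"
      unfolding sum_distrib_left by (intro sum.cong refl) (simp add: aw)
    also have "(\<Sum>j<?n. mat_adjoint W $$ (i, j) * W $$ (j, 0)) = (mat_adjoint W * W) $$ (i, 0)"
      by (rule mat_mult_index[symmetric, OF c2(1) Wc i]) simp
    finally show ?thesis unfolding unitary_groupD(2)[OF W] using i by simp
  qed
  have A'0': "A' $$ (0, i) = (if i = 0 then cnj e else 0)" if i: "i < ?n" for i
    using hermitian_mat_index[OF A'c A'h, of 0 i] A'0[OF i] i by auto
  have e_real: "e = complex_of_real (Re e)"
    using A'0[of 0] A'0'[of 0] by (simp add: complex_eq_iff)
  define A3 where "A3 = mat k k (\<lambda>(i, j). A' $$ (Suc i, Suc j))"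
  have A3c: "A3 \<in> carrier_mat k k" by (simp add: A3_def)
  have "hermitian_mat A3"
    by (rule hermitian_matI[OF A3c]) (use hermitian_mat_index[OF A'c A'h] in \<open>auto simp: A3_def\<close>)
  then obtain W3 l3 where W3: "W3 \<in> unitary_group k"
    and A3: "A3 = W3 * diagm k (\<lambda>i. complex_of_real (l3 i)) * mat_adjoint W3"
    using Suc.IH[OF A3c] by blast
  note W3c = unitary_groupD(1)[OF W3]
  \<comment> \<open>The direct sum of the scalar 1 and \<open>W3\<close>.\<close>
  define W1 where "W1 = mat ?n ?n (\<lambda>(i, j). if i = 0 \<and> j = 0 then 1 else if i = 0 \<or> j = 0 then 0 else W3 $$ (i - 1, j - 1))"
  have W1c: "W1 \<in> carrier_mat ?n ?n" by (simp add: W1_def)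
  have W1i: "W1 $$ (0, 0) = 1" "\<And>i. i < k \<Longrightarrow> W1 $$ (Suc i, 0) = 0" "\<And>i. i < k \<Longrightarrow> W1 $$ (0, Suc i) = 0"
    "\<And>i j. i < k \<Longrightarrow> j < k \<Longrightarrow> W1 $$ (Suc i, Suc j) = W3 $$ (i, j)"
    by (auto simp: W1_def)
  have W1: "W1 \<in> unitary_group ?n"
  proof (rule unitary_groupI[OF W1c], rule eq_matI)
    fix i j assume "i < dim_row (1\<^sub>m ?n :: complex mat)" "j < dim_col (1\<^sub>m ?n :: complex mat)"
    then have ij: "i < ?n" "j < ?n" by auto
    have "(W1 * mat_adjoint W1) $$ (i, j) = (\<Sum>l<?n. W1 $$ (i, l) * cnj (W1 $$ (j, l)))"
      unfolding mat_mult_index[OF W1c mat_adjoint_carrier[OF W1c] ij]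
      by (intro sum.cong refl) (use W1c ij in auto)
    also have "\<dots> = W1 $$ (i, 0) * cnj (W1 $$ (j, 0)) + (\<Sum>l<k. W1 $$ (i, Suc l) * cnj (W1 $$ (j, Suc l)))"
      by (rule sum.lessThan_Suc_shift)
    also have "\<dots> = (if i = j then 1 else 0)"
    proof (cases i)
      case 0 then show ?thesis using ij by (cases j) (auto simp: W1i)
    next
      case i: (Suc i')
      show ?thesis
      proof (cases j)
        case 0 then show ?thesis using ij i by (auto simp: W1i)
      next
        case j: (Suc j')
        have ij': "i' < k" "j' < k" using ij i j by auto
        have "(\<Sum>l<k. W3 $$ (i', l) * cnj (W3 $$ (j', l))) = (W3 * mat_adjoint W3) $$ (i', j')"
          unfolding mat_mult_index[OF W3c mat_adjoint_carrier[OF W3c] ij']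
          by (intro sum.cong refl) (use W3c ij' in auto)
        then show ?thesis unfolding i j using ij' unitary_groupD(3)[OF W3] by (simp add: W1i)
      qed
    qed
    finally show "(W1 * mat_adjoint W1) $$ (i, j) = (1\<^sub>m ?n :: complex mat) $$ (i, j)" using ij by simp
  qed (use W1c in auto)
  define l1 where "l1 i = (case i of 0 \<Rightarrow> Re e | Suc i \<Rightarrow> l3 i)" for i
  have "A' = W1 * diagm ?n (\<lambda>i. complex_of_real (l1 i)) * mat_adjoint W1"
  proof (rule eq_matI)
    fix i j assume "i < dim_row (W1 * diagm ?n (\<lambda>i. complex_of_real (l1 i)) * mat_adjoint W1)"
      "j < dim_col (W1 * diagm ?n (\<lambda>i. complex_of_real (l1 i)) * mat_adjoint W1)"
    then have ij: "i < ?n" "j < ?n" using W1c by auto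
    show "A' $$ (i, j) = (W1 * diagm ?n (\<lambda>i. complex_of_real (l1 i)) * mat_adjoint W1) $$ (i, j)"
      unfolding mat_conj_diagm_index[OF W1c ij] sum.lessThan_Suc_shift
    proof (cases i)
      case 0
      then show "A' $$ (i, j) = W1 $$ (i, 0) * complex_of_real (l1 0) * cnj (W1 $$ (j, 0)) +
        (\<Sum>a<k. W1 $$ (i, Suc a) * complex_of_real (l1 (Suc a)) * cnj (W1 $$ (j, Suc a)))"
        using ij A'0'[OF ij(2)] e_real by (cases j) (auto simp: W1i l1_def complex_eq_iff)
    next
      case i: (Suc i')
      show "A' $$ (i, j) = W1 $$ (i, 0) * complex_of_real (l1 0) * cnj (W1 $$ (j, 0)) +
        (\<Sum>a<k. W1 $$ (i, Suc a) * complex_of_real (l1 (Suc a)) * cnj (W1 $$ (j, Suc a)))"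
      proof (cases j)
        case 0 then show ?thesis using ij i A'0[OF ij(1)] by (auto simp: W1i)
      next
        case j: (Suc j')
        have ij': "i' < k" "j' < k" using ij i j by auto
        have "A' $$ (i, j) = A3 $$ (i', j')" using ij' by (simp add: A3_def i j)
        then show ?thesis unfolding A3 mat_conj_diagm_index[OF W3c ij'] i j using ij' by (simp add: W1i l1_def)
      qed
    qed
  qed (use A'c W1c in auto)
  then have "A = (W * W1) * diagm ?n (\<lambda>i. complex_of_real (l1 i)) * mat_adjoint (W * W1)"
    unfolding AA' by (simp add: mat_conj_conj[OF W W1 diagm_carrier])
  then show ?case using unitary_group_mult[OF W W1] by blast
qed

subsection \<open>The entangling gate\<close>

lemma diagm_mult: "diagm n f * diagm n g = diagm n (\<lambda>i. f i * g i)"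
proof (rule eq_matI)
  fix i j assume "i < dim_row (diagm n (\<lambda>i. f i * g i))" "j < dim_col (diagm n (\<lambda>i. f i * g i))"
  then have ij: "i < n" "j < n" by (auto simp: diagm_def)
  have "(diagm n f * diagm n g) $$ (i, j) = (\<Sum>k<n. if i = k then (if k = j then f i * g i else 0) else 0)"
    unfolding mat_mult_index[OF diagm_carrier diagm_carrier ij]
    by (intro sum.cong refl) (use ij in \<open>auto simp: diagm_def\<close>)
  then show "(diagm n f * diagm n g) $$ (i, j) = diagm n (\<lambda>i. f i * g i) $$ (i, j)"
    using ij by (simp add: diagm_def)
qed (auto simp: diagm_def)

lemma mat_conj_diagm_pow:
  assumes W: "W \<in> unitary_group n"
  shows "(W * diagm n f * mat_adjoint W) ^\<^sub>m k = W * diagm n (\<lambda>a. f a ^ k) * mat_adjoint W"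
proof (induction k)
  case 0
  have "diagm n (\<lambda>a. 1) = 1\<^sub>m n" by (rule eq_matI) (auto simp: diagm_def)
  then show ?case using unitary_groupD[OF W] by auto
next
  case (Suc k)
  show ?case
    by (simp add: Suc mat_conj_mult[OF W] diagm_mult mult.commute)
qed

text \<open>The entrywise power series is summed in an eigenbasis of \<open>G\<close>, where it is
  the scalar exponential series.\<close>

lemma mat_exp_diag:
  assumes W: "W \<in> unitary_group n" and G: "G = W * diagm n g * mat_adjoint W"
  shows "mat_exp (c \<cdot>\<^sub>m G) = W * diagm n (\<lambda>a. exp (c * g a)) * mat_adjoint W"
proof -
  note Wc = unitary_groupD(1)[OF W]
  have Gc: "G \<in> carrier_mat n n" unfolding G by (rule mat_conj_carrier[OF W]) simp
  have cG: "c \<cdot>\<^sub>m G = W * diagm n (\<lambda>a. c * g a) * mat_adjoint W"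
  proof (rule eq_matI)
    fix i j assume "i < dim_row (W * diagm n (\<lambda>a. c * g a) * mat_adjoint W)" "j < dim_col (W * diagm n (\<lambda>a. c * g a) * mat_adjoint W)"
    then have ij: "i < n" "j < n" using Wc by auto
    have "(c \<cdot>\<^sub>m G) $$ (i, j) = c * G $$ (i, j)" using ij Gc by simp
    then show "(c \<cdot>\<^sub>m G) $$ (i, j) = (W * diagm n (\<lambda>a. c * g a) * mat_adjoint W) $$ (i, j)"
      unfolding G mat_conj_diagm_index[OF Wc ij] by (simp add: sum_distrib_left mult_ac)
  qed (use Gc Wc in auto)
  show ?thesis
  proof (rule eq_matI)
    fix i j assume "i < dim_row (W * diagm n (\<lambda>a. exp (c * g a)) * mat_adjoint W)" "j < dim_col (W * diagm n (\<lambda>a. exp (c * g a)) * mat_adjoint W)"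
    then have ij: "i < n" "j < n" using Wc by auto
    have e: "(\<lambda>k. (c * g a) ^ k / fact k) sums exp (c * g a)" for a
      using exp_converges[of "c * g a"] by (simp add: scaleR_conv_of_real divide_inverse mult.commute)
    have "(\<lambda>k. \<Sum>a<n. W $$ (i, a) * cnj (W $$ (j, a)) * ((c * g a) ^ k / fact k)) sums
        (\<Sum>a<n. W $$ (i, a) * cnj (W $$ (j, a)) * exp (c * g a))"
      by (intro sums_sum sums_mult e)
    moreover have "((c \<cdot>\<^sub>m G) ^\<^sub>m k) $$ (i, j) / fact k = (\<Sum>a<n. W $$ (i, a) * cnj (W $$ (j, a)) * ((c * g a) ^ k / fact k))" for k
      unfolding cG mat_conj_diagm_pow[OF W] mat_conj_diagm_index[OF Wc ij] sum_divide_distrib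
      by (intro sum.cong refl) (simp add: mult_ac)
    ultimately have "(\<Sum>k. ((c \<cdot>\<^sub>m G) ^\<^sub>m k) $$ (i, j) / fact k) = (\<Sum>a<n. W $$ (i, a) * cnj (W $$ (j, a)) * exp (c * g a))"
      by (simp add: sums_iff)
    then show "mat_exp (c \<cdot>\<^sub>m G) $$ (i, j) = (W * diagm n (\<lambda>a. exp (c * g a)) * mat_adjoint W) $$ (i, j)"
      unfolding mat_conj_diagm_index[OF Wc ij] using ij Gc by (simp add: mat_exp_def mult_ac)
  qed (use Gc Wc in \<open>auto simp: mat_exp_def\<close>)
qed

text \<open>The eigenvalues are real, so the second exponential is the adjoint of the first. One
  unitary serves all arguments \<open>X\<close>, so the gate is a conjugation and inherits trace,
  hermiticity and expansion facts from that.\<close>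

lemma entangling_gate_unitary:
  assumes G: "G \<in> carrier_mat n n" "hermitian_mat G"
  shows "\<exists>E\<in>unitary_group n. \<forall>X. entangling_gate G x X = E * X * mat_adjoint E"
proof -
  obtain W l where W: "W \<in> unitary_group n" and G': "G = W * diagm n (\<lambda>i. complex_of_real (l i)) * mat_adjoint W"
    using hermitian_diagonalisation[OF G] by blast
  note Wc = unitary_groupD(1)[OF W]
  define E where "E = mat_exp ((\<i> * complex_of_real x) \<cdot>\<^sub>m G)"
  have E: "E = W * diagm n (\<lambda>a. exp (\<i> * complex_of_real x * complex_of_real (l a))) * mat_adjoint W"
    unfolding E_def by (rule mat_exp_diag[OF W G'])
  have E': "mat_exp ((- (\<i> * complex_of_real x)) \<cdot>\<^sub>m G) = W * diagm n (\<lambda>a. exp (- (\<i> * complex_of_real x) * complex_of_real (l a))) * mat_adjoint W"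
    by (rule mat_exp_diag[OF W G'])
  have Ec: "E \<in> carrier_mat n n" unfolding E by (rule mat_conj_carrier[OF W]) simp
  have adj: "mat_exp ((- (\<i> * complex_of_real x)) \<cdot>\<^sub>m G) = mat_adjoint E"
  proof (rule eq_matI)
    fix i j assume "i < dim_row (mat_adjoint E)" "j < dim_col (mat_adjoint E)"
    then have ij: "i < n" "j < n" using Ec by auto
    show "mat_exp ((- (\<i> * complex_of_real x)) \<cdot>\<^sub>m G) $$ (i, j) = mat_adjoint E $$ (i, j)"
    proof -
      have "mat_adjoint E $$ (i, j) = cnj (E $$ (j, i))" using ij Ec by simp
      also have "\<dots> = (\<Sum>a<n. W $$ (i, a) * exp (- (\<i> * complex_of_real x) * complex_of_real (l a)) * cnj (W $$ (j, a)))"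
        unfolding E mat_conj_diagm_index[OF Wc ij(2,1)] by (simp add: exp_cnj mult_ac)
      finally show ?thesis unfolding E' mat_conj_diagm_index[OF Wc ij] ..
    qed
  qed (use Ec Wc G in \<open>auto simp: mat_exp_def\<close>)
  have "E * mat_adjoint E = W * (diagm n (\<lambda>a. exp (\<i> * complex_of_real x * complex_of_real (l a))) *
      diagm n (\<lambda>a. exp (- (\<i> * complex_of_real x) * complex_of_real (l a)))) * mat_adjoint W"
    unfolding adj[symmetric] E' unfolding E by (rule mat_conj_mult[OF W]) auto
  also have "\<dots> = W * 1\<^sub>m n * mat_adjoint W"
  proof -
    have "diagm n (\<lambda>a. 1) = 1\<^sub>m n" by (rule eq_matI) (auto simp: diagm_def)
    then show ?thesis by (simp add: diagm_mult exp_minus_inverse)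
  qed
  also have "\<dots> = 1\<^sub>m n" using unitary_groupD[OF W] by simp
  finally have "E \<in> unitary_group n" by (rule unitary_groupI[OF Ec])
  then show ?thesis unfolding entangling_gate_def adj E_def[symmetric] by blast
qed

text \<open>In the eigenbasis of \<open>G\<close> the gate multiplies the entry
  \<open>(b, a)\<close> by a phase with frequency \<open>l b - l a\<close>. The norm of
  \<open>G\<close> is returned for the same \<open>l\<close> because
  \<open>entangling_gate_overlap\<close> bounds these frequencies by it;
  \<open>bdd_measurable_entangling_gate\<close> uses the explicit dependence on
  \<open>x\<close>.\<close>

lemma entangling_gate_trace:
  assumes G: "G \<in> carrier_mat n n" "hermitian_mat G"
  obtains W l where "W \<in> unitary_group n" "(hs_norm G)\<^sup>2 = (\<Sum>a<n. (l a)\<^sup>2)"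
    "\<And>B C x. B \<in> carrier_mat n n \<Longrightarrow> C \<in> carrier_mat n n \<Longrightarrow> mat_trace (B * entangling_gate G x C) =
      (\<Sum>a<n. \<Sum>b<n. (W * B * mat_adjoint W) $$ (a, b) * (W * C * mat_adjoint W) $$ (b, a) *
        exp (\<i> * complex_of_real (x * (l b - l a))))"
proof -
  obtain V l where V: "V \<in> unitary_group n" and G': "G = V * diagm n (\<lambda>i. complex_of_real (l i)) * mat_adjoint V"
    using hermitian_diagonalisation[OF G] by blast
  note Vc = unitary_groupD(1)[OF V]
  define W where "W = mat_adjoint V"
  have W: "W \<in> unitary_group n" and V': "V = mat_adjoint W" unfolding W_def using unitary_group_adjoint[OF V] by auto
  note Wc = unitary_groupD(1)[OF W]
  have "hs_inner G G = mat_trace (G * G)" using G(2) by (simp add: hs_inner_def hermitian_mat_def)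
  also have "G * G = V * (diagm n (\<lambda>i. complex_of_real (l i)) * diagm n (\<lambda>i. complex_of_real (l i))) * mat_adjoint V"
    unfolding G' by (rule mat_conj_mult[OF V]) auto
  also have "mat_trace \<dots> = complex_of_real (\<Sum>a<n. (l a)\<^sup>2)"
    unfolding diagm_mult mat_trace_conj[OF V diagm_carrier]
    by (simp add: mat_trace_def diagm_def power2_eq_square)
  finally have nG: "(hs_norm G)\<^sup>2 = (\<Sum>a<n. (l a)\<^sup>2)"
    by (simp add: hs_norm_def sum_nonneg)
  have tr: "mat_trace (B * entangling_gate G x C) =
      (\<Sum>a<n. \<Sum>b<n. (W * B * mat_adjoint W) $$ (a, b) * (W * C * mat_adjoint W) $$ (b, a) *
        exp (\<i> * complex_of_real (x * (l b - l a))))"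
    if B: "B \<in> carrier_mat n n" and C: "C \<in> carrier_mat n n" for B C x
  proof -
    define p q where "p = diagm n (\<lambda>a. exp (\<i> * complex_of_real x * complex_of_real (l a)))"
      and "q = diagm n (\<lambda>a. exp (- (\<i> * complex_of_real x) * complex_of_real (l a)))"
    have pq: "p \<in> carrier_mat n n" "q \<in> carrier_mat n n" by (auto simp: p_def q_def)
    have E: "entangling_gate G x C = (V * p * mat_adjoint V) * C * (V * q * mat_adjoint V)"
      unfolding entangling_gate_def p_def q_def mat_exp_diag[OF V G'] ..
    note c = mat_conj_carrier[OF V pq(1)] mat_conj_carrier[OF V pq(2)]
    have Yc: "entangling_gate G x C \<in> carrier_mat n n" unfolding E
      by (rule mult_carrier_mat[OF mult_carrier_mat[OF c(1) C] c(2)])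
    let ?C = "W * C * mat_adjoint W"
    have pc: "V * p * mat_adjoint V * C \<in> carrier_mat n n" by (rule mult_carrier_mat[OF c(1) C])
    have "W * entangling_gate G x C * mat_adjoint W = (W * (V * p * mat_adjoint V * C) * mat_adjoint W) * (W * (V * q * mat_adjoint V) * mat_adjoint W)"
      unfolding E by (rule mat_conj_mult[symmetric, OF W pc c(2)])
    also have "W * (V * p * mat_adjoint V * C) * mat_adjoint W = (W * (V * p * mat_adjoint V) * mat_adjoint W) * ?C"
      by (rule mat_conj_mult[symmetric, OF W c(1) C])
    finally have Y: "W * entangling_gate G x C * mat_adjoint W = p * ?C * q"
      using mat_conj_cancel(2)[OF V] pq by (simp add: W_def)
    have "mat_trace (B * entangling_gate G x C) = mat_trace (W * (B * entangling_gate G x C) * mat_adjoint W)"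
      by (rule mat_trace_conj[OF W, symmetric]) (use B Yc in auto)
    also have "W * (B * entangling_gate G x C) * mat_adjoint W = (W * B * mat_adjoint W) * (p * ?C * q)"
      unfolding Y[symmetric] by (rule mat_conj_mult[symmetric, OF W B Yc])
    also have "mat_trace \<dots> = (\<Sum>a<n. \<Sum>b<n. (W * B * mat_adjoint W) $$ (a, b) * (p * ?C * q) $$ (b, a))"
      by (rule mat_trace_mult[OF mat_conj_carrier[OF W B]])
        (use pq mat_conj_carrier[OF W C] in auto)
    also have "\<dots> = (\<Sum>a<n. \<Sum>b<n. (W * B * mat_adjoint W) $$ (a, b) * ?C $$ (b, a) * exp (\<i> * complex_of_real (x * (l b - l a))))"
    proof (intro sum.cong refl)
      fix a b assume "a \<in> {..<n}" "b \<in> {..<n}"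
      then have ab: "a < n" "b < n" by auto
      have "(p * ?C * q) $$ (b, a) = (\<Sum>k<n. \<Sum>m<n. if b = k \<and> a = m then
          exp (\<i> * complex_of_real x * complex_of_real (l b)) * ?C $$ (k, m) * exp (- (\<i> * complex_of_real x) * complex_of_real (l a)) else 0)"
        unfolding mat_mult3_index[OF pq(1) mat_conj_carrier[OF W C] pq(2) ab(2,1)]
        by (intro sum.cong refl) (use ab in \<open>auto simp: p_def q_def diagm_def\<close>)
      also have "\<dots> = exp (\<i> * complex_of_real x * complex_of_real (l b)) * ?C $$ (b, a) * exp (- (\<i> * complex_of_real x) * complex_of_real (l a))"
        using ab by (rule sum_delta_pair[rotated])
      also have "\<dots> = ?C $$ (b, a) * exp (\<i> * complex_of_real (x * (l b - l a)))"
        by (simp add: exp_add[symmetric] mult_ac) (simp add: algebra_simps exp_diff exp_minus divide_inverse)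
      finally show "(W * B * mat_adjoint W) $$ (a, b) * (p * ?C * q) $$ (b, a) =
          (W * B * mat_adjoint W) $$ (a, b) * ?C $$ (b, a) * exp (\<i> * complex_of_real (x * (l b - l a)))"
        by simp
    qed
    finally show ?thesis .
  qed
  show thesis by (rule that[OF W nG tr])
qed

lemma one_minus_cos_le: "1 - cos x \<le> x\<^sup>2 / (2 :: real)"
proof -
  have "cos x = 1 - 2 * (sin (x / 2))\<^sup>2" using cos_double_sin[of "x / 2"] by simp
  moreover have "(sin (x / 2))\<^sup>2 \<le> (x / 2)\<^sup>2"
    by (metis abs_sin_x_le_abs_x abs_ge_zero power2_abs power_mono)
  ultimately show ?thesis by (simp add: power2_eq_square)
qed

text \<open>The weights \<open>w a b\<close> sum to 1, and each cosine loses at most y^2 / 2 for y =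
  x (l b - l a). Two eigenvalues differ by at most sqrt 2 times the norm of \<open>G\<close>, which
  cancels the factor 1/2.\<close>

lemma entangling_gate_overlap:
  assumes G: "G \<in> carrier_mat n n" "hermitian_mat G"
    and B: "B \<in> carrier_mat n n" "hermitian_mat B" "mat_trace (B * B) = 1"
  shows "1 - x\<^sup>2 * (hs_norm G)\<^sup>2 \<le> Re (mat_trace (B * entangling_gate G x B))"
proof -
  obtain W l where W: "W \<in> unitary_group n" and nG: "(hs_norm G)\<^sup>2 = (\<Sum>a<n. (l a)\<^sup>2)"
    and tr': "\<And>B C x. B \<in> carrier_mat n n \<Longrightarrow> C \<in> carrier_mat n n \<Longrightarrow> mat_trace (B * entangling_gate G x C) =
      (\<Sum>a<n. \<Sum>b<n. (W * B * mat_adjoint W) $$ (a, b) * (W * C * mat_adjoint W) $$ (b, a) *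
        exp (\<i> * complex_of_real (x * (l b - l a))))"
    by (rule entangling_gate_trace[OF G]) (rule that; simp)
  note tr = tr'[OF B(1) B(1)]
  let ?B = "W * B * mat_adjoint W"
  have Bc: "?B \<in> carrier_mat n n" by (rule mat_conj_carrier[OF W B(1)])
  have Bh: "hermitian_mat ?B" by (rule hermitian_conj[OF unitary_groupD(1)[OF W] B(1,2)])
  define w where "w a b = (norm (?B $$ (a, b)))\<^sup>2" for a b
  have Bw: "?B $$ (a, b) * ?B $$ (b, a) = complex_of_real (w a b)" if "a < n" "b < n" for a b
    using hermitian_mat_index[OF Bc Bh that(2,1)] by (metis complex_norm_square w_def)
  have "mat_trace (?B * ?B) = 1"
    using mat_conj_mult[OF W B(1) B(1)] mat_trace_conj[OF W mult_carrier_mat[OF B(1) B(1)]] B(3) by simp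
  then have "complex_of_real (\<Sum>a<n. \<Sum>b<n. w a b) = 1"
    unfolding mat_trace_mult[OF Bc Bc] by (simp add: Bw)
  then have w1: "(\<Sum>a<n. \<Sum>b<n. w a b) = 1" using of_real_eq_1_iff by blast
  have "Re (mat_trace (B * entangling_gate G x B)) = (\<Sum>a<n. \<Sum>b<n. w a b * cos (x * (l b - l a)))"
    unfolding tr Re_sum
  proof (intro sum.cong refl)
    fix a b assume "a \<in> {..<n}" "b \<in> {..<n}"
    then show "Re (?B $$ (a, b) * ?B $$ (b, a) * exp (\<i> * complex_of_real (x * (l b - l a)))) = w a b * cos (x * (l b - l a))"
      by (simp add: Bw Re_exp del: of_real_mult)
  qed
  moreover have "(\<Sum>a<n. \<Sum>b<n. w a b * (1 - cos (x * (l b - l a)))) \<le> (\<Sum>a<n. \<Sum>b<n. w a b * (x\<^sup>2 * (hs_norm G)\<^sup>2))"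
  proof (intro sum_mono mult_left_mono)
    fix a b assume ab: "a \<in> {..<n}" "b \<in> {..<n}"
    show "0 \<le> w a b" by (simp add: w_def)
    have "(l b - l a)\<^sup>2 \<le> 2 * (\<Sum>a<n. (l a)\<^sup>2)"
    \<comment> \<open>For distinct \<open>a\<close> and \<open>b\<close> the two squares are
      distinct summands of the squared norm; for \<open>a = b\<close> the left side is 0.\<close>
    proof (cases "a = b")
      case False
      have "(l b - l a)\<^sup>2 \<le> 2 * ((l a)\<^sup>2 + (l b)\<^sup>2)"
        using zero_le_power2[of "l a + l b"] by (simp add: power2_eq_square algebra_simps)
      also have "(l a)\<^sup>2 + (l b)\<^sup>2 = (\<Sum>i\<in>{a, b}. (l i)\<^sup>2)" using False by simp
      also have "\<dots> \<le> (\<Sum>a<n. (l a)\<^sup>2)" using ab by (intro sum_mono2) auto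
      finally show ?thesis by simp
    qed (simp add: sum_nonneg)
    then have "x\<^sup>2 * (l b - l a)\<^sup>2 \<le> x\<^sup>2 * (2 * (hs_norm G)\<^sup>2)"
      unfolding nG by (intro mult_left_mono) auto
    then show "1 - cos (x * (l b - l a)) \<le> x\<^sup>2 * (hs_norm G)\<^sup>2"
      using one_minus_cos_le[of "x * (l b - l a)"] by (simp add: power_mult_distrib)
  qed
  ultimately show ?thesis
    unfolding right_diff_distrib sum_subtractf sum_distrib_right[symmetric] by (simp add: w1)
qed

lemma bdd_measurable_entangling_gate:
  assumes G: "G \<in> carrier_mat n n" "hermitian_mat G" and B: "B \<in> carrier_mat n n" "C \<in> carrier_mat n n"
  shows "bdd_measurable borel (\<lambda>x. mat_trace (B * entangling_gate G x C))"
proof -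
  obtain W l where W: "W \<in> unitary_group n" "(hs_norm G)\<^sup>2 = (\<Sum>a<n. (l a)\<^sup>2)"
    and tr: "\<And>B C x. B \<in> carrier_mat n n \<Longrightarrow> C \<in> carrier_mat n n \<Longrightarrow> mat_trace (B * entangling_gate G x C) =
      (\<Sum>a<n. \<Sum>b<n. (W * B * mat_adjoint W) $$ (a, b) * (W * C * mat_adjoint W) $$ (b, a) *
        exp (\<i> * complex_of_real (x * (l b - l a))))"
    by (rule entangling_gate_trace[OF G]) (rule that; simp)
  have e: "bdd_measurable borel (\<lambda>x. exp (\<i> * complex_of_real (x * c)))" for c
    unfolding bdd_measurable_def
  proof
    show "(\<lambda>x. exp (\<i> * complex_of_real (x * c))) \<in> borel_measurable borel"
      by (intro borel_measurable_continuous_onI continuous_intros)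
  qed (auto intro!: exI[of _ 1])
  show ?thesis unfolding tr[OF B]
    by (intro bdd_measurable_sum bdd_measurable_mult bdd_measurable_const e)
qed

subsection \<open>Expectations over the layers\<close>

lemma pattern_Cons: "pattern (d # ds) (A # As) = (A \<noteq> normid d) # pattern ds As"
  by (simp add: pattern_def)

lemma card_sector_index:
  assumes "\<And>d. d \<in> set ds \<Longrightarrow> qubit_block d" "length \<kappa> = length ds"
  shows "card (sector_index ds \<kappa>) = (\<Prod>(d, k)\<leftarrow>zip ds \<kappa>. if k then card (block_basis d) - 1 else 1)"
  using assms(2,1)
proof (induction \<kappa> ds rule: list_induct2)
  case Nil
  then show ?case by (simp add: sector_index_def tensor_index_def pattern_def)
next
  case (Cons k \<kappa> d ds)
  have q: "qubit_block d" using Cons.prems by simp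
  let ?S = "{A \<in> block_basis d. (A \<noteq> normid d) = k}"
  have eq: "sector_index (d # ds) (k # \<kappa>) = (\<lambda>(A, As). A # As) ` (?S \<times> sector_index ds \<kappa>)"
    unfolding sector_index_def tensor_index_Cons by (auto simp: pattern_Cons image_iff)
  have "card (sector_index (d # ds) (k # \<kappa>)) = card ?S * card (sector_index ds \<kappa>)"
    unfolding eq by (subst card_image) (auto simp: inj_on_def card_cartesian_product)
  moreover have "card ?S = (if k then card (block_basis d) - 1 else 1)"
  proof (cases k)
    case True
    then have "?S = block_basis d - {normid d}" by auto
    then show ?thesis using True block_basis[OF q] by (simp add: card_Diff_singleton)
  next
    case False
    then have "?S = {normid d}" using block_basis[OF q] by auto
    then show ?thesis using False by simp
  qed
  ultimately show ?case using Cons by simp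
qed

text \<open>A block on which exactly one of the two tensors is the identity contributes 0. A block
  on which neither is contributes the inverse of its factor in
  \<open>card_sector_index\<close>.\<close>

lemma (in qubit_blocks) prod_design_coeff:
  assumes \<alpha>: "\<alpha> \<in> tensor_index ds" and \<beta>: "\<beta> \<in> tensor_index ds"
  shows "(\<Prod>m<length ds. design_coeff (ds ! m) (\<alpha> ! m) (\<beta> ! m)) =
    (if pattern ds \<alpha> = pattern ds \<beta> then 1 / real (card (sector_index ds (pattern ds \<alpha>))) else 0)"
proof (cases "pattern ds \<alpha> = pattern ds \<beta>")
  case True
  have "real (card (sector_index ds (pattern ds \<alpha>))) =
      (\<Prod>m<length ds. if pattern ds \<alpha> ! m then real (card (block_basis (ds ! m))) - 1 else 1)"
  proof -
    have c: "card (block_basis (ds ! m)) \<ge> 1" if "m < length ds" for m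
      using block_basisD[OF that] hs_onbD(1) by (metis One_nat_def Suc_leI card_gt_0_iff empty_iff)
    have "card (sector_index ds (pattern ds \<alpha>)) =
        (\<Prod>m<length ds. if pattern ds \<alpha> ! m then card (block_basis (ds ! m)) - 1 else 1)"
      by (subst card_sector_index)
        (auto simp: qubit_blocks pattern_length[OF \<alpha>] prod.list_conv_set_nth lessThan_atLeast0 intro!: prod.cong)
    then show ?thesis using c by (auto simp: of_nat_diff intro!: prod.cong)
  qed
  then have "1 / real (card (sector_index ds (pattern ds \<alpha>))) =
      (\<Prod>m<length ds. if pattern ds \<alpha> ! m then 1 / (real (card (block_basis (ds ! m))) - 1) else 1)"
    using prod_dividef[of "\<lambda>_. 1 :: real"
        "\<lambda>m. if pattern ds \<alpha> ! m then real (card (block_basis (ds ! m))) - 1 else 1" "{..<length ds}"]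
    by (simp add: if_distrib cong: if_cong)
  also have "\<dots> = (\<Prod>m<length ds. design_coeff (ds ! m) (\<alpha> ! m) (\<beta> ! m))"
    using pattern_nth[OF \<alpha>] pattern_nth[OF \<beta>] True
    by (intro prod.cong refl) (auto simp: design_coeff_def)
  finally show ?thesis using True by simp
next
  case False
  then obtain m where m: "m < length ds" "pattern ds \<alpha> ! m \<noteq> pattern ds \<beta> ! m"
    using nth_equalityI[of "pattern ds \<alpha>" "pattern ds \<beta>"] pattern_length[OF \<alpha>] pattern_length[OF \<beta>] by auto
  then have "design_coeff (ds ! m) (\<alpha> ! m) (\<beta> ! m) = 0"
    using pattern_nth[OF \<alpha>] pattern_nth[OF \<beta>] by (auto simp: design_coeff_def)
  then show ?thesis using False m(1) by (auto intro!: prod_zero)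
qed

text \<open>Parseval after moving the conjugation onto \<open>A\<close>, which spares a separate
  linearity argument for sums of matrices.\<close>

lemma (in qubit_blocks) mat_trace_conj_expand:
  assumes V: "V \<in> carrier_mat D D" and X: "X \<in> carrier_mat D D" and A: "A \<in> carrier_mat D D"
  shows "mat_trace (A * (V * X * mat_adjoint V)) =
    (\<Sum>\<beta>\<in>tensor_index ds. mat_trace (tensor_mats \<beta> * X) * mat_trace (A * (V * tensor_mats \<beta> * mat_adjoint V)))"
proof -
  have c: "mat_adjoint V * A * V \<in> carrier_mat D D"
    by (rule mult_carrier_mat[OF mult_carrier_mat[OF mat_adjoint_carrier[OF V] A] V])
  show ?thesis
    unfolding mat_trace_conj_cyclic[OF V X A] tensor_trace_expand[OF X c]
    by (intro sum.cong refl) (simp add: mat_trace_conj_cyclic[OF V tensor_index_carrier A])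
qed

lemma unitary_kronecker:
  assumes "V \<in> unitary_group a" "W \<in> unitary_group b"
  shows "kronecker V W \<in> unitary_group (a * b)"
proof (rule unitary_groupI)
  note V = unitary_groupD[OF assms(1)] and W = unitary_groupD[OF assms(2)]
  show "kronecker V W * mat_adjoint (kronecker V W) = 1\<^sub>m (a * b)"
    unfolding mat_adjoint_kronecker
    by (simp add: kronecker_mult[OF V(1) W(1) mat_adjoint_carrier[OF V(1)] mat_adjoint_carrier[OF W(1)]] V(3) W(3) kronecker_one)
qed (use unitary_groupD(1) assms in auto)

lemma unitary_tensor_mats:
  "list_all2 (\<lambda>d V. V \<in> unitary_group d) ds Vs \<Longrightarrow> tensor_mats Vs \<in> unitary_group (prod_list ds)"
proof (induction rule: list_all2_induct)
  case Nil
  show ?case by (rule unitary_groupI) auto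
qed (simp add: unitary_kronecker)

lemma (in qubit_blocks) local_layer_unitary:
  assumes "\<And>m. m < length ds \<Longrightarrow> u m \<in> unitary_group (ds ! m)"
  shows "tensor_mats (map u [0..<length ds]) \<in> unitary_group D"
  by (rule unitary_tensor_mats) (use assms in \<open>auto simp: list_all2_conv_all_nth\<close>)

text \<open>The overlap factors over the blocks, which is the form needed to use independence within
  one layer.\<close>

lemma (in qubit_blocks) local_layer_overlap:
  assumes u: "\<And>m. m < length ds \<Longrightarrow> u m \<in> unitary_group (ds ! m)"
    and \<alpha>: "\<alpha> \<in> tensor_index ds" and \<beta>: "\<beta> \<in> tensor_index ds"
  shows "mat_trace (tensor_mats \<alpha> * local_layer (length ds) u (tensor_mats \<beta>)) =
    (\<Prod>m<length ds. mat_trace (\<alpha> ! m * (u m * \<beta> ! m * mat_adjoint (u m))))"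
proof -
  let ?us = "map u [0..<length ds]" and ?vs = "map mat_adjoint (map u [0..<length ds])"
  have us: "square_mats ds ?us" and vs: "square_mats ds ?vs"
    using unitary_groupD(1)[OF u] by (auto simp: list_all2_conv_all_nth)
  note b = tensor_index_squareD[OF \<beta>]
  have lb: "length \<beta> = length ds" by (rule tensor_index_length[OF \<beta>])
  have ub: "square_mats ds (map2 (*) ?us \<beta>)"
    using us b by (auto simp: list_all2_conv_all_nth)
  have ubv: "square_mats ds (map2 (*) (map2 (*) ?us \<beta>) ?vs)"
    using ub vs by (auto simp: list_all2_conv_all_nth)
  show ?thesis
    unfolding local_layer_def mat_adjoint_tensor_mats tensor_mats_mult[OF us b] tensor_mats_mult[OF ub vs]
      mat_trace_tensor_mult[OF tensor_index_squareD[OF \<alpha>] ubv]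
    by (intro prod.cong refl) (simp add: lb)
qed

text \<open>Here \<open>\<sigma>\<^sup>2\<close> is the raw second moment of \<open>\<nu>\<close>;
  the mean-zero hypothesis identifies it with the variance at the end.\<close>

locale layered_circuit = random_layered_circuit P ds L \<nu> U \<phi> + qubit_blocks ds
  for P :: "'w measure" and ds L \<nu> U \<phi> +
  fixes G \<rho> :: "complex mat" and \<sigma> :: real
  assumes G: "G \<in> carrier_mat (prod_list ds) (prod_list ds)" "hermitian_mat G"
    and \<rho>: "\<rho> \<in> carrier_mat (prod_list ds) (prod_list ds)" "hermitian_mat \<rho>"
    and \<nu>: "prob_space \<nu>" "sets \<nu> = sets borel" "integrable \<nu> (\<lambda>x. x\<^sup>2)" "(\<integral>x. x\<^sup>2 \<partial>\<nu>) = \<sigma>\<^sup>2"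
begin

abbreviation I where "I \<equiv> layer_index (length ds) L"

lemma finite_I [simp]: "finite I"
  by (simp add: layer_index_def)

lemma U_measurable: "(l, m) \<in> I \<Longrightarrow> U l m \<in> measurable P (unitary_borel (ds ! m))"
  using U_design by blast

lemma U_unitary: "(l, m) \<in> I \<Longrightarrow> \<omega> \<in> space P \<Longrightarrow> U l m \<omega> \<in> unitary_group (ds ! m)"
  using measurable_space[OF U_measurable] by auto

lemma \<phi>_measurable: "l \<in> {1..L} \<Longrightarrow> \<phi> l \<in> borel_measurable P"
  using \<phi>_distr by blast

text \<open>Test functions of the layers: \<open>f l m\<close> acts on the unitary \<open>U l m\<close> and \<open>g l\<close> on the parameter \<open>\<phi> l\<close>.\<close>

definition test_fun :: "(nat \<Rightarrow> nat \<Rightarrow> complex mat \<Rightarrow> complex) \<Rightarrow> (nat \<Rightarrow> real \<Rightarrow> complex) \<Rightarrow> bool" where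
  "test_fun f g \<longleftrightarrow> (\<forall>(l, m)\<in>I. bdd_measurable (unitary_borel (ds ! m)) (f l m)) \<and>
     (\<forall>l\<in>{1..L}. bdd_measurable borel (g l))"

definition rprod :: "(nat \<Rightarrow> nat \<Rightarrow> complex mat \<Rightarrow> complex) \<Rightarrow> (nat \<Rightarrow> real \<Rightarrow> complex) \<Rightarrow> 'w \<Rightarrow> complex" where
  "rprod f g \<omega> = (\<Prod>(l, m)\<in>I. f l m (U l m \<omega>)) * (\<Prod>l\<in>{1..L}. g l (\<phi> l \<omega>))"

text \<open>The value that independence predicts for the mean of \<open>rprod f g\<close>; the
  parameters are integrated against their common law \<open>\<nu>\<close>.\<close>

definition eprod :: "(nat \<Rightarrow> nat \<Rightarrow> complex mat \<Rightarrow> complex) \<Rightarrow> (nat \<Rightarrow> real \<Rightarrow> complex) \<Rightarrow> complex" where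
  "eprod f g = (\<Prod>(l, m)\<in>I. expectation (\<lambda>\<omega>. f l m (U l m \<omega>))) * (\<Prod>l\<in>{1..L}. \<integral>x. g l x \<partial>\<nu>)"

text \<open>Independence enters only here, in three ways: between the unitaries and the parameters,
  among the unitaries, and among the parameters.\<close>

lemma expectation_rprod:
  assumes fg: "test_fun f g"
  shows "expectation (rprod f g) = eprod f g"
proof -
  have f: "bdd_measurable (unitary_borel (ds ! m)) (f l m)" if "(l, m) \<in> I" for l m
    using fg that by (auto simp: test_fun_def)
  have g: "bdd_measurable borel (g l)" if "l \<in> {1..L}" for l
    using fg that by (auto simp: test_fun_def)
  have fU: "bdd_measurable P (\<lambda>\<omega>. f l m (U l m \<omega>))" if "(l, m) \<in> I" for l m
    using f[OF that] U_measurable[OF that] by (rule bdd_measurable_compose)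
  have g\<phi>: "bdd_measurable P (\<lambda>\<omega>. g l (\<phi> l \<omega>))" if "l \<in> {1..L}" for l
    using g[OF that] \<phi>_measurable[OF that] by (rule bdd_measurable_compose)
  define XU where "XU \<omega> = (\<lambda>(l, m)\<in>I. U l m \<omega>)" for \<omega>
  define X\<phi> where "X\<phi> \<omega> = (\<lambda>l\<in>{1..L}. \<phi> l \<omega>)" for \<omega>
  let ?MU = "Pi\<^sub>M I (\<lambda>(l, m). unitary_borel (ds ! m))" and ?M\<phi> = "Pi\<^sub>M {1..L} (\<lambda>_. borel) :: (nat \<Rightarrow> real) measure"
  have XU: "XU \<in> measurable P ?MU"
    unfolding XU_def by (rule measurable_restrict) (use U_measurable in auto)
  have X\<phi>: "X\<phi> \<in> measurable P ?M\<phi>"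
    unfolding X\<phi>_def by (rule measurable_restrict) (use \<phi>_measurable in auto)
  have mf: "(\<lambda>u. \<Prod>(l, m)\<in>I. f l m (u (l, m))) \<in> borel_measurable ?MU"
  proof (rule borel_measurable_prod)
    fix p assume p: "p \<in> I"
    obtain l m where lm: "p = (l, m)" by (cases p)
    have "(\<lambda>u. u (l, m)) \<in> measurable ?MU (unitary_borel (ds ! m))"
      using measurable_component_singleton[of "(l, m)" I "\<lambda>(l, m). unitary_borel (ds ! m)"] p lm by simp
    then show "(\<lambda>u. case p of (l, m) \<Rightarrow> f l m (u (l, m))) \<in> borel_measurable ?MU"
      using f[of l m] p unfolding lm bdd_measurable_def by (auto intro: measurable_compose)
  qed
  have mg: "(\<lambda>x. \<Prod>l\<in>{1..L}. g l (x l)) \<in> borel_measurable ?M\<phi>"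
  proof (rule borel_measurable_prod)
    fix l assume l: "l \<in> {1..L}"
    have "(\<lambda>x. x l) \<in> measurable ?M\<phi> borel" by (rule measurable_component_singleton[OF l])
    then show "(\<lambda>x. g l (x l)) \<in> borel_measurable ?M\<phi>"
      using g[OF l] unfolding bdd_measurable_def by (auto intro: measurable_compose)
  qed
  let ?F = "\<lambda>\<omega>. \<Prod>(l, m)\<in>I. f l m (U l m \<omega>)" and ?K = "\<lambda>\<omega>. \<Prod>l\<in>{1..L}. g l (\<phi> l \<omega>)"
  \<comment> \<open>The independence of unitaries and parameters concerns the sigma-algebras of the
    joint maps \<open>XU\<close> and \<open>X\<phi>\<close>, so both products are shown measurable
    for these, not just for \<open>P\<close>.\<close>
  have F: "?F \<in> borel_measurable (vimage_algebra (space P) XU ?MU)"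
  proof -
    have "(\<lambda>\<omega>. \<Prod>(l, m)\<in>I. f l m (XU \<omega> (l, m))) \<in> borel_measurable (vimage_algebra (space P) XU ?MU)"
      using measurable_space[OF XU] by (intro measurable_compose[OF measurable_vimage_algebra1 mf]) auto
    moreover have "(\<lambda>\<omega>. \<Prod>(l, m)\<in>I. f l m (XU \<omega> (l, m))) = ?F"
      by (auto simp: XU_def fun_eq_iff intro!: prod.cong)
    ultimately show ?thesis by simp
  qed
  have K: "?K \<in> borel_measurable (vimage_algebra (space P) X\<phi> ?M\<phi>)"
  proof -
    have "(\<lambda>\<omega>. \<Prod>l\<in>{1..L}. g l (X\<phi> \<omega> l)) \<in> borel_measurable (vimage_algebra (space P) X\<phi> ?M\<phi>)"
      using measurable_space[OF X\<phi>] by (intro measurable_compose[OF measurable_vimage_algebra1 mg]) auto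
    moreover have "(\<lambda>\<omega>. \<Prod>l\<in>{1..L}. g l (X\<phi> \<omega> l)) = ?K"
      by (auto simp: X\<phi>_def fun_eq_iff intro!: prod.cong)
    ultimately show ?thesis by simp
  qed
  have sig: "sigma_sets (space P) {h -` A \<inter> space P | A. A \<in> sets borel} \<subseteq> sets (vimage_algebra (space P) X N)"
    if "h \<in> borel_measurable (vimage_algebra (space P) X N)" for h :: "'w \<Rightarrow> complex" and X :: "'w \<Rightarrow> 'z" and N
    using measurable_sets[OF that] sets.sigma_sets_subset[of _ "vimage_algebra (space P) X N"]
    by (simp, intro sets.sigma_sets_subset[of _ "vimage_algebra (space P) X N", simplified]) auto
  have "indep_set (sets (vimage_algebra (space P) XU ?MU)) (sets (vimage_algebra (space P) X\<phi> ?M\<phi>))"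
    using U_\<phi>_indep unfolding XU_def X\<phi>_def .
  then have "indep_set (sigma_sets (space P) {?F -` A \<inter> space P | A. A \<in> sets borel})
      (sigma_sets (space P) {?K -` A \<inter> space P | A. A \<in> sets borel})"
    unfolding indep_set_def using sig[OF F] sig[OF K]
    by (elim indep_sets_mono_sets) (auto split: bool.split)
  moreover have bP: "bdd_measurable P ?F" "bdd_measurable P ?K"
    by (rule bdd_measurable_prod, use fU g\<phi> in auto)+
  ultimately have ind: "indep_var borel ?F borel ?K"
    unfolding indep_var_eq by (simp add: bdd_measurable_def)
  from bP have "expectation (rprod f g) = expectation (\<lambda>\<omega>. \<Prod>(l, m)\<in>I. f l m (U l m \<omega>)) * expectation (\<lambda>\<omega>. \<Prod>l\<in>{1..L}. g l (\<phi> l \<omega>))"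
    unfolding rprod_def by (intro indep_var_lebesgue_integral[OF ind] bdd_measurable_integrable)
  also have "expectation (\<lambda>\<omega>. \<Prod>(l, m)\<in>I. f l m (U l m \<omega>)) = (\<Prod>(l, m)\<in>I. expectation (\<lambda>\<omega>. f l m (U l m \<omega>)))"
  proof -
    have "indep_vars (\<lambda>_. borel) (\<lambda>p \<omega>. (\<lambda>(l, m). f l m) p ((\<lambda>(l, m). U l m) p \<omega>)) I"
      by (rule indep_vars_compose2[OF U_indep]) (use f in \<open>auto simp: bdd_measurable_def\<close>)
    from indep_vars_lebesgue_integral[OF finite_I this] show ?thesis
      using fU bdd_measurable_integrable by (auto simp: case_prod_unfold)
  qed
  also have "expectation (\<lambda>\<omega>. \<Prod>l\<in>{1..L}. g l (\<phi> l \<omega>)) = (\<Prod>l\<in>{1..L}. expectation (\<lambda>\<omega>. g l (\<phi> l \<omega>)))"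
  proof (rule indep_vars_lebesgue_integral)
    show "indep_vars (\<lambda>_. borel) (\<lambda>l \<omega>. g l (\<phi> l \<omega>)) {1..L}"
      by (rule indep_vars_compose2[OF \<phi>_indep]) (use g in \<open>auto simp: bdd_measurable_def\<close>)
  qed (use g\<phi> bdd_measurable_integrable in auto)
  also have "\<dots> = (\<Prod>l\<in>{1..L}. \<integral>x. g l x \<partial>\<nu>)"
  proof (intro prod.cong refl)
    fix l assume l: "l \<in> {1..L}"
    have "(\<integral>x. g l x \<partial>distr P borel (\<phi> l)) = expectation (\<lambda>\<omega>. g l (\<phi> l \<omega>))"
      by (rule integral_distr[OF \<phi>_measurable[OF l]]) (use g[OF l] in \<open>simp add: bdd_measurable_def\<close>)
    then show "expectation (\<lambda>\<omega>. g l (\<phi> l \<omega>)) = (\<integral>x. g l x \<partial>\<nu>)" using \<phi>_distr[OF l] by simp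
  qed
  finally show ?thesis by (simp add: eprod_def)
qed

lemma bdd_measurable_rprod: "test_fun f g \<Longrightarrow> bdd_measurable P (rprod f g)"
  unfolding rprod_def test_fun_def
  by (intro bdd_measurable_mult bdd_measurable_prod)
    (auto intro: bdd_measurable_compose[OF _ U_measurable] bdd_measurable_compose[OF _ \<phi>_measurable])

end

context layered_circuit
begin

section \<open>Coordinates of layers, gates and states\<close>

abbreviation circ :: "nat \<Rightarrow> 'w \<Rightarrow> complex mat" where
  "circ l \<omega> \<equiv> circuit (length ds) G (\<lambda>l m. U l m \<omega>) (\<lambda>l. \<phi> l \<omega>) l \<rho>"

text \<open>Matrix elements of a local layer as a superoperator; in a Pauli basis this is the Pauli
  transfer matrix. \<open>gate_coeff\<close> is the same for a gate, and \<open>circ_coeff\<close>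
  gives the coordinates of the state.\<close>

definition layer_coeff :: "nat \<Rightarrow> complex mat list \<Rightarrow> complex mat list \<Rightarrow> 'w \<Rightarrow> complex" where
  "layer_coeff l \<alpha> \<beta> \<omega> = mat_trace (tensor_mats \<alpha> * local_layer (length ds) (\<lambda>m. U l m \<omega>) (tensor_mats \<beta>))"

definition gate_coeff :: "complex mat list \<Rightarrow> complex mat list \<Rightarrow> real \<Rightarrow> complex" where
  "gate_coeff \<alpha> \<beta> x = mat_trace (tensor_mats \<alpha> * entangling_gate G x (tensor_mats \<beta>))"

definition circ_coeff :: "nat \<Rightarrow> complex mat list \<Rightarrow> 'w \<Rightarrow> complex" where
  "circ_coeff l \<alpha> \<omega> = mat_trace (tensor_mats \<alpha> * circ l \<omega>)"

lemma layer_unitary: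
  assumes "l \<in> {1..L + 1}" "\<omega> \<in> space P"
  shows "tensor_mats (map (\<lambda>m. U l m \<omega>) [0..<length ds]) \<in> unitary_group D"
  using assms by (intro local_layer_unitary U_unitary) (auto simp: layer_index_def)

lemma gate_carrier: "X \<in> carrier_mat D D \<Longrightarrow> entangling_gate G x X \<in> carrier_mat D D"
  using entangling_gate_unitary[OF G, of x] mat_conj_carrier by metis

lemma layer_carrier:
  "l \<in> {1..L + 1} \<Longrightarrow> \<omega> \<in> space P \<Longrightarrow> X \<in> carrier_mat D D \<Longrightarrow>
    local_layer (length ds) (\<lambda>m. U l m \<omega>) X \<in> carrier_mat D D"
  unfolding local_layer_def by (rule mat_conj_carrier[OF layer_unitary])

lemma circ_carrier: "l \<le> L \<Longrightarrow> \<omega> \<in> space P \<Longrightarrow> circ l \<omega> \<in> carrier_mat D D"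
proof (induction l)
  case 0 then show ?case using layer_carrier[of 1] \<rho> by simp
next
  case (Suc l) then show ?case using layer_carrier[of "l + 2"] gate_carrier by simp
qed

lemma mat_trace_layer: "l \<in> {1..L + 1} \<Longrightarrow> \<omega> \<in> space P \<Longrightarrow> X \<in> carrier_mat D D \<Longrightarrow>
    mat_trace (local_layer (length ds) (\<lambda>m. U l m \<omega>) X) = mat_trace X"
  unfolding local_layer_def by (rule mat_trace_conj[OF layer_unitary])

lemma mat_trace_gate: "X \<in> carrier_mat D D \<Longrightarrow> mat_trace (entangling_gate G x X) = mat_trace X"
  using entangling_gate_unitary[OF G, of x] mat_trace_conj by metis

text \<open>Used for the shifted observable: the identity part then contributes a constant to the
  loss.\<close>

lemma mat_trace_circ: "l \<le> L \<Longrightarrow> \<omega> \<in> space P \<Longrightarrow> mat_trace (circ l \<omega>) = mat_trace \<rho>"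
proof (induction l)
  case 0 then show ?case using mat_trace_layer[of 1] \<rho> by simp
next
  case (Suc l)
  then show ?case using mat_trace_layer[of "l + 2"] mat_trace_gate[OF circ_carrier] gate_carrier[OF circ_carrier] by simp
qed

lemma hermitian_gate: "X \<in> carrier_mat D D \<Longrightarrow> hermitian_mat X \<Longrightarrow> hermitian_mat (entangling_gate G x X)"
  using entangling_gate_unitary[OF G, of x] hermitian_conj unitary_groupD(1) by metis

lemma hermitian_circ: "l \<le> L \<Longrightarrow> \<omega> \<in> space P \<Longrightarrow> hermitian_mat (circ l \<omega>)"
proof (induction l)
  case 0
  then show ?case
    using hermitian_conj[OF unitary_groupD(1)[OF layer_unitary[of 1]] \<rho>] by (simp add: local_layer_def)
next
  case (Suc l)
  then have "hermitian_mat (entangling_gate G (\<phi> (l + 1) \<omega>) (circ l \<omega>))"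
    by (intro hermitian_gate circ_carrier) auto
  then show ?case
    using hermitian_conj[OF unitary_groupD(1)[OF layer_unitary[of "l + 2"]] gate_carrier[OF circ_carrier]] Suc.prems
    by (simp add: local_layer_def)
qed

lemma layer_expand:
  assumes "l \<in> {1..L + 1}" "\<omega> \<in> space P" "X \<in> carrier_mat D D" "\<alpha> \<in> tensor_index ds"
  shows "mat_trace (tensor_mats \<alpha> * local_layer (length ds) (\<lambda>m. U l m \<omega>) X) =
    (\<Sum>\<beta>\<in>tensor_index ds. mat_trace (tensor_mats \<beta> * X) * layer_coeff l \<alpha> \<beta> \<omega>)"
  unfolding layer_coeff_def local_layer_def
  by (rule mat_trace_conj_expand[OF unitary_groupD(1)[OF layer_unitary[OF assms(1,2)]] assms(3) tensor_index_carrier[OF assms(4)]])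

lemma gate_expand:
  assumes X: "X \<in> carrier_mat D D" and \<alpha>: "\<alpha> \<in> tensor_index ds"
  shows "mat_trace (tensor_mats \<alpha> * entangling_gate G x X) =
    (\<Sum>\<beta>\<in>tensor_index ds. mat_trace (tensor_mats \<beta> * X) * gate_coeff \<alpha> \<beta> x)"
proof -
  obtain E where E: "E \<in> unitary_group D" "\<And>X. entangling_gate G x X = E * X * mat_adjoint E"
    using entangling_gate_unitary[OF G] by blast
  show ?thesis
    unfolding gate_coeff_def E(2)
    by (rule mat_trace_conj_expand[OF unitary_groupD(1)[OF E(1)] X tensor_index_carrier[OF \<alpha>]])
qed

lemma circ_coeff_0:
  assumes "\<omega> \<in> space P" "\<alpha> \<in> tensor_index ds"
  shows "circ_coeff 0 \<alpha> \<omega> = (\<Sum>\<beta>\<in>tensor_index ds. mat_trace (tensor_mats \<beta> * \<rho>) * layer_coeff 1 \<alpha> \<beta> \<omega>)"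
  unfolding circ_coeff_def using layer_expand[OF _ assms(1) \<rho>(1) assms(2), of 1] by simp

text \<open>Index shift: \<open>circuit\<close> at \<open>l\<close> has passed local layers 1 to
  \<open>l + 1\<close> and gates 1 to \<open>l\<close>, so gate \<open>l + 1\<close> and local layer
  \<open>l + 2\<close> come next.\<close>

lemma circ_coeff_Suc:
  assumes "Suc l \<le> L" "\<omega> \<in> space P" "\<alpha> \<in> tensor_index ds"
  shows "circ_coeff (Suc l) \<alpha> \<omega> = (\<Sum>\<gamma>\<in>tensor_index ds. \<Sum>\<beta>\<in>tensor_index ds.
    circ_coeff l \<beta> \<omega> * (gate_coeff \<gamma> \<beta> (\<phi> (l + 1) \<omega>) * layer_coeff (l + 2) \<alpha> \<gamma> \<omega>))"
proof -
  note c = circ_carrier[of l \<omega>]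
  have "circ_coeff (Suc l) \<alpha> \<omega> = (\<Sum>\<gamma>\<in>tensor_index ds.
      mat_trace (tensor_mats \<gamma> * entangling_gate G (\<phi> (l + 1) \<omega>) (circ l \<omega>)) * layer_coeff (l + 2) \<alpha> \<gamma> \<omega>)"
    unfolding circ_coeff_def circuit.simps
    by (rule layer_expand) (use assms gate_carrier[OF c] in auto)
  also have "\<dots> = (\<Sum>\<gamma>\<in>tensor_index ds. \<Sum>\<beta>\<in>tensor_index ds.
    circ_coeff l \<beta> \<omega> * (gate_coeff \<gamma> \<beta> (\<phi> (l + 1) \<omega>) * layer_coeff (l + 2) \<alpha> \<gamma> \<omega>))"
    by (intro sum.cong refl, subst gate_expand) (use assms c in \<open>auto simp: sum_distrib_right circ_coeff_def mult.assoc\<close>)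
  finally show ?thesis .
qed

lemma layer_coeff_prod:
  assumes "l \<in> {1..L + 1}" "\<omega> \<in> space P" "\<alpha> \<in> tensor_index ds" "\<beta> \<in> tensor_index ds"
  shows "layer_coeff l \<alpha> \<beta> \<omega> = (\<Prod>m<length ds. mat_trace (\<alpha> ! m * (U l m \<omega> * \<beta> ! m * mat_adjoint (U l m \<omega>))))"
  unfolding layer_coeff_def
  by (rule local_layer_overlap) (use assms U_unitary in \<open>auto simp: layer_index_def\<close>)

lemma bdd_measurable_block_overlap:
  assumes "m < length ds" "\<alpha> \<in> tensor_index ds" "\<beta> \<in> tensor_index ds"
  shows "bdd_measurable (unitary_borel (ds ! m)) (\<lambda>V. mat_trace (\<alpha> ! m * (V * \<beta> ! m * mat_adjoint V)))"
proof -
  have c: "\<alpha> ! m \<in> carrier_mat (ds ! m) (ds ! m)" "\<beta> ! m \<in> carrier_mat (ds ! m) (ds ! m)"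
    using assms tensor_index_squareD by (auto simp: list_all2_conv_all_nth)
  show ?thesis
    by (rule bdd_measurable_trace[OF c(1)]) (use c mat_conj_carrier in \<open>auto intro: bdd_measurable_conj_entry\<close>)
qed

lemma bdd_measurable_layer_coeff:
  assumes "l \<in> {1..L + 1}" "\<alpha> \<in> tensor_index ds" "\<beta> \<in> tensor_index ds"
  shows "bdd_measurable P (layer_coeff l \<alpha> \<beta>)"
proof -
  have "bdd_measurable P (\<lambda>\<omega>. \<Prod>m<length ds. mat_trace (\<alpha> ! m * (U l m \<omega> * \<beta> ! m * mat_adjoint (U l m \<omega>))))"
    by (rule bdd_measurable_prod, rule bdd_measurable_compose[OF bdd_measurable_block_overlap U_measurable])
      (use assms in \<open>auto simp: layer_index_def\<close>)
  then show ?thesis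
    by (rule iffD1[OF bdd_measurable_cong, rotated]) (rule layer_coeff_prod[symmetric, OF assms(1) _ assms(2,3)])
qed

lemma bdd_measurable_gate_coeff:
  "\<alpha> \<in> tensor_index ds \<Longrightarrow> \<beta> \<in> tensor_index ds \<Longrightarrow> bdd_measurable borel (gate_coeff \<alpha> \<beta>)"
  unfolding gate_coeff_def[abs_def]
  by (rule bdd_measurable_entangling_gate[OF G tensor_index_carrier tensor_index_carrier])

lemma bdd_measurable_circ_coeff:
  "l \<le> L \<Longrightarrow> \<alpha> \<in> tensor_index ds \<Longrightarrow> bdd_measurable P (circ_coeff l \<alpha>)"
proof (induction l arbitrary: \<alpha>)
  case 0
  have "bdd_measurable P (\<lambda>\<omega>. \<Sum>\<beta>\<in>tensor_index ds. mat_trace (tensor_mats \<beta> * \<rho>) * layer_coeff 1 \<alpha> \<beta> \<omega>)"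
    by (intro bdd_measurable_sum bdd_measurable_mult bdd_measurable_const bdd_measurable_layer_coeff) (use 0 in auto)
  then show ?case by (rule iffD1[OF bdd_measurable_cong, rotated]) (simp add: circ_coeff_0 0)
next
  case (Suc l)
  have "bdd_measurable P (\<lambda>\<omega>. \<Sum>\<gamma>\<in>tensor_index ds. \<Sum>\<beta>\<in>tensor_index ds.
    circ_coeff l \<beta> \<omega> * (gate_coeff \<gamma> \<beta> (\<phi> (l + 1) \<omega>) * layer_coeff (l + 2) \<alpha> \<gamma> \<omega>))"
    by (intro bdd_measurable_sum bdd_measurable_mult Suc.IH bdd_measurable_layer_coeff
        bdd_measurable_compose[OF bdd_measurable_gate_coeff \<phi>_measurable])
      (use Suc.prems in auto)
  then show ?case by (rule iffD1[OF bdd_measurable_cong, rotated]) (simp add: circ_coeff_Suc Suc.prems)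
qed

text \<open>Absorbs two coefficients of local layer \<open>l\<close> into the test functions, block
  by block. It is applied where \<open>f l\<close> is still constantly 1, so that nothing is
  overwritten.\<close>

definition with_layer where
  "with_layer f l \<alpha> \<beta> \<alpha>' \<beta>' = (\<lambda>l' m. if l' = l
     then (\<lambda>V. mat_trace (\<alpha> ! m * (V * \<beta> ! m * mat_adjoint V)) * mat_trace (\<alpha>' ! m * (V * \<beta>' ! m * mat_adjoint V)))
     else f l' m)"

lemma prod_I_split:
  fixes h :: "nat \<Rightarrow> nat \<Rightarrow> complex"
  assumes "l \<in> {1..L + 1}"
  shows "(\<Prod>(l', m)\<in>I. h l' m) = (\<Prod>m<length ds. h l m) * (\<Prod>l'\<in>{1..L + 1} - {l}. \<Prod>m<length ds. h l' m)"
proof -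
  have "(\<Prod>(l', m)\<in>I. h l' m) = (\<Prod>l'\<in>{1..L + 1}. \<Prod>m<length ds. h l' m)"
    by (simp add: layer_index_def prod.cartesian_product)
  then show ?thesis unfolding prod.remove[OF finite_atLeastAtMost assms] .
qed

context
  fixes l \<alpha> \<beta> \<alpha>' \<beta>' f g
  assumes l: "l \<in> {1..L + 1}"
    and idx: "\<alpha> \<in> tensor_index ds" "\<beta> \<in> tensor_index ds" "\<alpha>' \<in> tensor_index ds" "\<beta>' \<in> tensor_index ds"
    and fg: "test_fun f g" and triv: "\<And>m. f l m = (\<lambda>_. 1)"
begin

lemma test_fun_with_layer: "test_fun (with_layer f l \<alpha> \<beta> \<alpha>' \<beta>') g"
  using fg idx unfolding test_fun_def with_layer_def
  by (auto simp: layer_index_def intro!: bdd_measurable_mult bdd_measurable_block_overlap)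

lemma rprod_with_layer:
  "\<omega> \<in> space P \<Longrightarrow> rprod (with_layer f l \<alpha> \<beta> \<alpha>' \<beta>') g \<omega> = layer_coeff l \<alpha> \<beta> \<omega> * layer_coeff l \<alpha>' \<beta>' \<omega> * rprod f g \<omega>"
  unfolding rprod_def prod_I_split[OF l] layer_coeff_prod[OF l _ idx(1,2)] layer_coeff_prod[OF l _ idx(3,4)]
  by (simp add: with_layer_def triv prod.distrib)

text \<open>Each block contributes the twirl of its design, and the blocks multiply by
  \<open>prod_design_coeff\<close>. The deltas arising here remove the cross terms between different
  basis tensors.\<close>

lemma eprod_with_layer:
  "eprod (with_layer f l \<alpha> \<beta> \<alpha>' \<beta>') g =
    (if \<alpha> = \<alpha>' \<and> \<beta> = \<beta>' \<and> pattern ds \<alpha> = pattern ds \<beta>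
     then complex_of_real (1 / real (card (sector_index ds (pattern ds \<alpha>)))) else 0) * eprod f g"
proof -
  have tw: "expectation (\<lambda>\<omega>. mat_trace (\<alpha> ! m * (U l m \<omega> * \<beta> ! m * mat_adjoint (U l m \<omega>))) *
      mat_trace (\<alpha>' ! m * (U l m \<omega> * \<beta>' ! m * mat_adjoint (U l m \<omega>)))) =
      (if \<alpha> ! m = \<alpha>' ! m \<and> \<beta> ! m = \<beta>' ! m then complex_of_real (design_coeff (ds ! m) (\<alpha> ! m) (\<beta> ! m)) else 0)"
    if m: "m < length ds" for m
  proof -
    have lm: "(l, m) \<in> I" using l m by (simp add: layer_index_def)
    have "expectation (\<lambda>\<omega>. mat_trace (\<alpha> ! m * (U l m \<omega> * \<beta> ! m * mat_adjoint (U l m \<omega>))) *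
      mat_trace (\<alpha>' ! m * (U l m \<omega> * \<beta>' ! m * mat_adjoint (U l m \<omega>)))) =
      twirl (distr P (unitary_borel (ds ! m)) (U l m)) (\<alpha> ! m) (\<alpha>' ! m) (\<beta> ! m) (\<beta>' ! m)"
      unfolding twirl_def
      by (rule integral_distr[symmetric, OF U_measurable[OF lm]])
        (use bdd_measurable_mult[OF bdd_measurable_block_overlap[OF m idx(1,2)] bdd_measurable_block_overlap[OF m idx(3,4)]]
          in \<open>simp add: bdd_measurable_def\<close>)
    then show ?thesis
      using design_twirl_onb[of "ds ! m" "distr P (unitary_borel (ds ! m)) (U l m)" "\<alpha> ! m" "\<alpha>' ! m" "\<beta> ! m" "\<beta>' ! m"]
        U_design[OF lm] qubit_blocks[OF nth_mem[OF m]] tensor_index_nth[OF _ m] idx by simp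
  qed
  have "(\<Prod>m<length ds. if \<alpha> ! m = \<alpha>' ! m \<and> \<beta> ! m = \<beta>' ! m then complex_of_real (design_coeff (ds ! m) (\<alpha> ! m) (\<beta> ! m)) else 0)
    = (if \<alpha> = \<alpha>' \<and> \<beta> = \<beta>' \<and> pattern ds \<alpha> = pattern ds \<beta>
     then complex_of_real (1 / real (card (sector_index ds (pattern ds \<alpha>)))) else 0)"
  proof (cases "\<alpha> = \<alpha>' \<and> \<beta> = \<beta>'")
    case True
    then show ?thesis
      using prod_design_coeff[OF idx(1,2)] by (simp add: of_real_prod[symmetric] del: of_real_prod of_real_divide)
  next
    case False
    then obtain m where "m < length ds" "\<not> (\<alpha> ! m = \<alpha>' ! m \<and> \<beta> ! m = \<beta>' ! m)"
      using nth_equalityI[of \<alpha> \<alpha>'] nth_equalityI[of \<beta> \<beta>'] tensor_index_length idx by metis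
    then have "(\<Prod>m<length ds. if \<alpha> ! m = \<alpha>' ! m \<and> \<beta> ! m = \<beta>' ! m then complex_of_real (design_coeff (ds ! m) (\<alpha> ! m) (\<beta> ! m)) else 0) = 0"
      by (intro prod_zero) auto
    then show ?thesis using False by auto
  qed
  then show ?thesis
    unfolding eprod_def prod_I_split[OF l] by (simp add: with_layer_def triv tw prob_space)
qed

end

definition with_gate where
  "with_gate g l \<gamma> \<beta> \<gamma>' \<beta>' = g(l := \<lambda>x. gate_coeff \<gamma> \<beta> x * gate_coeff \<gamma>' \<beta>' x)"

context
  fixes l \<gamma> \<beta> \<gamma>' \<beta>' f g
  assumes l: "l \<in> {1..L}"
    and idx: "\<gamma> \<in> tensor_index ds" "\<beta> \<in> tensor_index ds" "\<gamma>' \<in> tensor_index ds" "\<beta>' \<in> tensor_index ds"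
    and fg: "test_fun f g" and triv: "g l = (\<lambda>_. 1)"
begin

lemma test_fun_with_gate: "test_fun f (with_gate g l \<gamma> \<beta> \<gamma>' \<beta>')"
  using fg idx unfolding test_fun_def with_gate_def
  by (auto intro!: bdd_measurable_mult bdd_measurable_gate_coeff)

lemma rprod_with_gate:
  "rprod f (with_gate g l \<gamma> \<beta> \<gamma>' \<beta>') \<omega> = gate_coeff \<gamma> \<beta> (\<phi> l \<omega>) * gate_coeff \<gamma>' \<beta>' (\<phi> l \<omega>) * rprod f g \<omega>"
  unfolding rprod_def prod.remove[OF finite_atLeastAtMost l]
  by (simp add: with_gate_def triv)

text \<open>In contrast to a local layer, a gate produces no deltas: its mixed moments stay as
  integrals.\<close>

lemma eprod_with_gate:
  "eprod f (with_gate g l \<gamma> \<beta> \<gamma>' \<beta>') = (\<integral>x. gate_coeff \<gamma> \<beta> x * gate_coeff \<gamma>' \<beta>' x \<partial>\<nu>) * eprod f g"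
proof -
  interpret \<nu>: prob_space \<nu> by (rule \<nu>)
  show ?thesis
    unfolding eprod_def prod.remove[OF finite_atLeastAtMost l]
    by (simp add: with_gate_def triv \<nu>.prob_space)
qed

end

section \<open>Second moments of gate coefficients\<close>

lemma gate_coeff_real:
  assumes "\<alpha> \<in> tensor_index ds" "\<beta> \<in> tensor_index ds"
  shows "gate_coeff \<alpha> \<beta> x = complex_of_real (Re (gate_coeff \<alpha> \<beta> x))"
proof -
  have "cnj (gate_coeff \<alpha> \<beta> x) = gate_coeff \<alpha> \<beta> x"
    unfolding gate_coeff_def
    by (rule cnj_mat_trace_hermitian)
      (use assms tensor_index_carrier tensor_hermitian gate_carrier hermitian_gate in auto)
  then show ?thesis by (simp add: complex_eq_iff)
qed

definition gate_moment where
  "gate_moment \<gamma> \<beta> = (\<integral>x. (Re (gate_coeff \<gamma> \<beta> x))\<^sup>2 \<partial>\<nu>)"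

lemma gate_moment_nonneg: "0 \<le> gate_moment \<gamma> \<beta>"
  unfolding gate_moment_def by (rule integral_nonneg_AE) simp

lemma gate_moment_eq:
  "\<gamma> \<in> tensor_index ds \<Longrightarrow> \<beta> \<in> tensor_index ds \<Longrightarrow>
    (\<integral>x. gate_coeff \<gamma> \<beta> x * gate_coeff \<gamma> \<beta> x \<partial>\<nu>) = complex_of_real (gate_moment \<gamma> \<beta>)"
  unfolding gate_moment_def integral_complex_of_real[symmetric]
  by (rule Bochner_Integration.integral_cong[OF refl]) (subst (1 2) gate_coeff_real, auto simp: power2_eq_square)

text \<open>The cut-off keeps all powers nonnegative; the comparison with a gate moment survives it
  because that moment is nonnegative.\<close>

definition decay :: real where
  "decay = max 0 (1 - 2 * (\<sigma>\<^sup>2 * (hs_norm G)\<^sup>2))"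

lemma gate_moment_diag:
  assumes \<gamma>: "\<gamma> \<in> tensor_index ds"
  shows "decay \<le> gate_moment \<gamma> \<gamma>"
proof -
  interpret \<nu>: prob_space \<nu> by (rule \<nu>)
  have b: "bdd_measurable \<nu> (gate_coeff \<gamma> \<gamma>)"
    unfolding bdd_measurable_cong_sets[OF \<nu>(2)] by (rule bdd_measurable_gate_coeff[OF \<gamma> \<gamma>])
  have "integrable \<nu> (\<lambda>x. Re (gate_coeff \<gamma> \<gamma> x * gate_coeff \<gamma> \<gamma> x))"
    by (intro integrable_Re \<nu>.bdd_measurable_integrable bdd_measurable_mult b)
  moreover have "Re (gate_coeff \<gamma> \<gamma> x * gate_coeff \<gamma> \<gamma> x) = (Re (gate_coeff \<gamma> \<gamma> x))\<^sup>2" for x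
    by (subst (1 2) gate_coeff_real[OF \<gamma> \<gamma>]) (simp add: power2_eq_square)
  ultimately have int: "integrable \<nu> (\<lambda>x. (Re (gate_coeff \<gamma> \<gamma> x))\<^sup>2)" by simp
  have "(\<integral>x. 1 - 2 * (hs_norm G)\<^sup>2 * x\<^sup>2 \<partial>\<nu>) \<le> (\<integral>x. (Re (gate_coeff \<gamma> \<gamma> x))\<^sup>2 \<partial>\<nu>)"
  proof (rule integral_mono[OF _ int])
    show "integrable \<nu> (\<lambda>x. 1 - 2 * (hs_norm G)\<^sup>2 * x\<^sup>2)" using \<nu>(3) by simp
    fix x
    have "1 - x\<^sup>2 * (hs_norm G)\<^sup>2 \<le> Re (gate_coeff \<gamma> \<gamma> x)"
      unfolding gate_coeff_def
      by (rule entangling_gate_overlap[OF G tensor_index_carrier[OF \<gamma>] tensor_hermitian[OF \<gamma>]])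
        (simp add: tensor_orthonormal[OF \<gamma> \<gamma>])
    \<comment> \<open>The tangent of the square at 1. It avoids squaring the overlap bound, which
      may be negative and would bring in the fourth moment of \<open>x\<close>.\<close>
    moreover have "2 * Re (gate_coeff \<gamma> \<gamma> x) - 1 \<le> (Re (gate_coeff \<gamma> \<gamma> x))\<^sup>2"
      using zero_le_power2[of "Re (gate_coeff \<gamma> \<gamma> x) - 1"] by (simp add: power2_eq_square algebra_simps)
    ultimately show "1 - 2 * (hs_norm G)\<^sup>2 * x\<^sup>2 \<le> (Re (gate_coeff \<gamma> \<gamma> x))\<^sup>2"
      by (simp add: algebra_simps)
  qed
  also have "(\<integral>x. 1 - 2 * (hs_norm G)\<^sup>2 * x\<^sup>2 \<partial>\<nu>) = 1 - 2 * (\<sigma>\<^sup>2 * (hs_norm G)\<^sup>2)"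
    using \<nu>(3,4) by (simp add: \<nu>.prob_space)
  finally show ?thesis
    using gate_moment_nonneg unfolding decay_def gate_moment_def by auto
qed

end

section \<open>Locality vectors of Hermitian operators\<close>

lemma (in qubit_blocks) trace_tensor_real:
  assumes "\<alpha> \<in> tensor_index ds" "X \<in> carrier_mat D D" "hermitian_mat X"
  shows "mat_trace (tensor_mats \<alpha> * X) = complex_of_real (Re (mat_trace (tensor_mats \<alpha> * X)))"
  using cnj_mat_trace_hermitian[OF tensor_index_carrier[OF assms(1)] assms(2) tensor_hermitian[OF assms(1)] assms(3)]
  by (simp add: complex_eq_iff)

lemma (in qubit_blocks) locality_hermitian:
  assumes l: "length \<kappa> = length ds" and X: "X \<in> carrier_mat D D" "hermitian_mat X"
  shows "locality ds X \<kappa> = (\<Sum>\<alpha>\<in>sector_index ds \<kappa>. (Re (mat_trace (tensor_mats \<alpha> * X)))\<^sup>2)"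
  unfolding locality_eq[OF l X(1)] Re_sum
proof (intro sum.cong refl)
  fix \<alpha> assume "\<alpha> \<in> sector_index ds \<kappa>"
  then have "\<alpha> \<in> tensor_index ds" using sector_index_subset by auto
  from trace_tensor_real[OF this X]
  show "Re ((mat_trace (tensor_mats \<alpha> * X))\<^sup>2) = (Re (mat_trace (tensor_mats \<alpha> * X)))\<^sup>2"
    by (metis Re_complex_of_real of_real_power)
qed

lemma (in qubit_blocks) locality_nonneg:
  assumes "length \<kappa> = length ds" "X \<in> carrier_mat D D" "hermitian_mat X"
  shows "0 \<le> locality ds X \<kappa>"
  unfolding locality_hermitian[OF assms] by (intro sum_nonneg) simp

lemma (in qubit_blocks) sum_pattern:
  "(\<Sum>\<beta>\<in>tensor_index ds. if \<kappa> = pattern ds \<beta> then h \<beta> else 0) = (\<Sum>\<beta>\<in>sector_index ds \<kappa>. h \<beta> :: 'c :: comm_monoid_add)"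
  unfolding sector_index_def by (rule sum.mono_neutral_cong_right) auto

context layered_circuit
begin

text \<open>The mean squared coordinate of \<open>\<rho>\<close> over a sector, hence the second
  moment of each coordinate in that sector once the first local layer has been applied.\<close>

definition weight :: "bool list \<Rightarrow> real" where
  "weight \<kappa> = locality ds \<rho> \<kappa> / real (card (sector_index ds \<kappa>))"

lemma weight_nonneg: "length \<kappa> = length ds \<Longrightarrow> 0 \<le> weight \<kappa>"
  unfolding weight_def using locality_nonneg[OF _ \<rho>] by simp

lemma decay_nonneg: "0 \<le> decay"
  by (simp add: decay_def)

lemma expectation_double_sum:
  assumes "finite S" "\<And>p q. p \<in> S \<Longrightarrow> q \<in> S \<Longrightarrow> bdd_measurable P (h p q)"
  shows "expectation (\<lambda>\<omega>. \<Sum>p\<in>S. \<Sum>q\<in>S. h p q \<omega>) = (\<Sum>p\<in>S. \<Sum>q\<in>S. expectation (h p q))"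
  by (intro trans[OF Bochner_Integration.integral_sum] sum.cong refl
      Bochner_Integration.integrable_sum bdd_measurable_integrable assms(2)) auto

text \<open>The first local layer by itself makes the second moments diagonal and constant on each
  sector; this starts the induction.\<close>

lemma circ_second_moment_0:
  assumes \<alpha>: "\<alpha> \<in> tensor_index ds" "\<alpha>' \<in> tensor_index ds" and fg: "test_fun f g"
    and triv: "\<And>m. f 1 m = (\<lambda>_. 1)"
  shows "expectation (\<lambda>\<omega>. circ_coeff 0 \<alpha> \<omega> * circ_coeff 0 \<alpha>' \<omega> * rprod f g \<omega>) =
    (if \<alpha> = \<alpha>' then complex_of_real (weight (pattern ds \<alpha>)) else 0) * eprod f g"
proof -
  let ?T = "tensor_index ds"
  define r where "r \<beta> = mat_trace (tensor_mats \<beta> * \<rho>)" for \<beta>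
  let ?f = "\<lambda>\<beta> \<beta>'. with_layer f 1 \<alpha> \<beta> \<alpha>' \<beta>'"
  have l1: "1 \<in> {1..L + 1}" by simp
  note tf = test_fun_with_layer[OF l1 \<alpha>(1) _ \<alpha>(2) _ fg triv]
  have "expectation (\<lambda>\<omega>. circ_coeff 0 \<alpha> \<omega> * circ_coeff 0 \<alpha>' \<omega> * rprod f g \<omega>) =
      expectation (\<lambda>\<omega>. \<Sum>\<beta>\<in>?T. \<Sum>\<beta>'\<in>?T. r \<beta> * r \<beta>' * rprod (?f \<beta> \<beta>') g \<omega>)"
  proof (rule Bochner_Integration.integral_cong[OF refl])
    fix \<omega> assume \<omega>: "\<omega> \<in> space P"
    show "circ_coeff 0 \<alpha> \<omega> * circ_coeff 0 \<alpha>' \<omega> * rprod f g \<omega> =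
      (\<Sum>\<beta>\<in>?T. \<Sum>\<beta>'\<in>?T. r \<beta> * r \<beta>' * rprod (?f \<beta> \<beta>') g \<omega>)"
      unfolding circ_coeff_0[OF \<omega> \<alpha>(1)] circ_coeff_0[OF \<omega> \<alpha>(2)] r_def[symmetric]
      unfolding sum_product unfolding sum_distrib_right
    proof (intro sum.cong refl)
      fix \<beta> \<beta>' assume \<beta>: "\<beta> \<in> ?T" "\<beta>' \<in> ?T"
      show "r \<beta> * layer_coeff 1 \<alpha> \<beta> \<omega> * (r \<beta>' * layer_coeff 1 \<alpha>' \<beta>' \<omega>) * rprod f g \<omega> =
        r \<beta> * r \<beta>' * rprod (?f \<beta> \<beta>') g \<omega>"
        unfolding rprod_with_layer[OF l1 \<alpha>(1) \<beta>(1) \<alpha>(2) \<beta>(2) fg triv \<omega>] by (simp only: mult_ac)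
    qed
  qed
  also have "\<dots> = (\<Sum>\<beta>\<in>?T. \<Sum>\<beta>'\<in>?T. expectation (\<lambda>\<omega>. r \<beta> * r \<beta>' * rprod (?f \<beta> \<beta>') g \<omega>))"
    by (rule expectation_double_sum, simp, intro bdd_measurable_mult bdd_measurable_const bdd_measurable_rprod tf)
  also have "\<dots> = (\<Sum>\<beta>\<in>?T. \<Sum>\<beta>'\<in>?T. if \<beta> = \<beta>' then (if \<alpha> = \<alpha>' then if pattern ds \<alpha> = pattern ds \<beta> then
      (r \<beta>)\<^sup>2 * complex_of_real (1 / real (card (sector_index ds (pattern ds \<alpha>)))) * eprod f g else 0 else 0) else 0)"
  proof (intro sum.cong refl)
    fix \<beta> \<beta>' assume \<beta>: "\<beta> \<in> ?T" "\<beta>' \<in> ?T"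
    have "expectation (\<lambda>\<omega>. r \<beta> * r \<beta>' * rprod (?f \<beta> \<beta>') g \<omega>) = r \<beta> * r \<beta>' * eprod (?f \<beta> \<beta>') g"
      using expectation_rprod[OF tf[OF \<beta>]] by simp
    then show "expectation (\<lambda>\<omega>. r \<beta> * r \<beta>' * rprod (?f \<beta> \<beta>') g \<omega>) =
      (if \<beta> = \<beta>' then (if \<alpha> = \<alpha>' then if pattern ds \<alpha> = pattern ds \<beta> then
      (r \<beta>)\<^sup>2 * complex_of_real (1 / real (card (sector_index ds (pattern ds \<alpha>)))) * eprod f g else 0 else 0) else 0)"
      unfolding eprod_with_layer[OF l1 \<alpha>(1) \<beta>(1) \<alpha>(2) \<beta>(2) fg triv] by (auto simp: power2_eq_square)
  qed
  also have "\<dots> = (if \<alpha> = \<alpha>' then (\<Sum>\<beta>\<in>sector_index ds (pattern ds \<alpha>). 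
      (r \<beta>)\<^sup>2 * complex_of_real (1 / real (card (sector_index ds (pattern ds \<alpha>)))) * eprod f g) else 0)"
    by (auto simp: sum_pattern)
  also have "(\<Sum>\<beta>\<in>sector_index ds (pattern ds \<alpha>). 
      (r \<beta>)\<^sup>2 * complex_of_real (1 / real (card (sector_index ds (pattern ds \<alpha>)))) * eprod f g) =
      complex_of_real (weight (pattern ds \<alpha>)) * eprod f g"
  proof -
    have "(r \<beta>)\<^sup>2 = complex_of_real ((Re (mat_trace (tensor_mats \<beta> * \<rho>)))\<^sup>2)" if "\<beta> \<in> sector_index ds (pattern ds \<alpha>)" for \<beta>
      unfolding r_def using trace_tensor_real[OF _ \<rho>] that sector_index_subset by (metis of_real_power subsetD)
    then show ?thesis
      unfolding weight_def locality_hermitian[OF pattern_length[OF \<alpha>(1)] \<rho>]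
      by (simp add: sum_distrib_right[symmetric] sum_divide_distrib[symmetric])
  qed
  finally show ?thesis by simp
qed

text \<open>The induction invariant. The extra factor \<open>rprod f g\<close> ranges over functions
  of what has not been passed yet, namely local layers beyond \<open>l + 1\<close> and gates beyond
  \<open>l\<close>; without it the coefficients of the next gate and layer could not be separated
  from the state before them.\<close>

definition moment_diag :: "nat \<Rightarrow> (complex mat list \<Rightarrow> real) \<Rightarrow> bool" where
  "moment_diag l q \<longleftrightarrow> (\<forall>\<alpha>\<in>tensor_index ds. \<forall>\<alpha>'\<in>tensor_index ds. \<forall>f g. test_fun f g \<longrightarrow>
     (\<forall>l'\<le>l + 1. \<forall>m. f l' m = (\<lambda>_. 1)) \<longrightarrow> (\<forall>l'\<le>l. g l' = (\<lambda>_. 1)) \<longrightarrow>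
     expectation (\<lambda>\<omega>. circ_coeff l \<alpha> \<omega> * circ_coeff l \<alpha>' \<omega> * rprod f g \<omega>) =
     (if \<alpha> = \<alpha>' then complex_of_real (q \<alpha>) else 0) * eprod f g)"

text \<open>The update of the diagonal: \<open>gate_moment\<close> acts first, then the local layer
  averages over the sector of \<open>\<alpha>\<close>. Pairs are summed jointly to match the terms
  of \<open>circ_coeff_Suc\<close>.\<close>

definition step :: "(complex mat list \<Rightarrow> real) \<Rightarrow> complex mat list \<Rightarrow> real" where
  "step q \<alpha> = (\<Sum>(\<gamma>, \<beta>)\<in>tensor_index ds \<times> tensor_index ds. if pattern ds \<alpha> = pattern ds \<gamma>
     then q \<beta> * (1 / real (card (sector_index ds (pattern ds \<alpha>)))) * gate_moment \<gamma> \<beta> else 0)"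

text \<open>The square of the recursion runs over pairs \<open>(\<gamma>, \<beta>)\<close> and
  \<open>(\<gamma>', \<beta>')\<close>. The induction hypothesis leaves
  \<open>\<beta> = \<beta>'\<close>, the new local layer leaves \<open>\<gamma> = \<gamma>'\<close>
  and \<open>\<alpha> = \<alpha>'\<close>, and the surviving gate integral is a mean of
  squares.\<close>

lemma moment_diag_step:
  assumes IH: "moment_diag l q" and l: "Suc l \<le> L"
  shows "moment_diag (Suc l) (step q)"
  unfolding moment_diag_def
proof (intro ballI allI impI)
  fix \<alpha> \<alpha>' f g
  assume \<alpha>: "\<alpha> \<in> tensor_index ds" "\<alpha>' \<in> tensor_index ds" and fg: "test_fun f g"
    and f1: "\<forall>l'\<le>Suc l + 1. \<forall>m. f l' m = (\<lambda>_. 1)" and g1: "\<forall>l'\<le>Suc l. g l' = (\<lambda>_. 1)"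
  let ?T = "tensor_index ds"
  let ?S = "?T \<times> ?T"
  define A where "A \<alpha> p \<omega> = (case p of (\<gamma>, \<beta>) \<Rightarrow> circ_coeff l \<beta> \<omega> * (gate_coeff \<gamma> \<beta> (\<phi> (l + 1) \<omega>) * layer_coeff (l + 2) \<alpha> \<gamma> \<omega>))"
    for \<alpha> p \<omega>
  have ll: "l + 2 \<in> {1..L + 1}" "l + 1 \<in> {1..L}" using l by auto
  have triv: "f (l + 2) m = (\<lambda>_. 1)" "g (l + 1) = (\<lambda>_. 1)" for m using f1 g1 by auto
  have cS: "circ_coeff (Suc l) \<alpha> \<omega> = (\<Sum>p\<in>?S. A \<alpha> p \<omega>)" if "\<omega> \<in> space P" "\<alpha> \<in> ?T" for \<omega> \<alpha>
    unfolding circ_coeff_Suc[OF l that] by (simp add: sum.cartesian_product A_def)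
  let ?c = "complex_of_real (1 / real (card (sector_index ds (pattern ds \<alpha>))))"
  have term_eq: "bdd_measurable P (\<lambda>\<omega>. A \<alpha> p \<omega> * A \<alpha>' p' \<omega> * rprod f g \<omega>) \<and>
      expectation (\<lambda>\<omega>. A \<alpha> p \<omega> * A \<alpha>' p' \<omega> * rprod f g \<omega>) =
      (if p = p' then (if \<alpha> = \<alpha>' then (case p of (\<gamma>, \<beta>) \<Rightarrow> if pattern ds \<alpha> = pattern ds \<gamma> then
         complex_of_real (q \<beta>) * ?c * complex_of_real (gate_moment \<gamma> \<beta>) else 0) else 0) else 0) * eprod f g"
    if pp: "p \<in> ?S" "p' \<in> ?S" for p p'
  proof -
    obtain \<gamma> \<beta> \<gamma>' \<beta>' where p: "p = (\<gamma>, \<beta>)" "p' = (\<gamma>', \<beta>')" by (cases p, cases p')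
    have T: "\<gamma> \<in> ?T" "\<beta> \<in> ?T" "\<gamma>' \<in> ?T" "\<beta>' \<in> ?T" using pp p by auto
    \<comment> \<open>Gate \<open>l + 1\<close> and local layer \<open>l + 2\<close> move into the
      test functions. These remain trivial up to gate \<open>l\<close> and layer
      \<open>l + 1\<close>, as the hypothesis at \<open>l\<close> demands.\<close>
    let ?g = "with_gate g (l + 1) \<gamma> \<beta> \<gamma>' \<beta>'"
    let ?f = "with_layer f (l + 2) \<alpha> \<gamma> \<alpha>' \<gamma>'"
    have tg: "test_fun f ?g" by (rule test_fun_with_gate[OF ll(2) T fg triv(2)])
    have tfg: "test_fun ?f ?g" by (rule test_fun_with_layer[OF ll(1) \<alpha>(1) T(1) \<alpha>(2) T(3) tg triv(1)])
    have pt: "A \<alpha> p \<omega> * A \<alpha>' p' \<omega> * rprod f g \<omega> = circ_coeff l \<beta> \<omega> * circ_coeff l \<beta>' \<omega> * rprod ?f ?g \<omega>"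
      if \<omega>: "\<omega> \<in> space P" for \<omega>
      unfolding rprod_with_layer[OF ll(1) \<alpha>(1) T(1) \<alpha>(2) T(3) tg triv(1) \<omega>] rprod_with_gate[OF ll(2) T fg triv(2)]
      by (simp add: A_def p)
    have "bdd_measurable P (\<lambda>\<omega>. circ_coeff l \<beta> \<omega> * circ_coeff l \<beta>' \<omega> * rprod ?f ?g \<omega>)"
      using l T by (intro bdd_measurable_mult bdd_measurable_circ_coeff bdd_measurable_rprod[OF tfg]) auto
    then have bm: "bdd_measurable P (\<lambda>\<omega>. A \<alpha> p \<omega> * A \<alpha>' p' \<omega> * rprod f g \<omega>)"
      by (rule iffD1[OF bdd_measurable_cong, rotated]) (simp add: pt)
    have "expectation (\<lambda>\<omega>. A \<alpha> p \<omega> * A \<alpha>' p' \<omega> * rprod f g \<omega>) =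
        expectation (\<lambda>\<omega>. circ_coeff l \<beta> \<omega> * circ_coeff l \<beta>' \<omega> * rprod ?f ?g \<omega>)"
      by (rule Bochner_Integration.integral_cong[OF refl pt])
    also have "\<dots> = (if \<beta> = \<beta>' then complex_of_real (q \<beta>) else 0) * eprod ?f ?g"
    proof -
      have "\<forall>l'\<le>l + 1. \<forall>m. ?f l' m = (\<lambda>_. 1)" using f1 by (simp add: with_layer_def)
      moreover have "\<forall>l'\<le>l. ?g l' = (\<lambda>_. 1)" using g1 by (simp add: with_gate_def)
      ultimately show ?thesis using IH[unfolded moment_diag_def, rule_format, OF T(2,4) tfg] by blast
    qed
    also have "\<dots> = (if \<beta> = \<beta>' then complex_of_real (q \<beta>) else 0) *
        ((if \<alpha> = \<alpha>' \<and> \<gamma> = \<gamma>' \<and> pattern ds \<alpha> = pattern ds \<gamma> then ?c else 0) *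
        ((\<integral>x. gate_coeff \<gamma> \<beta> x * gate_coeff \<gamma>' \<beta>' x \<partial>\<nu>) * eprod f g))"
      unfolding eprod_with_layer[OF ll(1) \<alpha>(1) T(1) \<alpha>(2) T(3) tg triv(1)] eprod_with_gate[OF ll(2) T fg triv(2)] ..
    also have "\<dots> = (if p = p' then (if \<alpha> = \<alpha>' then (case p of (\<gamma>, \<beta>) \<Rightarrow> if pattern ds \<alpha> = pattern ds \<gamma> then
         complex_of_real (q \<beta>) * ?c * complex_of_real (gate_moment \<gamma> \<beta>) else 0) else 0) else 0) * eprod f g"
      using gate_moment_eq[OF T(1,2)] gate_moment_eq[OF T(3,4)] unfolding p by simp
    finally show ?thesis using bm by blast
  qed
  have "expectation (\<lambda>\<omega>. circ_coeff (Suc l) \<alpha> \<omega> * circ_coeff (Suc l) \<alpha>' \<omega> * rprod f g \<omega>) =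
      expectation (\<lambda>\<omega>. \<Sum>p\<in>?S. \<Sum>p'\<in>?S. A \<alpha> p \<omega> * A \<alpha>' p' \<omega> * rprod f g \<omega>)"
  proof (rule Bochner_Integration.integral_cong[OF refl])
    fix \<omega> assume \<omega>: "\<omega> \<in> space P"
    show "circ_coeff (Suc l) \<alpha> \<omega> * circ_coeff (Suc l) \<alpha>' \<omega> * rprod f g \<omega> =
      (\<Sum>p\<in>?S. \<Sum>p'\<in>?S. A \<alpha> p \<omega> * A \<alpha>' p' \<omega> * rprod f g \<omega>)"
      unfolding cS[OF \<omega> \<alpha>(1)] cS[OF \<omega> \<alpha>(2)] unfolding sum_product unfolding sum_distrib_right ..
  qed
  also have "\<dots> = (\<Sum>p\<in>?S. \<Sum>p'\<in>?S. expectation (\<lambda>\<omega>. A \<alpha> p \<omega> * A \<alpha>' p' \<omega> * rprod f g \<omega>))"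
    by (rule expectation_double_sum) (use term_eq in auto)
  also have "\<dots> = (\<Sum>p\<in>?S. \<Sum>p'\<in>?S. if p = p' then (if \<alpha> = \<alpha>' then (case p of (\<gamma>, \<beta>) \<Rightarrow> if pattern ds \<alpha> = pattern ds \<gamma> then
         complex_of_real (q \<beta>) * ?c * complex_of_real (gate_moment \<gamma> \<beta>) else 0) else 0) * eprod f g else 0)"
    using term_eq by (intro sum.cong refl) auto
  also have "\<dots> = (\<Sum>p\<in>?S. (if \<alpha> = \<alpha>' then (case p of (\<gamma>, \<beta>) \<Rightarrow> if pattern ds \<alpha> = pattern ds \<gamma> then
         complex_of_real (q \<beta>) * ?c * complex_of_real (gate_moment \<gamma> \<beta>) else 0) else 0) * eprod f g)"
    by (intro sum.cong refl) simp
  also have "\<dots> = (if \<alpha> = \<alpha>' then complex_of_real (step q \<alpha>) else 0) * eprod f g"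
    unfolding step_def sum_distrib_right[symmetric] of_real_sum
    by (auto intro!: sum.cong)
  finally show "expectation (\<lambda>\<omega>. circ_coeff (Suc l) \<alpha> \<omega> * circ_coeff (Suc l) \<alpha>' \<omega> * rprod f g \<omega>) =
    (if \<alpha> = \<alpha>' then complex_of_real (step q \<alpha>) else 0) * eprod f g" .
qed

text \<open>Only the summands with \<open>\<beta> = \<gamma>\<close> are kept. While
  \<open>\<gamma>\<close> runs through the sector of \<open>\<alpha>\<close> the weight does not
  change, so dividing by the cardinality averages a constant.\<close>

lemma step_lower_bound:
  assumes q: "\<And>\<beta>. \<beta> \<in> tensor_index ds \<Longrightarrow> decay ^ l * weight (pattern ds \<beta>) \<le> q \<beta>" and \<alpha>: "\<alpha> \<in> tensor_index ds"
  shows "decay ^ Suc l * weight (pattern ds \<alpha>) \<le> step q \<alpha>"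
proof -
  let ?T = "tensor_index ds" and ?S = "sector_index ds (pattern ds \<alpha>)"
  let ?c = "1 / real (card ?S)"
  \<comment> \<open>Nonnegativity of the dropped summands comes from the lower bound itself.\<close>
  have q0: "0 \<le> q \<beta>" if "\<beta> \<in> ?T" for \<beta>
    using q[OF that] weight_nonneg[OF pattern_length[OF that]] decay_nonneg
    by (meson mult_nonneg_nonneg order_trans zero_le_power)
  have mem: "\<alpha> \<in> ?S" using \<alpha> by (simp add: sector_index_def)
  then have card: "real (card ?S) > 0" using finite_sector_index card_gt_0_iff by fastforce
  have "decay ^ Suc l * weight (pattern ds \<alpha>) = (\<Sum>\<gamma>\<in>?S. ?c * (decay * (decay ^ l * weight (pattern ds \<alpha>))))"
    using mem by auto
  also have "\<dots> \<le> (\<Sum>\<gamma>\<in>?S. \<Sum>\<beta>\<in>?T. q \<beta> * ?c * gate_moment \<gamma> \<beta>)"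
  proof (rule sum_mono)
    fix \<gamma> assume \<gamma>: "\<gamma> \<in> ?S"
    then have \<gamma>T: "\<gamma> \<in> ?T" and pat: "pattern ds \<gamma> = pattern ds \<alpha>" by (auto simp: sector_index_def)
    have "decay * (decay ^ l * weight (pattern ds \<alpha>)) \<le> gate_moment \<gamma> \<gamma> * q \<gamma>"
      using q[OF \<gamma>T] pat gate_moment_diag[OF \<gamma>T] gate_moment_nonneg decay_nonneg weight_nonneg[OF pattern_length[OF \<alpha>]]
      by (intro mult_mono) auto
    then have "?c * (decay * (decay ^ l * weight (pattern ds \<alpha>))) \<le> q \<gamma> * ?c * gate_moment \<gamma> \<gamma>"
      using card by (simp add: divide_right_mono mult.commute)
    also have "\<dots> \<le> (\<Sum>\<beta>\<in>?T. q \<beta> * ?c * gate_moment \<gamma> \<beta>)"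
      by (rule member_le_sum[OF \<gamma>T]) (use q0 card gate_moment_nonneg in auto)
    finally show "?c * (decay * (decay ^ l * weight (pattern ds \<alpha>))) \<le> (\<Sum>\<beta>\<in>?T. q \<beta> * ?c * gate_moment \<gamma> \<beta>)" .
  qed
  also have "\<dots> = step q \<alpha>"
    unfolding step_def sum.cartesian_product[symmetric] sum_pattern[symmetric]
    by (intro sum.cong refl) auto
  finally show ?thesis .
qed

lemma circ_second_moment:
  "l \<le> L \<Longrightarrow> \<exists>q. moment_diag l q \<and> (\<forall>\<alpha>\<in>tensor_index ds. decay ^ l * weight (pattern ds \<alpha>) \<le> q \<alpha>)"
proof (induction l)
  case 0
  have "moment_diag 0 (\<lambda>\<alpha>. weight (pattern ds \<alpha>))"
    unfolding moment_diag_def using circ_second_moment_0 by auto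
  then show ?case by (intro exI[of _ "\<lambda>\<alpha>. weight (pattern ds \<alpha>)"]) simp
next
  case (Suc l)
  then obtain q where q: "moment_diag l q" "\<And>\<alpha>. \<alpha> \<in> tensor_index ds \<Longrightarrow> decay ^ l * weight (pattern ds \<alpha>) \<le> q \<alpha>"
    by auto
  show ?case
    by (rule exI[of _ "step q"]) (use moment_diag_step[OF q(1)] step_lower_bound[OF q(2)] Suc.prems in auto)
qed

text \<open>In coordinates, diagonality leaves the sum of
  \<open>(k \<alpha>)\<^sup>2 * q \<alpha>\<close>. Grouped by patterns, the bound on
  \<open>q\<close> turns into \<open>locality_inner\<close>, since \<open>weight\<close> already
  contains the division by the sector dimension.\<close>

theorem second_moment_lower_bound:
  assumes K: "K \<in> carrier_mat D D" "hermitian_mat K"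
  shows "decay ^ L * locality_inner ds (locality ds \<rho>) (locality ds K) \<le>
    expectation (\<lambda>\<omega>. (Re (mat_trace (circ L \<omega> * K)))\<^sup>2)"
proof -
  let ?T = "tensor_index ds"
  define k where "k \<alpha> = Re (mat_trace (tensor_mats \<alpha> * K))" for \<alpha>
  obtain q where q: "moment_diag L q" "\<And>\<alpha>. \<alpha> \<in> ?T \<Longrightarrow> decay ^ L * weight (pattern ds \<alpha>) \<le> q \<alpha>"
    using circ_second_moment[of L] by auto
  \<comment> \<open>With constant test functions the invariant is the plain second moment.\<close>
  have one: "test_fun (\<lambda>_ _ _. 1) (\<lambda>_ _. 1)" by (auto simp: test_fun_def)
  interpret \<nu>: prob_space \<nu> by (rule \<nu>)
  have mom: "expectation (\<lambda>\<omega>. circ_coeff L \<alpha> \<omega> * circ_coeff L \<alpha>' \<omega>) = (if \<alpha> = \<alpha>' then complex_of_real (q \<alpha>) else 0)"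
    if "\<alpha> \<in> ?T" "\<alpha>' \<in> ?T" for \<alpha> \<alpha>'
    using q(1)[unfolded moment_diag_def, rule_format, OF that one]
    by (simp add: rprod_def eprod_def prob_space \<nu>.prob_space)
  have "complex_of_real (expectation (\<lambda>\<omega>. (Re (mat_trace (circ L \<omega> * K)))\<^sup>2)) =
      expectation (\<lambda>\<omega>. \<Sum>\<alpha>\<in>?T. \<Sum>\<alpha>'\<in>?T. complex_of_real (k \<alpha>) * complex_of_real (k \<alpha>') * (circ_coeff L \<alpha> \<omega> * circ_coeff L \<alpha>' \<omega>))"
    unfolding integral_complex_of_real[symmetric]
  proof (rule Bochner_Integration.integral_cong[OF refl])
    fix \<omega> assume \<omega>: "\<omega> \<in> space P"
    note C = circ_carrier[OF order_refl \<omega>]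
    have "mat_trace (circ L \<omega> * K) = complex_of_real (Re (mat_trace (circ L \<omega> * K)))"
      using cnj_mat_trace_hermitian[OF C K(1) hermitian_circ[OF order_refl \<omega>] K(2)] by (simp add: complex_eq_iff)
    then have sq: "complex_of_real ((Re (mat_trace (circ L \<omega> * K)))\<^sup>2) = (mat_trace (circ L \<omega> * K))\<^sup>2"
      by (metis of_real_power)
    have tr: "mat_trace (circ L \<omega> * K) = (\<Sum>\<alpha>\<in>?T. complex_of_real (k \<alpha>) * circ_coeff L \<alpha> \<omega>)"
      unfolding tensor_trace_expand[OF C K(1)]
      by (intro sum.cong refl) (simp add: k_def trace_tensor_real[OF _ K, symmetric] circ_coeff_def)
    show "complex_of_real ((Re (mat_trace (circ L \<omega> * K)))\<^sup>2) =
        (\<Sum>\<alpha>\<in>?T. \<Sum>\<alpha>'\<in>?T. complex_of_real (k \<alpha>) * complex_of_real (k \<alpha>') * (circ_coeff L \<alpha> \<omega> * circ_coeff L \<alpha>' \<omega>))"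
      unfolding sq unfolding tr power2_eq_square sum_product by (simp only: mult_ac)
  qed
  also have "\<dots> = (\<Sum>\<alpha>\<in>?T. \<Sum>\<alpha>'\<in>?T. expectation (\<lambda>\<omega>. complex_of_real (k \<alpha>) * complex_of_real (k \<alpha>') * (circ_coeff L \<alpha> \<omega> * circ_coeff L \<alpha>' \<omega>)))"
    by (rule expectation_double_sum) (auto intro!: bdd_measurable_mult bdd_measurable_circ_coeff)
  also have "\<dots> = (\<Sum>\<alpha>\<in>?T. \<Sum>\<alpha>'\<in>?T. if \<alpha> = \<alpha>' then complex_of_real ((k \<alpha>)\<^sup>2 * q \<alpha>) else 0)"
    by (intro sum.cong refl) (auto simp: mom power2_eq_square)
  also have "\<dots> = complex_of_real (\<Sum>\<alpha>\<in>?T. (k \<alpha>)\<^sup>2 * q \<alpha>)" by simp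
  finally have eq: "expectation (\<lambda>\<omega>. (Re (mat_trace (circ L \<omega> * K)))\<^sup>2) = (\<Sum>\<alpha>\<in>?T. (k \<alpha>)\<^sup>2 * q \<alpha>)"
    using of_real_eq_iff by blast
  have fin: "finite {\<kappa> :: bool list. length \<kappa> = length ds}"
    using finite_lists_length_eq[of "UNIV :: bool set" "length ds"] by simp
  have "decay ^ L * locality_inner ds (locality ds \<rho>) (locality ds K) =
      (\<Sum>\<kappa>\<in>{\<kappa>. length \<kappa> = length ds}. \<Sum>\<alpha>\<in>{\<alpha> \<in> ?T. pattern ds \<alpha> = \<kappa>}. (k \<alpha>)\<^sup>2 * (decay ^ L * weight (pattern ds \<alpha>)))"
    unfolding locality_inner_def sum_distrib_left
  proof (intro sum.cong refl)
    fix \<kappa> :: "bool list" assume "\<kappa> \<in> {\<kappa>. length \<kappa> = length ds}"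
    then have l: "length \<kappa> = length ds" by simp
    have "(\<Sum>\<alpha>\<in>{\<alpha> \<in> ?T. pattern ds \<alpha> = \<kappa>}. (k \<alpha>)\<^sup>2 * (decay ^ L * weight (pattern ds \<alpha>))) =
        (\<Sum>\<alpha>\<in>sector_index ds \<kappa>. (k \<alpha>)\<^sup>2 * (decay ^ L * weight \<kappa>))"
      unfolding sector_index_def by (intro sum.cong) auto
    also have "\<dots> = (\<Sum>\<alpha>\<in>sector_index ds \<kappa>. (k \<alpha>)\<^sup>2) * (decay ^ L * weight \<kappa>)"
      by (simp only: sum_distrib_right)
    finally have "(\<Sum>\<alpha>\<in>{\<alpha> \<in> ?T. pattern ds \<alpha> = \<kappa>}. (k \<alpha>)\<^sup>2 * (decay ^ L * weight (pattern ds \<alpha>))) =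
        locality ds K \<kappa> * (decay ^ L * weight \<kappa>)"
      unfolding locality_hermitian[OF l K] k_def .
    then show "decay ^ L * (locality ds \<rho> \<kappa> * locality ds K \<kappa> / real (sector_dim ds \<kappa>)) =
        (\<Sum>\<alpha>\<in>{\<alpha> \<in> ?T. pattern ds \<alpha> = \<kappa>}. (k \<alpha>)\<^sup>2 * (decay ^ L * weight (pattern ds \<alpha>)))"
      unfolding sector_dim_eq[OF l] by (simp add: weight_def)
  qed
  also have "\<dots> = (\<Sum>\<alpha>\<in>?T. (k \<alpha>)\<^sup>2 * (decay ^ L * weight (pattern ds \<alpha>)))"
    by (rule sum.group[OF finite_tensor_index fin]) (auto simp: pattern_length)
  also have "\<dots> \<le> (\<Sum>\<alpha>\<in>?T. (k \<alpha>)\<^sup>2 * q \<alpha>)"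
    by (intro sum_mono mult_left_mono q(2)) auto
  finally show ?thesis unfolding eq .
qed

text \<open>Subtracting \<open>m\<close> times the identity changes a coordinate by \<open>m\<close>
  times the trace of the basis tensor. That trace vanishes except at the all-identity tensor, and
  there the coordinate of the traceless \<open>H\<close> is 0, so a square can only grow.\<close>

lemma locality_shift_le:
  assumes H: "H \<in> carrier_mat D D" "hermitian_mat H" "mat_trace H = 0" and l: "length \<kappa> = length ds"
  shows "locality ds H \<kappa> \<le> locality ds (H - complex_of_real m \<cdot>\<^sub>m 1\<^sub>m D) \<kappa>"
proof -
  let ?K = "H - complex_of_real m \<cdot>\<^sub>m 1\<^sub>m D"
  have K: "?K \<in> carrier_mat D D" "hermitian_mat ?K"
    using H by (auto simp: hermitian_mat_def mat_adjoint_diff[of _ D D] mat_adjoint_smult)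
  show ?thesis
    unfolding locality_hermitian[OF l H(1,2)] locality_hermitian[OF l K]
  proof (rule sum_mono)
    fix \<alpha> assume "\<alpha> \<in> sector_index ds \<kappa>"
    then have \<alpha>: "\<alpha> \<in> tensor_index ds" using sector_index_subset by auto
    note B = tensor_index_carrier[OF \<alpha>]
    have "tensor_mats \<alpha> * ?K = tensor_mats \<alpha> * H - tensor_mats \<alpha> * (complex_of_real m \<cdot>\<^sub>m 1\<^sub>m D)"
      by (rule mult_minus_distrib_mat[OF B H(1)]) simp
    also have "tensor_mats \<alpha> * (complex_of_real m \<cdot>\<^sub>m 1\<^sub>m D) = complex_of_real m \<cdot>\<^sub>m tensor_mats \<alpha>"
      using B mult_smult_distrib[OF B one_carrier_mat] by simp
    finally have tr: "mat_trace (tensor_mats \<alpha> * ?K) = mat_trace (tensor_mats \<alpha> * H) - complex_of_real m * mat_trace (tensor_mats \<alpha>)"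
      using mat_trace_diff[of "tensor_mats \<alpha> * H" D "complex_of_real m \<cdot>\<^sub>m tensor_mats \<alpha>"] B H
      by (simp add: mat_trace_smult[OF B])
    show "(Re (mat_trace (tensor_mats \<alpha> * H)))\<^sup>2 \<le> (Re (mat_trace (tensor_mats \<alpha> * ?K)))\<^sup>2"
    proof (cases "\<forall>m<length ds. \<alpha> ! m = normid (ds ! m)")
      case True
      have norm: "tensor_mats (map normid ds) = normid (prod_list ds)" for ds
      proof (induction ds)
        case Nil show ?case by (rule eq_matI) (auto simp: normid_def)
      qed (simp add: kronecker_normid)
      have "\<alpha> = map normid ds" using True tensor_index_length[OF \<alpha>] by (intro nth_equalityI) auto
      then have "mat_trace (tensor_mats \<alpha> * H) = 0"
        using norm normid_mult[OF H(1)] mat_trace_smult[OF H(1)] H(3) by simp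
      then show ?thesis by simp
    next
      case False
      then obtain j where j: "j < length ds" "\<alpha> ! j \<noteq> normid (ds ! j)" by auto
      have "mat_trace (\<alpha> ! j) = 0" using mat_trace_block[OF j(1) tensor_index_nth[OF \<alpha> j(1)]] j(2) by simp
      moreover have "\<alpha> ! j \<in> set \<alpha>" using j(1) tensor_index_length[OF \<alpha>] by simp
      ultimately have "mat_trace (tensor_mats \<alpha>) = 0"
        unfolding mat_trace_tensor_mats[OF tensor_index_squareD[OF \<alpha>]]
        by (auto simp: prod_list_zero_iff image_iff intro: bexI[of _ "\<alpha> ! j"])
      then show ?thesis using tr by simp
    qed
  qed
qed

text \<open>With \<open>m\<close> the mean loss, trace preservation and
  \<open>mat_trace \<rho> = 1\<close> show that replacing \<open>H\<close> by \<open>?K\<close>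
  subtracts exactly \<open>m\<close> from the loss.\<close>

theorem loss_variance_lower_bound:
  assumes H: "H \<in> carrier_mat D D" "hermitian_mat H" "mat_trace H = 0" and tr\<rho>: "mat_trace \<rho> = 1"
  shows "decay ^ L * locality_inner ds (locality ds \<rho>) (locality ds H) \<le>
    loss_variance P (length ds) L G \<rho> H U \<phi>"
proof -
  define m where "m = expectation (loss (length ds) L G \<rho> H U \<phi>)"
  let ?K = "H - complex_of_real m \<cdot>\<^sub>m 1\<^sub>m D"
  have K: "?K \<in> carrier_mat D D" "hermitian_mat ?K"
    using H by (auto simp: hermitian_mat_def mat_adjoint_diff[of _ D D] mat_adjoint_smult)
  have "locality_inner ds (locality ds \<rho>) (locality ds H) \<le> locality_inner ds (locality ds \<rho>) (locality ds ?K)"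
    unfolding locality_inner_def
    using locality_shift_le[OF H] locality_nonneg[OF _ \<rho>]
    by (intro sum_mono divide_right_mono mult_left_mono) auto
  then have "decay ^ L * locality_inner ds (locality ds \<rho>) (locality ds H) \<le>
      decay ^ L * locality_inner ds (locality ds \<rho>) (locality ds ?K)"
    by (intro mult_left_mono zero_le_power decay_nonneg)
  also have "\<dots> \<le> expectation (\<lambda>\<omega>. (Re (mat_trace (circ L \<omega> * ?K)))\<^sup>2)"
    by (rule second_moment_lower_bound[OF K])
  also have "\<dots> = loss_variance P (length ds) L G \<rho> H U \<phi>"
    unfolding loss_variance_def m_def[symmetric]
  proof (rule Bochner_Integration.integral_cong[OF refl])
    fix \<omega> assume \<omega>: "\<omega> \<in> space P"
    note C = circ_carrier[OF order_refl \<omega>]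
    have "circ L \<omega> * ?K = circ L \<omega> * H - circ L \<omega> * (complex_of_real m \<cdot>\<^sub>m 1\<^sub>m D)"
      by (rule mult_minus_distrib_mat[OF C H(1)]) simp
    also have "circ L \<omega> * (complex_of_real m \<cdot>\<^sub>m 1\<^sub>m D) = complex_of_real m \<cdot>\<^sub>m circ L \<omega>"
      using C mult_smult_distrib[OF C one_carrier_mat] by simp
    finally have "mat_trace (circ L \<omega> * ?K) = mat_trace (circ L \<omega> * H) - complex_of_real m"
      using mat_trace_diff[of "circ L \<omega> * H" D "complex_of_real m \<cdot>\<^sub>m circ L \<omega>"] C H mat_trace_circ[OF order_refl \<omega>] tr\<rho>
      by (simp add: mat_trace_smult[OF C])
    then show "(Re (mat_trace (circ L \<omega> * ?K)))\<^sup>2 = (loss (length ds) L G \<rho> H U \<phi> \<omega> - m)\<^sup>2"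
      by (simp add: loss_def)
  qed
  finally show ?thesis .
qed

end

subsection \<open>Asymptotics\<close>

text \<open>From (1 - x) (1 + 2 x) = 1 + x (1 - 2 x) and 1 + 2 x <= exp (2 x).\<close>

lemma exp_le_one_minus: "0 \<le> x \<Longrightarrow> x \<le> 1 / 2 \<Longrightarrow> exp (- 2 * x) \<le> 1 - (x :: real)"
proof -
  assume x: "0 \<le> x" "x \<le> 1 / 2"
  have "1 \<le> (1 - x) * (1 + 2 * x)"
    using mult_nonneg_nonneg[of x "1 - 2 * x"] x by (simp add: algebra_simps)
  also have "\<dots> \<le> (1 - x) * exp (2 * x)"
    using x exp_ge_add_one_self[of "2 * x"] by (intro mult_left_mono) auto
  finally show ?thesis by (simp add: exp_minus field_simps)
qed

text \<open>The number of layers outgrows ln n, so \<open>s n\<close> eventually is at most 1/4.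
  Then 1 - 2 s >= exp (- 4 s), and the power is at least exp (- 4 C ln n), which gives the exponent
  \<open>4 * C\<close>.\<close>

lemma inverse_poly_bounded_decay:
  fixes s :: "nat \<Rightarrow> real" and L :: "nat \<Rightarrow> nat"
  assumes s: "\<And>n. 0 \<le> s n" and small: "(\<lambda>n. s n * real (L n)) \<in> O(\<lambda>n. ln (real n))"
    and \<epsilon>: "0 < \<epsilon>" and many: "(\<lambda>n. real (L n)) \<in> \<Omega>(\<lambda>n. ln (real n) powr (1 + \<epsilon>))"
  shows "inverse_poly_bounded (\<lambda>n. (max 0 (1 - 2 * s n)) ^ L n)"
proof -
  obtain C where C: "C > 0" "\<forall>\<^sub>F n in sequentially. norm (s n * real (L n)) \<le> C * norm (ln (real n))"
    using small by (elim landau_o.bigE)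
  obtain c where c: "c > 0" "\<forall>\<^sub>F n in sequentially. c * norm (ln (real n) powr (1 + \<epsilon>)) \<le> norm (real (L n))"
    using many by (elim landau_omega.bigE)
  have lim: "filterlim (\<lambda>n. ln (real n)) at_top sequentially"
    by (rule filterlim_compose[OF ln_at_top filterlim_real_sequentially])
  \<comment> \<open>The threshold is chosen so that its power \<open>\<epsilon>\<close> is 4 C / c,
    the ratio that yields L n >= 4 C ln n below.\<close>
  have "\<forall>\<^sub>F n in sequentially. (4 * C / c) powr (1 / \<epsilon>) \<le> ln (real n)"
    using lim by (simp add: filterlim_at_top)
  then have big: "\<forall>\<^sub>F n in sequentially. 4 * C / c \<le> ln (real n) powr \<epsilon>"
  proof eventually_elim
    case (elim n)
    have "4 * C / c = ((4 * C / c) powr (1 / \<epsilon>)) powr \<epsilon>"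
      using C(1) c(1) \<epsilon> by (simp add: powr_powr)
    also have "\<dots> \<le> ln (real n) powr \<epsilon>"
      using elim \<epsilon> by (intro powr_mono2) auto
    finally show ?case .
  qed
  have "\<forall>\<^sub>F n in sequentially. 1 \<le> ln (real n)" using lim by (simp add: filterlim_at_top)
  then have "\<forall>\<^sub>F n in sequentially. 1 * real n powr (- (4 * C)) \<le> (max 0 (1 - 2 * s n)) ^ L n"
    using C(2) c(2) big eventually_gt_at_top[of 0]
  proof eventually_elim
    case (elim n)
    define l where "l = ln (real n)"
    have l: "1 \<le> l" using elim by (simp add: l_def)
    have sL: "s n * real (L n) \<le> C * l"
      using elim(2) l s[of n] by (simp add: l_def)
    have "c * l powr \<epsilon> * l \<le> real (L n)"
      using elim(3) l by (simp add: l_def powr_add mult_ac)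
    moreover have "c * (4 * C / c) * l \<le> c * l powr \<epsilon> * l"
      using elim(4) c(1) l by (intro mult_right_mono mult_left_mono) (auto simp: l_def)
    ultimately have L: "4 * (C * l) \<le> real (L n)" using c(1) by simp
    have Lpos: "real (L n) > 0" using L C(1) l by (smt (verit) mult_pos_pos)
    have "4 * (s n * real (L n)) \<le> 1 * real (L n)" using sL L by linarith
    \<comment> \<open>This is the hypothesis x <= 1/2 of \<open>exp_le_one_minus\<close> at x = 2
      s.\<close>
    then have s4: "4 * s n \<le> 1" using Lpos by (metis mult.assoc mult_le_cancel_right_pos)
    have "real n powr (- (4 * C)) = exp (- (4 * C * l))"
      using elim(5) by (simp add: powr_def l_def)
    also have "\<dots> \<le> exp (- 2 * (2 * s n) * real (L n))"
      using sL by simp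
    also have "\<dots> = exp (- 2 * (2 * s n)) ^ L n"
      by (simp add: exp_of_nat_mult[symmetric] mult_ac)
    also have "\<dots> \<le> (max 0 (1 - 2 * s n)) ^ L n"
      using exp_le_one_minus[of "2 * s n"] s[of n] s4 by (intro power_mono) auto
    finally show ?case by simp
  qed
  then show ?thesis
    unfolding inverse_poly_bounded_def using C(1) by (intro exI[of _ 1] conjI exI[of _ "4 * C"]) auto
qed

theorem mainTheorem4:
  fixes qs :: "nat \<Rightarrow> nat list"
    and \<rho> H G :: "nat \<Rightarrow> complex mat"
    and L :: "nat \<Rightarrow> nat"
    and \<nu> :: "nat \<Rightarrow> real measure"
    and \<mu> \<sigma> :: "nat \<Rightarrow> real"
    and P :: "nat \<Rightarrow> 'w measure"
    and U :: "nat \<Rightarrow> nat \<Rightarrow> nat \<Rightarrow> 'w \<Rightarrow> complex mat"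
    and \<phi> :: "nat \<Rightarrow> nat \<Rightarrow> 'w \<Rightarrow> real"
    and \<epsilon> :: real
  assumes blocks: "\<And>n. sum_list (qs n) = n \<and> (\<forall>k \<in> set (qs n). 1 \<le> k)"
    and state: "\<And>n. density_mat (2 ^ n) (\<rho> n)"
    and observable: "\<And>n. H n \<in> carrier_mat (2 ^ n) (2 ^ n) \<and> hermitian_mat (H n) \<and>
          mat_trace (H n) = 0"
    and generator: "\<And>n. G n \<in> carrier_mat (2 ^ n) (2 ^ n) \<and> hermitian_mat (G n)"
    and initialization: "\<And>n. real_distribution (\<nu> n) \<and>
          integrable (\<nu> n) (\<lambda>x. x) \<and> integrable (\<nu> n) (\<lambda>x. x\<^sup>2) \<and>
          prob_space.expectation (\<nu> n) (\<lambda>x. x) = \<mu> n \<and>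
          prob_space.variance (\<nu> n) (\<lambda>x. x) = (\<sigma> n)\<^sup>2"
    and random: "\<And>n. random_layered_circuit (P n) (qubit_dims (qs n)) (L n) (\<nu> n) (U n) (\<phi> n)"
    and mean_zero: "\<And>n. \<mu> n = 0"
    and small_variance: "(\<lambda>n. (\<sigma> n)\<^sup>2 * ((hs_norm (G n))\<^sup>2 * real (L n))) \<in> O(\<lambda>n. ln (real n))"
    and many_layers: "0 < \<epsilon>" "(\<lambda>n. real (L n)) \<in> \<Omega>(\<lambda>n. ln (real n) powr (1 + \<epsilon>))"
  shows "\<exists>F. inverse_poly_bounded F \<and>
           (\<forall>n. F n * locality_inner (qubit_dims (qs n))
                  (locality (qubit_dims (qs n)) (\<rho> n)) (locality (qubit_dims (qs n)) (H n))
                \<le> loss_variance (P n) (length (qs n)) (L n) (G n) (\<rho> n) (H n) (U n) (\<phi> n))"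
proof (intro exI conjI allI)
  let ?s = "\<lambda>n. (\<sigma> n)\<^sup>2 * (hs_norm (G n))\<^sup>2"
  show "inverse_poly_bounded (\<lambda>n. (max 0 (1 - 2 * ?s n)) ^ L n)"
    using small_variance by (intro inverse_poly_bounded_decay[OF _ _ many_layers]) (simp_all add: mult.assoc)
  fix n
  have dims: "prod_list (qubit_dims ks) = 2 ^ sum_list ks" for ks
    by (induction ks) (auto simp: qubit_dims_def power_add)
  have D: "prod_list (qubit_dims (qs n)) = 2 ^ n" using blocks dims by simp
  interpret \<nu>: real_distribution "\<nu> n" using initialization by blast
  have m0: "\<nu>.expectation (\<lambda>x. x) = 0"
    using initialization[of n] mean_zero[of n] by simp
  \<comment> \<open>Mean zero turns the variance into the raw second moment that
    \<open>layered_circuit\<close> asks for.\<close>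
  have "\<nu>.variance (\<lambda>x. x) = (\<sigma> n)\<^sup>2"
    using initialization[of n] by blast
  then have "(\<integral>x. x\<^sup>2 \<partial>\<nu> n) = (\<sigma> n)\<^sup>2"
    unfolding m0 by simp
  moreover have "qubit_block d" if "d \<in> set (qubit_dims (qs n))" for d
    using that by (auto simp: qubit_dims_def qubit_block_def)
  ultimately have "layered_circuit (P n) (qubit_dims (qs n)) (L n) (\<nu> n) (U n) (\<phi> n) (G n) (\<rho> n) (\<sigma> n)"
    using random[of n] generator[of n] state[of n] initialization[of n] \<nu>.prob_space_axioms
    by (intro layered_circuit.intro qubit_blocks.intro layered_circuit_axioms.intro)
      (auto simp only: D density_mat_def \<nu>.events_eq_borel)
  then interpret layered_circuit "P n" "qubit_dims (qs n)" "L n" "\<nu> n" "U n" "\<phi> n" "G n" "\<rho> n" "\<sigma> n" .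
  show "(max 0 (1 - 2 * ?s n)) ^ L n * locality_inner (qubit_dims (qs n))
      (locality (qubit_dims (qs n)) (\<rho> n)) (locality (qubit_dims (qs n)) (H n))
    \<le> loss_variance (P n) (length (qs n)) (L n) (G n) (\<rho> n) (H n) (U n) (\<phi> n)"
    using loss_variance_lower_bound[of "H n"] observable[of n] state[of n]
    unfolding decay_def D density_mat_def by (simp add: qubit_dims_def)
qed

end
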